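(* Let $g$ be a $d$-variate, $(\beta,C)$-smooth function. There exist universal constants $c_1,\dots,c_5$ depending only on $d,\beta,C$ such that for arbitrary $N\in\mathbb N^+\setminus\{1\}$ there exists a deep ReLU network $g^\dagger\in\mathcal G(c_1,d,1,c_2N,\infty,c_3N^{c_4})$ satisfying $$\|g^\dagger-g\|_{\infty,[0,1]^d}\le c_5N^{-2\beta/d}.$$ Furthermore, suppose $g\in\mathcal H(d,l,\mathcal P)$ with $\sup_{(\beta,t)\in\mathcal P}(\beta\vee t)<\infty$ and $g$ is supported on $[-c_6,c_6]^d$ for some constant $c_6$. Then there also exist universal constants $c_7,\dots,c_{11}$ such that for arbitrary $N\in\mathbb N^+\setminus\{1\}$ there exists a deep ReLU network $g^\dagger\in\mathcal G(c_7,d,1,c_8N,\infty,c_9N^{c_{10}})$ satisfying $$\|g^\dagger-g\|_{\infty,[-c_6,c_6]^d}\le c_{11}N^{-\inf_{(\beta,t)\in\mathcal P}(2\beta/t)}.$$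
   Context: $\|h\|_{\infty,A}=\sup_{x\in A}|h(x)|$. Deep ReLU network class: $\mathcal G(L,d_{in},d_{out},N,M,B)$ is the set of functions $z\mapsto\bar T_M(g(z))$ from $\mathbb R^{d_{in}}$ to $\mathbb R^{d_{out}}$, where $g=\mathcal L_{L+1}\circ\bar\sigma\circ\mathcal L_L\circ\cdots\circ\bar\sigma\circ\mathcal L_1$ (depth $L$, width $N$), $\mathcal L_\ell(z)=W_\ell z+b_\ell$ with $W_\ell\in\mathbb R^{d_\ell\times d_{\ell-1}}$, $b_\ell\in\mathbb R^{d_\ell}$, $d_0=d_{in}$, $d_1=\dots=d_L=N$, $d_{L+1}=d_{out}$, and all entries of $W_\ell,b_\ell$ bounded by $B$ in absolute value; $\bar\sigma$ applies $\sigma(x)=\max\{x,0\}$ entrywise and $\bar T_M$ truncates each entry at level $M$ (no truncation if $M=\infty$). $(\beta,C)$-smoothness: with $\beta=q+s$, $q\ge0$ an integer, $0<s\le1$, $C>0$, a $d$-variate function $h$ is $(\beta,C)$-smooth if for every $\alpha\in\mathbb N^d$ with $\sum_j\alpha_j=q$ the partial derivative $\partial^\alpha h$ exists and $|\partial^\alpha h(x)-\partial^\alpha h(z)|\le C\|x-z\|_2^s$ for all $x,z$. Hierarchical composition class: $l,d\in\mathbb N^+$, $\mathcal P\subset[1,\infty)\times\mathbb N^+$ (a given finite set), $C>0$ fixed. $\mathcal H(d,1,\mathcal P)$ is the set of $h:\mathbb R^d\to\mathbb R$, $h(x)=g(x_{\pi(1)},\dots,x_{\pi(t)})$ with $g:\mathbb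 R^t\to\mathbb R$ $(\beta,C)$-smooth for some $(\beta,t)\in\mathcal P$ and $\pi:\{1,\dots,t\}\to\{1,\dots,d\}$. For $l>1$, $\mathcal H(d,l,\mathcal P)$ is the set of $h(x)=g(f_1(x),\dots,f_t(x))$ with $g:\mathbb R^t\to\mathbb R$ $(\beta,C)$-smooth for some $(\beta,t)\in\mathcal P$ and $f_i\in\mathcal H(d,l-1,\mathcal P)$. "Universal constants" for this class may depend on the fixed quantities $d,l,\mathcal P,C,c_6$ but not on $N$.
   Formalization: The constants c_3, c_5 (and c_9, c_11) may also depend on a bound R for the sup norm on the unit cube of g (of the smooth constituents of the composition); with no such dependence the claim fails, e.g. for large constant functions g. *)

theory Defs
  imports
    "Jordan_Normal_Form.Matrix"
    "HOL-Analysis.L2_Norm"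
    "HOL-Library.Extended_Real"
begin

text \<open>
  Points of \<open>\<real>\<^sup>n\<close> are elements of \<^term>\<open>carrier_vec n\<close>, since the dimensions \<open>t\<close> and the
  network widths vary inside the statement. Functions on \<open>\<real>\<^sup>n\<close> are total on \<open>real vec\<close>, but every
  definition below looks only at their values on \<^term>\<open>carrier_vec n\<close>. Coordinates are indexed
  by \<open>{..<n}\<close>.
\<close>

definition box :: "nat \<Rightarrow> real \<Rightarrow> real \<Rightarrow> real vec set" where
  "box n a b = {x \<in> carrier_vec n. \<forall>i<n. a \<le> x $ i \<and> x $ i \<le> b}"

definition sup_norm_on :: "real vec set \<Rightarrow> (real vec \<Rightarrow> real) \<Rightarrow> ereal" where
  "sup_norm_on A h = (SUP x\<in>A. ereal \<bar>h x\<bar>)"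


section \<open>Deep ReLU networks\<close>

definition relu :: "real \<Rightarrow> real" where
  "relu x = max x 0"

definition trunc_at :: "ereal \<Rightarrow> real \<Rightarrow> real" where
  "trunc_at M y = sgn y * real_of_ereal (min (ereal \<bar>y\<bar>) M)"

lemma trunc_at_infinity [simp]: "trunc_at \<infinity> y = y"
  by (simp add: trunc_at_def sgn_mult_abs)

definition affine :: "real mat \<Rightarrow> real vec \<Rightarrow> real vec \<Rightarrow> real vec" where
  "affine W b z = W *\<^sub>v z + b"

primrec hidden_layers ::
  "(nat \<Rightarrow> real mat) \<Rightarrow> (nat \<Rightarrow> real vec) \<Rightarrow> nat \<Rightarrow> real vec \<Rightarrow> real vec" where
  "hidden_layers W b 0 z = z"
| "hidden_layers W b (Suc k) z =
     map_vec relu (affine (W (Suc k)) (b (Suc k)) (hidden_layers W b k z))"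

definition network ::
  "(nat \<Rightarrow> real mat) \<Rightarrow> (nat \<Rightarrow> real vec) \<Rightarrow> nat \<Rightarrow> real vec \<Rightarrow> real vec" where
  "network W b L z = affine (W (L + 1)) (b (L + 1)) (hidden_layers W b L z)"

definition layer_dim :: "nat \<Rightarrow> nat \<Rightarrow> nat \<Rightarrow> nat \<Rightarrow> nat \<Rightarrow> nat" where
  "layer_dim L din dout N k = (if k = 0 then din else if k \<le> L then N else dout)"

definition relu_networks ::
  "nat \<Rightarrow> nat \<Rightarrow> nat \<Rightarrow> nat \<Rightarrow> ereal \<Rightarrow> real \<Rightarrow> (real vec \<Rightarrow> real vec) set" where
  "relu_networks L din dout N M B =
     {f. \<exists>W b.
        (\<forall>k\<in>{1..L + 1}.
           W k \<in> carrier_mat (layer_dim L din dout N k) (layer_dim L din dout N (k - 1)) \<and>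
           b k \<in> carrier_vec (layer_dim L din dout N k) \<and>
           (\<forall>i<layer_dim L din dout N k.
              \<bar>b k $ i\<bar> \<le> B \<and>
              (\<forall>j<layer_dim L din dout N (k - 1). \<bar>W k $$ (i, j)\<bar> \<le> B))) \<and>
        (\<forall>z\<in>carrier_vec din. f z = map_vec (trunc_at M) (network W b L z))}"


section \<open>Smooth functions\<close>

definition has_partial ::
  "nat \<Rightarrow> nat \<Rightarrow> (real vec \<Rightarrow> real) \<Rightarrow> (real vec \<Rightarrow> real) \<Rightarrow> bool" where
  "has_partial n i h h' \<longleftrightarrow>
     (\<forall>x\<in>carrier_vec n.
        ((\<lambda>u. h (x + u \<cdot>\<^sub>v unit_vec n i)) has_real_derivative h' x) (at 0))"

primrec has_iterated_partial ::
  "nat \<Rightarrow> nat list \<Rightarrow> (real vec \<Rightarrow> real) \<Rightarrow> (real vec \<Rightarrow> real) \<Rightarrow> bool" where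
  "has_iterated_partial n [] h h' \<longleftrightarrow> (\<forall>x\<in>carrier_vec n. h' x = h x)"
| "has_iterated_partial n (i # is) h h' \<longleftrightarrow>
     (\<exists>k. has_partial n i h k \<and> has_iterated_partial n is k h')"

text \<open>
  \<open>has_multi_partial n \<alpha> h h'\<close>: the partial derivative of multi-index \<open>\<alpha>\<close> exists and equals \<open>h'\<close>,
  in whichever order the \<open>\<alpha> 0 + \<dots> + \<alpha> (n - 1)\<close> differentiations are carried out.
\<close>

definition has_multi_partial ::
  "nat \<Rightarrow> (nat \<Rightarrow> nat) \<Rightarrow> (real vec \<Rightarrow> real) \<Rightarrow> (real vec \<Rightarrow> real) \<Rightarrow> bool" where
  "has_multi_partial n \<alpha> h h' \<longleftrightarrow>
     (\<forall>is. set is \<subseteq> {..<n} \<and> (\<forall>j<n. count_list is j = \<alpha> j) \<longrightarrow>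
        has_iterated_partial n is h h')"

definition holder_smooth :: "nat \<Rightarrow> real \<Rightarrow> real \<Rightarrow> (real vec \<Rightarrow> real) \<Rightarrow> bool" where
  "holder_smooth n \<beta> C h \<longleftrightarrow>
     (\<exists>(q::nat) (s::real). \<beta> = real q + s \<and> 0 < s \<and> s \<le> 1 \<and>
        (\<forall>\<alpha>. (\<Sum>j<n. \<alpha> j) = q \<longrightarrow>
           (\<exists>h'. has_multi_partial n \<alpha> h h' \<and>
              (\<forall>x\<in>carrier_vec n. \<forall>z\<in>carrier_vec n.
                 \<bar>h' x - h' z\<bar> \<le> C * L2_set (\<lambda>i. x $ i - z $ i) {..<n} powr s))))"


section \<open>Hierarchical compositions\<close>

text \<open>
  The hierarchical class, in which moreover every constituent \<open>g\<close> satisfies \<open>\<bar>g\<bar> \<le> R\<close> on the unit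
  cube. For \<open>R = \<infinity>\<close> this is no restriction. Since a smooth function is bounded on the unit cube, the
  classes with finite \<open>R\<close> exhaust the unrestricted one (lemma \<open>hier_comp_eq_Union\<close>). The level
  \<open>l\<close> starts at 1; level 0 is a dummy.
\<close>

fun hier_comp_bounded ::
  "ereal \<Rightarrow> real \<Rightarrow> (real \<times> nat) set \<Rightarrow> nat \<Rightarrow> nat \<Rightarrow> (real vec \<Rightarrow> real) set" where
  "hier_comp_bounded R C P d 0 = {}"
| "hier_comp_bounded R C P d (Suc 0) =
     {h. \<exists>\<beta> t g \<pi>. (\<beta>, t) \<in> P \<and> holder_smooth t \<beta> C g \<and> sup_norm_on (box t 0 1) g \<le> R \<and>
        (\<forall>j<t. \<pi> j < d) \<and>
        (\<forall>x\<in>carrier_vec d. h x = g (vec t (\<lambda>j. x $ \<pi> j)))}"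
| "hier_comp_bounded R C P d (Suc (Suc l)) =
     {h. \<exists>\<beta> t g f. (\<beta>, t) \<in> P \<and> holder_smooth t \<beta> C g \<and> sup_norm_on (box t 0 1) g \<le> R \<and>
        (\<forall>j<t. f j \<in> hier_comp_bounded R C P d (Suc l)) \<and>
        (\<forall>x\<in>carrier_vec d. h x = g (vec t (\<lambda>j. f j x)))}"

definition hier_comp ::
  "real \<Rightarrow> (real \<times> nat) set \<Rightarrow> nat \<Rightarrow> nat \<Rightarrow> (real vec \<Rightarrow> real) set" where
  "hier_comp C P d l = hier_comp_bounded \<infinity> C P d l"


subsection \<open>The bounded classes exhaust the hierarchical class\<close>

lemma has_partial_unique:
  assumes "has_partial n i h a" "has_partial n i h' b" "\<forall>x\<in>carrier_vec n. h x = h' x"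
    and x: "x \<in> carrier_vec n"
  shows "a x = b x"
proof -
  have "h (x + u \<cdot>\<^sub>v unit_vec n i) = h' (x + u \<cdot>\<^sub>v unit_vec n i)" for u
    using assms(3) x by simp
  moreover have "((\<lambda>u. h (x + u \<cdot>\<^sub>v unit_vec n i)) has_real_derivative a x) (at 0)"
    using assms(1) x by (simp add: has_partial_def)
  moreover have "((\<lambda>u. h' (x + u \<cdot>\<^sub>v unit_vec n i)) has_real_derivative b x) (at 0)"
    using assms(2) x by (simp add: has_partial_def)
  ultimately show ?thesis by (simp add: DERIV_unique)
qed

lemma has_iterated_partial_unique:
  assumes "has_iterated_partial n is h a" "has_iterated_partial n is h' b"
    and "\<forall>x\<in>carrier_vec n. h x = h' x"
  shows "\<forall>x\<in>carrier_vec n. a x = b x"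
  using assms
proof (induction "is" arbitrary: h h')
  case (Cons i "is")
  then obtain k k' where k: "has_partial n i h k" "has_iterated_partial n is k a"
      "has_partial n i h' k'" "has_iterated_partial n is k' b"
    by auto
  have "\<forall>x\<in>carrier_vec n. k x = k' x"
    using has_partial_unique[OF k(1,3) Cons.prems(3)] by blast
  then show ?case using Cons.IH[OF k(2,4)] by blast
qed simp

lemma has_iterated_partial_append:
  assumes "has_iterated_partial n (xs @ ys) h a"
  shows "\<exists>k. has_iterated_partial n xs h k \<and> has_iterated_partial n ys k a"
  using assms
proof (induction xs arbitrary: h)
  case Nil
  then show ?case by (intro exI[of _ h]) simp
next
  case (Cons i xs)
  then obtain m where m: "has_partial n i h m" "has_iterated_partial n (xs @ ys) m a"
    by auto
  obtain k where "has_iterated_partial n xs m k" "has_iterated_partial n ys k a"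
    using Cons.IH[OF m(2)] by blast
  then show ?case using m(1) by (intro exI[of _ k]) auto
qed

lemma bounded_of_partials:
  assumes m: "\<And>i. i < n \<Longrightarrow> has_partial n i f (m i)"
    and M: "\<And>i x. i < n \<Longrightarrow> x \<in> box n 0 1 \<Longrightarrow> \<bar>m i x\<bar> \<le> M"
    and x: "x \<in> box n 0 1"
  shows "\<bar>f x\<bar> \<le> \<bar>f (0\<^sub>v n)\<bar> + real n * M"
proof -
  define X where "X k = vec n (\<lambda>j. if j < k then x $ j else 0)" for k
  have xc: "x \<in> carrier_vec n" and xb: "\<And>i. i < n \<Longrightarrow> 0 \<le> x $ i \<and> x $ i \<le> 1"
    using x by (auto simp: box_def)
  have "\<bar>f (X k)\<bar> \<le> \<bar>f (0\<^sub>v n)\<bar> + real k * M" if "k \<le> n" for k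
    using that
  proof (induction k)
    case 0
    have "X 0 = 0\<^sub>v n" by (auto simp: X_def)
    then show ?case by simp
  next
    case (Suc k)
    then have k: "k < n" by simp
    define \<phi> where "\<phi> u = f (X k + u \<cdot>\<^sub>v unit_vec n k)" for u
    define y where "y u = X k + u \<cdot>\<^sub>v unit_vec n k" for u
    have yc: "y u \<in> carrier_vec n" for u by (auto simp: y_def X_def)
    have D: "(\<phi> has_real_derivative m k (y u)) (at u)" for u
    proof -
      have "((\<lambda>v. f (y u + v \<cdot>\<^sub>v unit_vec n k)) has_real_derivative m k (y u)) (at 0)"
        using m[OF k] yc unfolding has_partial_def by blast
      moreover have "y u + v \<cdot>\<^sub>v unit_vec n k = X k + (v + u) \<cdot>\<^sub>v unit_vec n k" for v
        by (auto simp: y_def X_def algebra_simps)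
      ultimately have "((\<lambda>v. \<phi> (v + u)) has_real_derivative m k (y u)) (at 0)"
        by (simp add: \<phi>_def)
      then show ?thesis using DERIV_shift[of \<phi> "m k (y u)" 0 u] by simp
    qed
    have y_box: "y u \<in> box n 0 1" if "0 \<le> u" "u \<le> x $ k" for u
    proof -
      have "0 \<le> y u $ i \<and> y u $ i \<le> 1" if "i < n" for i
        using that xb[OF that] xb[OF k] \<open>0 \<le> u\<close> \<open>u \<le> x $ k\<close> k
        by (auto simp: y_def X_def unit_vec_def)
      then show ?thesis using yc by (auto simp: box_def)
    qed
    have M0: "0 \<le> M" using M[OF k x] by linarith
    have step: "\<bar>\<phi> (x $ k) - \<phi> 0\<bar> \<le> M"
    proof (cases "x $ k = 0")
      case True
      then show ?thesis using M0 by simp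
    next
      case False
      then have pos: "0 < x $ k" using xb[OF k] by simp
      obtain z where z: "0 < z" "z < x $ k" "\<phi> (x $ k) - \<phi> 0 = (x $ k - 0) * m k (y z)"
        using MVT2[OF pos, of \<phi> "\<lambda>u. m k (y u)"] D by blast
      have "\<bar>\<phi> (x $ k) - \<phi> 0\<bar> = x $ k * \<bar>m k (y z)\<bar>"
        using z pos by (simp add: abs_mult)
      also have "\<dots> \<le> 1 * M"
        using M[OF k y_box] z xb[OF k] by (intro mult_mono) auto
      finally show ?thesis by simp
    qed
    have "X (Suc k) = X k + x $ k \<cdot>\<^sub>v unit_vec n k"
      using k by (intro eq_vecI) (auto simp: X_def unit_vec_def less_Suc_eq)
    moreover have "X k = X k + 0 \<cdot>\<^sub>v unit_vec n k" by (auto simp: X_def)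
    ultimately have "\<bar>f (X (Suc k)) - f (X k)\<bar> \<le> M" using step by (simp add: \<phi>_def)
    then show ?case using Suc by (simp add: algebra_simps)
  qed
  from this[of n] have "\<bar>f (X n)\<bar> \<le> \<bar>f (0\<^sub>v n)\<bar> + real n * M" by simp
  moreover have "X n = x" using xc by (auto simp: X_def)
  ultimately show ?thesis by simp
qed

lemma holder_smooth_bounded:
  assumes "holder_smooth n \<beta> C h"
  shows "\<exists>R. \<forall>x\<in>box n 0 1. \<bar>h x\<bar> \<le> R"
proof (cases "n = 0")
  case True
  have "x = 0\<^sub>v 0" if "x \<in> box n 0 1" for x
    using that True by (auto simp: box_def)
  then show ?thesis by (intro exI[of _ "\<bar>h (0\<^sub>v 0)\<bar>"]) auto
next
  case False
  obtain q s where s: "0 < s" and H: "\<And>\<alpha>. (\<Sum>j<n. \<alpha> j) = q \<Longrightarrow>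
           (\<exists>h'. has_multi_partial n \<alpha> h h' \<and>
              (\<forall>x\<in>carrier_vec n. \<forall>z\<in>carrier_vec n.
                 \<bar>h' x - h' z\<bar> \<le> C * L2_set (\<lambda>i. x $ i - z $ i) {..<n} powr s))"
    using assms unfolding holder_smooth_def by blast
  have top: "\<exists>h'. has_iterated_partial n is h h' \<and>
      (\<forall>x\<in>carrier_vec n. \<forall>z\<in>carrier_vec n.
         \<bar>h' x - h' z\<bar> \<le> C * L2_set (\<lambda>i. x $ i - z $ i) {..<n} powr s)"
    if "set is \<subseteq> {..<n}" "length is = q" for "is"
  proof -
    have "(\<Sum>j<n. count_list is j) = (\<Sum>j\<in>set is. count_list is j)"
      using that(1) by (intro sum.mono_neutral_right) (auto simp: count_list_0_iff)
    also have "\<dots> = q" using that(2) by (simp add: sum_count_set)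
    finally show ?thesis
      using H[of "count_list is"] that(1) unfolding has_multi_partial_def by blast
  qed
  have "\<forall>is h'. set is \<subseteq> {..<n} \<and> length is = q - k \<and> has_iterated_partial n is h h' \<longrightarrow>
      (\<exists>R. \<forall>x\<in>box n 0 1. \<bar>h' x\<bar> \<le> R)" if "k \<le> q" for k
    using that
  proof (induction k)
    case 0
    show ?case
    proof (intro allI impI)
      fix "is" h'
      assume *: "set is \<subseteq> {..<n} \<and> length is = q - 0 \<and> has_iterated_partial n is h h'"
      then obtain g where g: "has_iterated_partial n is h g"
        and gh: "\<forall>x\<in>carrier_vec n. \<forall>z\<in>carrier_vec n.
           \<bar>g x - g z\<bar> \<le> C * L2_set (\<lambda>i. x $ i - z $ i) {..<n} powr s"
        using top[of "is"] by auto
      have eq: "\<forall>x\<in>carrier_vec n. h' x = g x"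
        using has_iterated_partial_unique * g by blast
      have "\<bar>h' x\<bar> \<le> \<bar>g (0\<^sub>v n)\<bar> + \<bar>C\<bar> * real n powr s" if x: "x \<in> box n 0 1" for x
      proof -
        have xc: "x \<in> carrier_vec n" using x by (simp add: box_def)
        have "L2_set (\<lambda>i. x $ i - 0\<^sub>v n $ i) {..<n} \<le> (\<Sum>i<n. \<bar>x $ i - 0\<^sub>v n $ i\<bar>)"
          by (rule L2_set_le_sum_abs)
        also have "\<dots> \<le> (\<Sum>i<n. 1)"
          using x by (intro sum_mono) (auto simp: box_def)
        finally have "L2_set (\<lambda>i. x $ i - 0\<^sub>v n $ i) {..<n} powr s \<le> real n powr s"
          using s by (intro powr_mono2) (auto simp: L2_set_nonneg)
        then have "\<bar>C\<bar> * L2_set (\<lambda>i. x $ i - 0\<^sub>v n $ i) {..<n} powr s \<le> \<bar>C\<bar> * real n powr s"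
          by (intro mult_left_mono) auto
        moreover have "C * L2_set (\<lambda>i. x $ i - 0\<^sub>v n $ i) {..<n} powr s
            \<le> \<bar>C\<bar> * L2_set (\<lambda>i. x $ i - 0\<^sub>v n $ i) {..<n} powr s"
          by (intro mult_right_mono) auto
        moreover have "\<bar>g x - g (0\<^sub>v n)\<bar>
            \<le> C * L2_set (\<lambda>i. x $ i - 0\<^sub>v n $ i) {..<n} powr s"
          using gh xc by simp
        ultimately show ?thesis using eq xc by fastforce
      qed
      then show "\<exists>R. \<forall>x\<in>box n 0 1. \<bar>h' x\<bar> \<le> R" by blast
    qed
  next
    case (Suc k)
    show ?case
    proof (intro allI impI)
      fix "is" h'
      assume *: "set is \<subseteq> {..<n} \<and> length is = q - Suc k \<and> has_iterated_partial n is h h'"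
      have "\<exists>m M. has_partial n i h' m \<and> (\<forall>x\<in>box n 0 1. \<bar>m x\<bar> \<le> M)" if i: "i < n" for i
      proof -
        have "set ((is @ [i]) @ replicate k 0) \<subseteq> {..<n}" using * i False by auto
        moreover have "length ((is @ [i]) @ replicate k 0) = q" using * Suc.prems by simp
        ultimately obtain g where "has_iterated_partial n ((is @ [i]) @ replicate k 0) h g"
          using top by blast
        then obtain m where m: "has_iterated_partial n (is @ [i]) h m"
          using has_iterated_partial_append by blast
        have "\<exists>M. \<forall>x\<in>box n 0 1. \<bar>m x\<bar> \<le> M"
        proof -
          have "set (is @ [i]) \<subseteq> {..<n} \<and> length (is @ [i]) = q - k"
            using * i Suc.prems by auto
          moreover have "k \<le> q" using Suc.prems by simp
          ultimately show ?thesis using Suc.IH m by blast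
        qed
        moreover obtain a where a: "has_iterated_partial n is h a"
            "has_iterated_partial n [i] a m"
          using has_iterated_partial_append[OF m] by blast
        have eq: "\<forall>x\<in>carrier_vec n. a x = h' x"
          using has_iterated_partial_unique a(1) * by blast
        obtain m' where m': "has_partial n i a m'" "\<forall>x\<in>carrier_vec n. m x = m' x"
          using a(2) by auto
        have "has_partial n i h' m"
          unfolding has_partial_def
        proof
          fix x :: "real vec"
          assume x: "x \<in> carrier_vec n"
          have "a (x + u \<cdot>\<^sub>v unit_vec n i) = h' (x + u \<cdot>\<^sub>v unit_vec n i)" for u
            using eq x by simp
          moreover have "((\<lambda>u. a (x + u \<cdot>\<^sub>v unit_vec n i)) has_real_derivative m' x) (at 0)"
            using m'(1) x by (simp add: has_partial_def)
          ultimately show "((\<lambda>u. h' (x + u \<cdot>\<^sub>v unit_vec n i)) has_real_derivative m x) (at 0)"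
            using m'(2) x by simp
        qed
        ultimately show ?thesis by blast
      qed
      then obtain m M where mM: "\<And>i. i < n \<Longrightarrow> has_partial n i h' (m i)"
          "\<And>i x. i < n \<Longrightarrow> x \<in> box n 0 1 \<Longrightarrow> \<bar>m i x\<bar> \<le> M i"
        by metis
      have "\<bar>m i x\<bar> \<le> (\<Sum>j<n. \<bar>M j\<bar>)" if "i < n" "x \<in> box n 0 1" for i x
      proof -
        have "\<bar>M i\<bar> \<le> (\<Sum>j<n. \<bar>M j\<bar>)" using that by (intro member_le_sum) auto
        then show ?thesis using mM(2)[OF that] by linarith
      qed
      then show "\<exists>R. \<forall>x\<in>box n 0 1. \<bar>h' x\<bar> \<le> R"
        using bounded_of_partials[OF mM(1)] by blast
    qed
  qed
  note bd = this
  have "set [] \<subseteq> {..<n} \<and> length [] = q - q \<and> has_iterated_partial n [] h h" by simp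
  then show ?thesis by (rule bd[OF order_refl, rule_format])
qed

lemma holder_smooth_sup_norm_finite:
  assumes "holder_smooth n \<beta> C h"
  shows "\<exists>R. sup_norm_on (box n 0 1) h \<le> ereal R"
proof -
  obtain R where "\<forall>x\<in>box n 0 1. \<bar>h x\<bar> \<le> R" using holder_smooth_bounded[OF assms] by blast
  then have "sup_norm_on (box n 0 1) h \<le> ereal R"
    unfolding sup_norm_on_def by (intro SUP_least) auto
  then show ?thesis by blast
qed

lemma hier_comp_bounded_mono:
  assumes "h \<in> hier_comp_bounded R C P d l" "R \<le> R'"
  shows "h \<in> hier_comp_bounded R' C P d l"
  using assms(1)
proof (induction l arbitrary: h)
  case 0
  then show ?case by simp
next
  case (Suc l)
  show ?case
  proof (cases l)
    case 0
    with Suc.prems obtain \<beta> t g \<pi> where *: "(\<beta>, t) \<in> P" "holder_smooth t \<beta> C g"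
        "sup_norm_on (box t 0 1) g \<le> R" "\<forall>j<t. \<pi> j < d"
        "\<forall>x\<in>carrier_vec d. h x = g (vec t (\<lambda>j. x $ \<pi> j))"
      unfolding 0 hier_comp_bounded.simps by blast
    have "sup_norm_on (box t 0 1) g \<le> R'" using *(3) assms(2) by (rule order_trans)
    with * show ?thesis unfolding 0 hier_comp_bounded.simps by blast
  next
    case l: (Suc l')
    with Suc.prems obtain \<beta> t g f where *: "(\<beta>, t) \<in> P" "holder_smooth t \<beta> C g"
        "sup_norm_on (box t 0 1) g \<le> R" "\<forall>j<t. f j \<in> hier_comp_bounded R C P d l"
        "\<forall>x\<in>carrier_vec d. h x = g (vec t (\<lambda>j. f j x))"
      unfolding l hier_comp_bounded.simps by blast
    have "sup_norm_on (box t 0 1) g \<le> R'" using *(3) assms(2) by (rule order_trans)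
    moreover have "\<forall>j<t. f j \<in> hier_comp_bounded R' C P d (Suc l')"
      using *(4) Suc.IH unfolding l by blast
    ultimately show ?thesis using *(1,2,5) unfolding l hier_comp_bounded.simps by blast
  qed
qed

lemma hier_comp_bounded_finite:
  assumes "h \<in> hier_comp_bounded \<infinity> C P d l"
  shows "\<exists>R::real. h \<in> hier_comp_bounded (ereal R) C P d l"
  using assms
proof (induction l arbitrary: h)
  case 0
  then show ?case by simp
next
  case (Suc l)
  show ?case
  proof (cases l)
    case 0
    with Suc.prems obtain \<beta> t g \<pi> where *: "(\<beta>, t) \<in> P" "holder_smooth t \<beta> C g"
        "\<forall>j<t. \<pi> j < d" "\<forall>x\<in>carrier_vec d. h x = g (vec t (\<lambda>j. x $ \<pi> j))"
      unfolding 0 hier_comp_bounded.simps by blast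
    obtain R where "sup_norm_on (box t 0 1) g \<le> ereal R"
      using holder_smooth_sup_norm_finite[OF *(2)] by blast
    with * show ?thesis unfolding 0 hier_comp_bounded.simps by blast
  next
    case l: (Suc l')
    with Suc.prems obtain \<beta> t g f where *: "(\<beta>, t) \<in> P" "holder_smooth t \<beta> C g"
        "\<forall>j<t. f j \<in> hier_comp_bounded \<infinity> C P d l"
        "\<forall>x\<in>carrier_vec d. h x = g (vec t (\<lambda>j. f j x))"
      unfolding l hier_comp_bounded.simps by blast
    have "\<forall>j\<in>{..<t}. \<exists>r. f j \<in> hier_comp_bounded (ereal r) C P d l"
      using *(3) Suc.IH by blast
    then obtain r where r: "\<forall>j\<in>{..<t}. f j \<in> hier_comp_bounded (ereal (r j)) C P d l"
      by (rule bchoice[THEN exE])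
    obtain R0 where R0: "sup_norm_on (box t 0 1) g \<le> ereal R0"
      using holder_smooth_sup_norm_finite[OF *(2)] by blast
    define R where "R = \<bar>R0\<bar> + (\<Sum>j<t. \<bar>r j\<bar>)"
    have "f j \<in> hier_comp_bounded (ereal R) C P d (Suc l')" if "j < t" for j
    proof -
      have "\<bar>r j\<bar> \<le> (\<Sum>j<t. \<bar>r j\<bar>)" using that by (intro member_le_sum) auto
      then have "ereal (r j) \<le> ereal R" by (simp add: R_def)
      then show ?thesis using hier_comp_bounded_mono r that unfolding l by blast
    qed
    moreover have "0 \<le> (\<Sum>j<t. \<bar>r j\<bar>)" by (rule sum_nonneg) simp
    then have "R0 \<le> R" unfolding R_def by linarith
    then have "ereal R0 \<le> ereal R" by simp
    with R0 have "sup_norm_on (box t 0 1) g \<le> ereal R" by (rule order_trans)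
    ultimately show ?thesis using *(1,2,4) unfolding l hier_comp_bounded.simps by blast
  qed
qed

lemma hier_comp_eq_Union:
  "hier_comp C P d l = (\<Union>R::real. hier_comp_bounded (ereal R) C P d l)"
proof (intro subset_antisym subsetI)
  fix h
  assume "h \<in> hier_comp C P d l"
  then obtain R where "h \<in> hier_comp_bounded (ereal R) C P d l"
    unfolding hier_comp_def using hier_comp_bounded_finite by metis
  then show "h \<in> (\<Union>R::real. hier_comp_bounded (ereal R) C P d l)" by (rule UN_I[OF UNIV_I])
next
  fix h
  assume "h \<in> (\<Union>R::real. hier_comp_bounded (ereal R) C P d l)"
  then obtain R where "h \<in> hier_comp_bounded (ereal R) C P d l" by (rule UN_E)
  then have "h \<in> hier_comp_bounded \<infinity> C P d l" by (rule hier_comp_bounded_mono) simp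
  then show "h \<in> hier_comp C P d l" by (simp add: hier_comp_def)
qed

end

theory Submission
  imports Defs "HOL-Computational_Algebra.Polynomial"
begin

text \<open>
  Write \<open>M = \<lfloor>N\<^sup>1\<^sup>/\<^sup>d\<rfloor>\<close> and cut the cube into about \<open>M\<^sup>2\<^sup>d\<close> cells of side \<open>M\<^sup>-\<^sup>2\<close>. On each cell a smooth
  function is approximated to order \<open>M\<^sup>-\<^sup>2\<^sup>\<beta>\<close> by tensor-product Lagrange interpolation; its error
  is controlled coordinate by coordinate, so that only pure partial derivatives enter. Each cell
  index has two digits in every coordinate, a coarse and a fine one, and both are extracted from \<open>x\<close>
  by steep step functions with \<open>O(M)\<close> pieces. The coarse digits together, and likewise the fine
  digits, form a number below \<open>O(M\<^sup>d) = O(N)\<close>, so a table with \<open>O(N\<^sup>2)\<close> entries is read off by two hidden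
  layers of width \<open>O(N)\<close> whose connecting \<open>O(N) \<times> O(N)\<close> weight matrix stores the entries. The remaining
  polynomial in the nodal values and the local coordinates does not depend on \<open>N\<close>, and constant
  depth with width \<open>O(N)\<close> multiplies to precision \<open>N\<^sup>-\<^sup>\<gamma>\<close> for any \<open>\<gamma>\<close>.

  Digits are wrong near cell boundaries. Therefore every coordinate grid is also used shifted by half
  a cell; where a shifted grid is bad at \<open>x\<close>, a penalty pushes its output below the target, and
  some grid is good with zero penalty. The maximum over all grids is then accurate everywhere.

  Compositions are handled by induction on the level: since \<open>\<beta> \<ge> 1\<close>, the constituents are
  Lipschitz on every cube, and their bounds on larger cubes follow from the interpolation estimate
  used for extrapolation.
\<close>

section \<open>Networks as sets of neuron functions\<close>

text \<open>The factor 2 in the exponent comes from counting weights instead of neurons: constant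
  depth and width O(N) leave room for O(N^2) weights, and splitting the cell address into two halves
  of O(N) values each is what lets the table use all of them. Interpolation is preferred to Taylor
  expansion because the table then holds values of the function itself. A bound for the function is
  enough to normalize them, and neither lower-order nor mixed derivatives have to be estimated.
  Digits jump while networks are continuous, so no network extracts them correctly everywhere; this
  obstacle is what forces several grids. An output computed from wrong digits is off in an unknown
  direction. Clipping it makes the damage bounded, and a penalty of the size of the clipping range
  then turns it into an underestimate, which a maximum ignores. Depth, width factor and weight
  exponent must be fixed before the size of the function is known, whereas multiplicative constants
  may follow it; this order of quantifiers is kept through all levels of a composition.\<close>

type_synonym fn = "(nat \<Rightarrow> real) \<Rightarrow> real"

abbreviation sup_le :: "nat \<Rightarrow> real \<Rightarrow> (nat \<Rightarrow> real) \<Rightarrow> bool" where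
  "sup_le d c v \<equiv> \<forall>j<d. \<bar>v j\<bar> \<le> c"

abbreviation cube_le :: "nat \<Rightarrow> real \<Rightarrow> fn \<Rightarrow> bool" where
  "cube_le d R F \<equiv> \<forall>v. (\<forall>j<d. 0 \<le> v j \<and> v j \<le> 1) \<longrightarrow> \<bar>F v\<bar> \<le> R"

definition affine_in :: "real \<Rightarrow> fn set \<Rightarrow> fn \<Rightarrow> bool" where
  "affine_in B F h \<longleftrightarrow>
     (\<exists>b c. \<bar>b\<bar> \<le> B \<and> (\<forall>f. \<bar>c f\<bar> \<le> B) \<and> (\<forall>v. h v = b + (\<Sum>f\<in>F. c f * f v)))"

definition coords :: "nat \<Rightarrow> fn set" where
  "coords d = (\<lambda>j v. v j) ` {..<d}"

text \<open>
  A hidden layer is the finite set of functions of the input that its neurons compute. Sets make the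
  parallel composition of two networks a union, and weights need no indexing until the end.
\<close>

primrec layers :: "nat \<Rightarrow> nat \<Rightarrow> real \<Rightarrow> nat \<Rightarrow> fn set \<Rightarrow> bool" where
  "layers d w B 0 F \<longleftrightarrow> F = coords d"
| "layers d w B (Suc L) G \<longleftrightarrow>
     (\<exists>F. layers d w B L F \<and> finite G \<and> card G \<le> w \<and>
          (\<forall>g\<in>G. \<exists>h. affine_in B F h \<and> g = (\<lambda>v. relu (h v))))"

definition NN :: "nat \<Rightarrow> nat \<Rightarrow> nat \<Rightarrow> real \<Rightarrow> fn set" where
  "NN d L w B = {h. \<exists>F. layers d w B L F \<and> affine_in B F h}"

lemma finite_coords [simp]: "finite (coords d)"
  by (simp add: coords_def)

lemma card_coords_le: "card (coords d) \<le> d"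
  unfolding coords_def by (metis card_image_le card_lessThan finite_lessThan)

lemma layers_finite: "layers d w B L F \<Longrightarrow> finite F"
  by (cases L) auto

lemma layers_card: "layers d w B L F \<Longrightarrow> card F \<le> max d w"
  using card_coords_le[of d] by (cases L) auto

section \<open>Affine functions of the neurons of one layer\<close>

lemma affine_in_nonneg: "affine_in B F h \<Longrightarrow> 0 \<le> B"
  unfolding affine_in_def using abs_ge_zero order_trans by blast

lemma affine_in_mono: "affine_in B F h \<Longrightarrow> B \<le> B' \<Longrightarrow> affine_in B' F h"
  unfolding affine_in_def by (meson order_trans)

lemma affine_in_supset:
  assumes "affine_in B F h" "F \<subseteq> F'" "finite F'"
  shows "affine_in B F' h"
proof -
  obtain b c where *: "\<bar>b\<bar> \<le> B" "\<And>f. \<bar>c f\<bar> \<le> B" "\<And>v. h v = b + (\<Sum>f\<in>F. c f * f v)"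
    using assms(1) unfolding affine_in_def by blast
  have "(\<Sum>f\<in>F. c f * f v) = (\<Sum>f\<in>F'. (if f \<in> F then c f else 0) * f v)" for v
    using assms(2,3) by (intro sum.mono_neutral_cong_left) auto
  moreover have "\<bar>if f \<in> F then c f else 0\<bar> \<le> B" for f
    using * affine_in_nonneg[OF assms(1)] by auto
  ultimately show ?thesis
    unfolding affine_in_def using * by (intro exI[of _ b] exI[of _ "\<lambda>f. if f \<in> F then c f else 0"]) auto
qed

lemma affine_in_const: "\<bar>b\<bar> \<le> B \<Longrightarrow> affine_in B F (\<lambda>v. b)"
  unfolding affine_in_def by (intro exI[of _ b] exI[of _ "\<lambda>f. 0"]) auto

lemma affine_in_base:
  assumes "f \<in> F" "finite F"
  shows "affine_in 1 F f"
proof -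
  have "f v = 0 + (\<Sum>g\<in>F. (if g = f then 1 else 0) * g v)" for v
    using assms by (simp add: if_distrib[of "\<lambda>x. x * _"] cong: if_cong)
  then show ?thesis
    unfolding affine_in_def by (intro exI[of _ 0] exI[of _ "\<lambda>g. if g = f then 1 else 0"]) auto
qed

lemma affine_in_add:
  assumes "affine_in A F f" "affine_in B F g"
  shows "affine_in (A + B) F (\<lambda>v. f v + g v)"
proof -
  obtain b c where *: "\<bar>b\<bar> \<le> A" "\<And>f. \<bar>c f\<bar> \<le> A" "\<And>v. f v = b + (\<Sum>f\<in>F. c f * f v)"
    using assms(1) unfolding affine_in_def by blast
  obtain b' c' where **: "\<bar>b'\<bar> \<le> B" "\<And>f. \<bar>c' f\<bar> \<le> B" "\<And>v. g v = b' + (\<Sum>f\<in>F. c' f * f v)"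
    using assms(2) unfolding affine_in_def by blast
  have "\<bar>b + b'\<bar> \<le> A + B" "\<And>f. \<bar>c f + c' f\<bar> \<le> A + B"
    using * ** by (metis abs_triangle_ineq add_mono order_trans)+
  then show ?thesis
    unfolding affine_in_def
    by (intro exI[of _ "b + b'"] exI[of _ "\<lambda>f. c f + c' f"])
       (auto simp: * ** algebra_simps sum.distrib)
qed

lemma affine_in_scale:
  assumes "affine_in A F f"
  shows "affine_in (\<bar>a\<bar> * A) F (\<lambda>v. a * f v)"
proof -
  obtain b c where *: "\<bar>b\<bar> \<le> A" "\<And>f. \<bar>c f\<bar> \<le> A" "\<And>v. f v = b + (\<Sum>f\<in>F. c f * f v)"
    using assms(1) unfolding affine_in_def by blast
  show ?thesis
    unfolding affine_in_def
    by (intro exI[of _ "a * b"] exI[of _ "\<lambda>f. a * c f"])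
       (auto simp: * abs_mult mult.commute[of A] mult_left_mono distrib_left sum_distrib_left mult.assoc intro!: mult_left_mono)
qed

text \<open>The coefficient bounds are added, not maximized, since several summands may use the same
  neuron.\<close>

lemma affine_in_sum:
  assumes "\<And>k. k \<in> K \<Longrightarrow> affine_in (A k) F (f k)"
  shows "affine_in (\<Sum>k\<in>K. A k) F (\<lambda>v. \<Sum>k\<in>K. f k v)"
  using assms
  by (induction K rule: infinite_finite_induct) (auto intro: affine_in_const affine_in_add)

lemma affine_in_uminus:
  assumes "affine_in A F f"
  shows "affine_in A F (\<lambda>v. - f v)"
  using affine_in_scale[OF assms, of "-1"] by simp

lemma affine_in_diff:
  assumes "affine_in A F f" "affine_in B F g"
  shows "affine_in (A + B) F (\<lambda>v. f v - g v)"
  using affine_in_add[OF assms(1) affine_in_uminus[OF assms(2)]] by simp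

section \<open>Enlarging, merging and deepening networks\<close>

lemma layers_mono:
  assumes "layers d w B L F" "w \<le> w'" "B \<le> B'"
  shows "layers d w' B' L F"
  using assms(1)
proof (induction L arbitrary: F)
  case (Suc L)
  then show ?case using assms(2,3) affine_in_mono[OF _ assms(3)] by (force intro: order_trans)
qed simp

text \<open>Layers of equal depth are merged level by level; each neuron keeps its old weights and
  gets weight 0 from the neurons of the other network.\<close>

lemma layers_union:
  assumes "layers d w B L F" "layers d w' B L F'"
  shows "layers d (w + w') B L (F \<union> F')"
  using assms
proof (induction L arbitrary: F F')
  case (Suc L)
  obtain E where E: "layers d w B L E" "finite F" "card F \<le> w"
      "\<And>g. g \<in> F \<Longrightarrow> \<exists>h. affine_in B E h \<and> g = (\<lambda>v. relu (h v))"
    using Suc.prems(1) by auto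
  obtain E' where E': "layers d w' B L E'" "finite F'" "card F' \<le> w'"
      "\<And>g. g \<in> F' \<Longrightarrow> \<exists>h. affine_in B E' h \<and> g = (\<lambda>v. relu (h v))"
    using Suc.prems(2) by auto
  have fin: "finite (E \<union> E')" using layers_finite E(1) E'(1) by blast
  have "\<exists>h. affine_in B (E \<union> E') h \<and> g = (\<lambda>v. relu (h v))" if "g \<in> F \<union> F'" for g
    using that E(4)[of g] E'(4)[of g] affine_in_supset[OF _ _ fin] by blast
  moreover have "card (F \<union> F') \<le> w + w'"
    using card_Un_le[of F F'] E(3) E'(3) by linarith
  ultimately show ?case
    using Suc.IH[OF E(1) E'(1)] E(2) E'(2) by (auto intro!: exI[of _ "E \<union> E'"])
qed simp

lemma layers_step:
  assumes "layers d w B L F" "finite K" "card K \<le> w" "\<And>k. k \<in> K \<Longrightarrow> affine_in B F (h k)"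
  shows "layers d w B (Suc L) ((\<lambda>k v. relu (h k v)) ` K)"
  using assms card_image_le[OF assms(2), of "\<lambda>k v. relu (h k v)"] by fastforce

lemma NN_I: "layers d w B L F \<Longrightarrow> affine_in B F h \<Longrightarrow> h \<in> NN d L w B"
  by (auto simp: NN_def)

lemma NN_mono:
  assumes "h \<in> NN d L w B" "w \<le> w'" "B \<le> B'"
  shows "h \<in> NN d L w' B'"
  using assms(1) layers_mono[OF _ assms(2,3)] affine_in_mono[OF _ assms(3)] unfolding NN_def by blast

text \<open>The outputs stay separate affine functions over one common last layer. Compositions and
  the table lookup need this, not only sums.\<close>

lemma NN_sum_joint:
  assumes "finite K" "K \<noteq> {}" "\<And>k. k \<in> K \<Longrightarrow> h k \<in> NN d L w B"
  shows "\<exists>F. layers d (card K * w) B L F \<and> (\<forall>k\<in>K. affine_in B F (h k))"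
  using assms
proof (induction K rule: finite_ne_induct)
  case (singleton k)
  then show ?case by (auto simp: NN_def)
next
  case (insert k K)
  then obtain F where F: "layers d (card K * w) B L F" "\<And>k. k \<in> K \<Longrightarrow> affine_in B F (h k)"
    by auto
  obtain F' where F': "layers d w B L F'" "affine_in B F' (h k)"
    using insert.prems[of k] by (auto simp: NN_def)
  have fin: "finite (F' \<union> F)" using layers_finite F(1) F'(1) by blast
  have "layers d (card (insert k K) * w) B L (F' \<union> F)"
    using layers_union[OF F'(1) F(1)] insert.hyps by simp
  moreover have "affine_in B (F' \<union> F) (h j)" if "j \<in> insert k K" for j
    using that F(2)[of j] F'(2) affine_in_supset[OF _ _ fin] by blast
  ultimately show ?case by blast
qed

lemma relu_pair: "x = relu x - relu (- x)"
  by (simp add: relu_def)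

text \<open>A value of either sign crosses a rectifier layer as the pair of its positive and
  negative parts, which costs two neurons. The bound 2 is the sum of two weights of size 1 as
  \<open>affine_in_diff\<close> counts them.\<close>

lemma NN_deepen:
  assumes "h \<in> NN d L w B" "2 \<le> w" "2 \<le> B"
  shows "h \<in> NN d (Suc L) w B"
proof -
  obtain F where F: "layers d w B L F" "affine_in B F h" using assms(1) by (auto simp: NN_def)
  define g where "g k v = (if k = (0::nat) then h v else - h v)" for k v
  have g: "affine_in B F (g k)" for k
    using F(2) affine_in_uminus[OF F(2)] by (cases "k = 0") (simp_all add: g_def[abs_def])
  have L: "layers d w B (Suc L) ((\<lambda>k v. relu (g k v)) ` {0,1})"
    using F(1) g assms(2) by (intro layers_step) auto
  let ?G = "(\<lambda>k v. relu (g k v)) ` {0,1::nat}"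
  have "affine_in (1 + 1) ?G (\<lambda>v. relu (g 0 v) - relu (g 1 v))"
    by (intro affine_in_diff affine_in_base) auto
  moreover have "relu (g 0 v) - relu (g 1 v) = h v" for v
    using relu_pair[of "h v"] by (simp add: g_def)
  ultimately have "affine_in B ?G h" using affine_in_mono[of 2 _ h B] assms(3) by simp
  with L show ?thesis by (rule NN_I)
qed

lemma NN_deepen_le:
  assumes "h \<in> NN d L w B" "2 \<le> w" "2 \<le> B" "L \<le> L'"
  shows "h \<in> NN d L' w B"
  using assms(4,1) by (induction L' rule: dec_induct) (auto intro: NN_deepen assms)

lemma NN_relu:
  assumes "h \<in> NN d L w B" "1 \<le> w" "1 \<le> B"
  shows "(\<lambda>v. relu (h v)) \<in> NN d (Suc L) w B"
proof -
  obtain F where F: "layers d w B L F" "affine_in B F h" using assms(1) by (auto simp: NN_def)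
  have L: "layers d w B (Suc L) ((\<lambda>k v. relu (h v)) ` {()})"
    using F assms(2) by (intro layers_step) auto
  have "affine_in B ((\<lambda>k v. relu (h v)) ` {()}) (\<lambda>v. relu (h v))"
    using affine_in_mono[OF affine_in_base assms(3)] by auto
  with L show ?thesis by (rule NN_I)
qed

lemma NN_coord: "j < d \<Longrightarrow> 1 \<le> B \<Longrightarrow> (\<lambda>v. v j) \<in> NN d 0 w B"
  by (rule NN_I[of _ _ _ _ "coords d"]) (auto simp: coords_def intro: affine_in_mono[OF affine_in_base])

lemma NN_const: "\<bar>c\<bar> \<le> B \<Longrightarrow> (\<lambda>v. c) \<in> NN d 0 w B"
  by (rule NN_I[of _ _ _ _ "coords d"]) (auto intro: affine_in_const)

lemma NN_scale:
  assumes "h \<in> NN d L w B"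
  shows "(\<lambda>v. a * h v) \<in> NN d L w (max B (\<bar>a\<bar> * B))"
proof -
  obtain F where F: "layers d w B L F" "affine_in B F h" using assms(1) by (auto simp: NN_def)
  show ?thesis
    by (rule NN_I[OF layers_mono[OF F(1)] affine_in_mono[OF affine_in_scale[OF F(2)]]]) auto
qed

lemma NN_sum:
  assumes "finite K" "K \<noteq> {}" "\<And>k. k \<in> K \<Longrightarrow> h k \<in> NN d L w B"
  shows "(\<lambda>v. \<Sum>k\<in>K. h k v) \<in> NN d L (card K * w) (real (card K) * B)"
proof -
  obtain F where F: "layers d (card K * w) B L F" "\<And>k. k \<in> K \<Longrightarrow> affine_in B F (h k)"
    using NN_sum_joint[of K h, OF assms] by blast
  obtain k where "k \<in> K" using assms(2) by blast
  then have B: "0 \<le> B" using F(2) affine_in_nonneg by blast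
  have "1 \<le> card K" using assms by (simp add: Suc_leI card_gt_0_iff)
  then have "B \<le> real (card K) * B" using B by (simp add: mult_le_cancel_right1)
  then show ?thesis
    using NN_I[OF layers_mono[OF F(1) order_refl]] affine_in_sum[of K "\<lambda>_. B" F h, OF F(2)] by simp
qed

section \<open>Sequential composition\<close>

lemma affine_in_compose:
  assumes "affine_in B G h" "finite G" "\<And>g. g \<in> G \<Longrightarrow> affine_in A F (\<lambda>v. g (\<lambda>j. f j v))"
  shows "affine_in (B + real (card G) * (B * A)) F (\<lambda>v. h (\<lambda>j. f j v))"
proof -
  obtain b c where *: "\<bar>b\<bar> \<le> B" "\<And>f. \<bar>c f\<bar> \<le> B" "\<And>v. h v = b + (\<Sum>f\<in>G. c f * f v)"
    using assms(1) unfolding affine_in_def by blast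
  have "affine_in (B * A) F (\<lambda>v. c g * g (\<lambda>j. f j v))" if "g \<in> G" for g
    using affine_in_mono[OF affine_in_scale[OF assms(3)[OF that]]] * affine_in_nonneg[OF assms(3)[OF that]]
    by (simp add: mult_right_mono)
  then have "affine_in (B + (\<Sum>g\<in>G. B * A)) F (\<lambda>v. b + (\<Sum>g\<in>G. c g * g (\<lambda>j. f j v)))"
    by (intro affine_in_add affine_in_const * affine_in_sum) auto
  then show ?thesis by (simp add: *)
qed

text \<open>No layer is spent on the interface: the affine outputs \<open>f j\<close> are absorbed
  into the first affine map of the second network, which multiplies weights. The invariant reads
  every neuron off with the small bound \<open>B\<close> instead of \<open>B'\<close>, so that the
  product \<open>B2 * B\<close> arises anew in each layer and does not compound with depth.\<close>

lemma layers_compose: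
  assumes "layers n w2 B2 L2 G" "layers d w B L F" "\<And>j. j < n \<Longrightarrow> affine_in B F (f j)"
    and B: "1 \<le> B" "0 \<le> B2" and B': "B' = B + B2 + real (max n w2) * (B2 * B)"
  shows "\<exists>F'. layers d (max w w2) B' (L + L2) F' \<and> (\<forall>g\<in>G. affine_in B F' (\<lambda>v. g (\<lambda>j. f j v)))"
  using assms(1)
proof (induction L2 arbitrary: G)
  case 0
  have "B \<le> B'" using B unfolding B' by simp
  then have "layers d (max w w2) B' L F" using assms(2) layers_mono by force
  moreover have "affine_in B F (\<lambda>v. g (\<lambda>j. f j v))" if "g \<in> G" for g
    using that 0 assms(3) by (auto simp: coords_def)
  ultimately show ?case by auto
next
  case (Suc L2)
  then obtain E where E: "layers n w2 B2 L2 E" "finite G" "card G \<le> w2"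
      "\<And>g. g \<in> G \<Longrightarrow> \<exists>h. affine_in B2 E h \<and> g = (\<lambda>v. relu (h v))"
    by auto
  obtain F' where F': "layers d (max w w2) B' (L + L2) F'"
      "\<And>g. g \<in> E \<Longrightarrow> affine_in B F' (\<lambda>v. g (\<lambda>j. f j v))"
    using Suc.IH[OF E(1)] by blast
  obtain h where h: "\<And>g. g \<in> G \<Longrightarrow> affine_in B2 E (h g)" "\<And>g. g \<in> G \<Longrightarrow> g = (\<lambda>v. relu (h g v))"
    using E(4) by metis
  have le: "B2 + real (card E) * (B2 * B) \<le> B'"
  proof -
    have "real (card E) * (B2 * B) \<le> real (max n w2) * (B2 * B)"
      using layers_card[OF E(1)] B by (intro mult_right_mono) auto
    then show ?thesis unfolding B' using B by simp
  qed
  have "affine_in B' F' (\<lambda>v. h g (\<lambda>j. f j v))" if "g \<in> G" for g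
    using affine_in_mono[OF affine_in_compose[where f = f, OF h(1)[OF that] layers_finite[OF E(1)] F'(2)] le] by blast
  then have "layers d (max w w2) B' (Suc (L + L2)) ((\<lambda>g v. relu (h g (\<lambda>j. f j v))) ` G)"
    using F'(1) E by (intro layers_step) auto
  moreover have "affine_in B ((\<lambda>g v. relu (h g (\<lambda>j. f j v))) ` G) (\<lambda>v. g (\<lambda>j. f j v))" if "g \<in> G" for g
  proof (rule affine_in_mono[OF affine_in_base B(1)])
    have "(\<lambda>v. g (\<lambda>j. f j v)) = (\<lambda>v. relu (h g (\<lambda>j. f j v)))"
      using h(2)[OF that] by metis
    then show "(\<lambda>v. g (\<lambda>j. f j v)) \<in> (\<lambda>g v. relu (h g (\<lambda>j. f j v))) ` G" using that by blast
  qed (use E in auto)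
  ultimately show ?case unfolding add_Suc_right by blast
qed

lemma NN_compose:
  assumes "h \<in> NN n L2 w2 B2" "0 < n" "\<And>j. j < n \<Longrightarrow> f j \<in> NN d L w B"
    and B: "1 \<le> B"
  shows "(\<lambda>v. h (\<lambda>j. f j v)) \<in> NN d (L + L2) (n * w + w2) (B + B2 + real (n + w2) * (B2 * B))"
proof -
  obtain G where G: "layers n w2 B2 L2 G" "affine_in B2 G h" using assms(1) by (auto simp: NN_def)
  have B2: "0 \<le> B2" using affine_in_nonneg[OF G(2)] .
  obtain F where F: "layers d (n * w) B L F" "\<And>j. j < n \<Longrightarrow> affine_in B F (f j)"
    using NN_sum_joint[of "{..<n}" f d L w B] assms(2,3) by auto
  obtain F' where F': "layers d (max (n * w) w2) (B + B2 + real (max n w2) * (B2 * B)) (L + L2) F'"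
      "\<And>g. g \<in> G \<Longrightarrow> affine_in B F' (\<lambda>v. g (\<lambda>j. f j v))"
    using layers_compose[where f = f, OF G(1) F B B2 refl] by blast
  have "real (max n w2) * (B2 * B) \<le> real (n + w2) * (B2 * B)"
    using B B2 by (intro mult_right_mono) auto
  then have "layers d (n * w + w2) (B + B2 + real (n + w2) * (B2 * B)) (L + L2) F'"
    using F'(1) by (elim layers_mono) auto
  moreover have "affine_in (B + B2 + real (n + w2) * (B2 * B)) F' (\<lambda>v. h (\<lambda>j. f j v))"
  proof (rule affine_in_mono[OF affine_in_compose[where f = f, OF G(2) layers_finite[OF G(1)] F'(2)]])
    have "real (card G) * (B2 * B) \<le> real (n + w2) * (B2 * B)"
      using layers_card[OF G(1)] B B2 by (intro mult_right_mono) auto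
    then show "B2 + real (card G) * (B2 * B) \<le> B + B2 + real (n + w2) * (B2 * B)"
      using B by simp
  qed
  ultimately show ?thesis by (rule NN_I)
qed


section \<open>Families of networks of width O(N) with polynomially bounded weights\<close>

text \<open>
  Depth, width factor and weight exponent are uniform in \<open>N\<close> and in the index. A constant factor in
  the weight bound is absorbed by the exponent because \<open>N \<ge> 2\<close>. Any larger parameters work as well,
  so finitely many families have common ones.
\<close>

definition nets :: "nat \<Rightarrow> (nat \<Rightarrow> 'i \<Rightarrow> fn) \<Rightarrow> bool" where
  "nets d h \<longleftrightarrow> (\<exists>L0 k0 e0. \<forall>L\<ge>L0. \<forall>k\<ge>k0. \<forall>e\<ge>e0. \<forall>N\<ge>2. \<forall>i.
      h N i \<in> NN d L (k * N) (real N ^ e))"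

lemma const_le_power: "\<exists>m. \<forall>N\<ge>2. (c::real) \<le> real N ^ m"
proof -
  obtain m where m: "c < 2 ^ m" using real_arch_pow[of 2 c] by auto
  have "c \<le> real N ^ m" if "2 \<le> N" for N
    using m power_mono[of 2 "real N" m] that by simp
  then show ?thesis by blast
qed

lemma poly_le_power: "\<exists>m. \<forall>N\<ge>2. c * real N ^ e \<le> real N ^ m"
proof -
  obtain m where m: "\<And>N. 2 \<le> N \<Longrightarrow> c \<le> real N ^ m" using const_le_power by blast
  have "c * real N ^ e \<le> real N ^ (m + e)" if "2 \<le> N" for N
    using m[OF that] by (simp add: power_add mult_right_mono)
  then show ?thesis by blast
qed

text \<open>The parameters are raised to \<open>max k 1\<close> and \<open>max m 1\<close> so that
  width and weight bound are at least 2 for every \<open>N \<ge> 2\<close>, as padding to a greater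
  depth requires.\<close>

lemma nets_I:
  assumes "\<And>N i. 2 \<le> N \<Longrightarrow> h N i \<in> NN d L (k * N) (c * real N ^ e)"
  shows "nets d h"
proof -
  obtain m where m: "\<And>N. 2 \<le> N \<Longrightarrow> c * real N ^ e \<le> real N ^ m"
    using poly_le_power by blast
  have "h N i \<in> NN d L' (k' * N) (real N ^ e')"
    if "L \<le> L'" "max k 1 \<le> k'" "max m 1 \<le> e'" "2 \<le> N" for L' k' e' N i
  proof (rule NN_deepen_le[OF NN_mono[OF assms[OF \<open>2 \<le> N\<close>]]])
    have N: "1 \<le> real N" using that by simp
    show "k * N \<le> k' * N" using that by simp
    have "real N ^ m \<le> real N ^ e'" using that N by (intro power_increasing) auto
    then show "c * real N ^ e \<le> real N ^ e'" using m[OF \<open>2 \<le> N\<close>] by linarith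
    have "1 * 2 \<le> k' * N" using that by (intro mult_le_mono) auto
    then show "2 \<le> k' * N" by simp
    have "real N ^ 1 \<le> real N ^ e'" using that N by (intro power_increasing) auto
    then show "2 \<le> real N ^ e'" using that(4) by (metis numeral_le_real_of_nat_iff order_trans power_one_right)
  qed (use that in simp)
  then show ?thesis unfolding nets_def by blast
qed

lemma nets_E:
  assumes "nets d h"
  shows "\<exists>L k e. 1 \<le> k \<and> 1 \<le> e \<and> (\<forall>N\<ge>2. \<forall>i. h N i \<in> NN d L (k * N) (real N ^ e))"
proof -
  obtain L0 k0 e0 where "\<forall>L\<ge>L0. \<forall>k\<ge>k0. \<forall>e\<ge>e0. \<forall>N\<ge>2. \<forall>i. h N i \<in> NN d L (k * N) (real N ^ e)"
    using assms unfolding nets_def by blast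
  then show ?thesis by (intro exI[of _ L0] exI[of _ "max k0 1"] exI[of _ "max e0 1"]) simp
qed

lemma nets_Efin:
  assumes "finite J" "\<And>j. j \<in> J \<Longrightarrow> nets d (h j)"
  shows "\<exists>L k e. 1 \<le> k \<and> 1 \<le> e \<and>
    (\<forall>j\<in>J. \<forall>N\<ge>2. \<forall>i. h j N i \<in> NN d L (k * N) (real N ^ e))"
proof -
  have "\<exists>L0 k0 e0. \<forall>L\<ge>L0. \<forall>k\<ge>k0. \<forall>e\<ge>e0. \<forall>j\<in>J. \<forall>N\<ge>2. \<forall>i.
      h j N i \<in> NN d L (k * N) (real N ^ e)"
    using assms
  proof (induction J rule: finite_induct)
    case (insert j J)
    obtain L0 k0 e0 where 1: "\<And>L k e. L0 \<le> L \<Longrightarrow> k0 \<le> k \<Longrightarrow> e0 \<le> e \<Longrightarrow> \<forall>j\<in>J. \<forall>N\<ge>2. \<forall>i.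
      h j N i \<in> NN d L (k * N) (real N ^ e)"
      using insert.IH insert.prems by (meson insertI2)
    obtain L1 k1 e1 where 2: "\<And>L k e. L1 \<le> L \<Longrightarrow> k1 \<le> k \<Longrightarrow> e1 \<le> e \<Longrightarrow> \<forall>N\<ge>2. \<forall>i.
      h j N i \<in> NN d L (k * N) (real N ^ e)"
      using insert.prems[of j] unfolding nets_def by (meson insertI1)
    show ?case
      using 1 2 by (intro exI[of _ "max L0 L1"] exI[of _ "max k0 k1"] exI[of _ "max e0 e1"]) auto
  qed auto
  then obtain L0 k0 e0 where "\<forall>L\<ge>L0. \<forall>k\<ge>k0. \<forall>e\<ge>e0. \<forall>j\<in>J. \<forall>N\<ge>2. \<forall>i.
      h j N i \<in> NN d L (k * N) (real N ^ e)"
    by blast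
  then show ?thesis by (intro exI[of _ L0] exI[of _ "max k0 1"] exI[of _ "max e0 1"]) simp
qed

section \<open>Closure of network families under arithmetic, maxima and composition\<close>

lemma nets_const:
  assumes "\<And>N i. 2 \<le> N \<Longrightarrow> \<bar>c N i\<bar> \<le> K * real N ^ e"
  shows "nets d (\<lambda>N i v. c N i)"
  by (rule nets_I[where L = 0 and k = 1]) (use assms in \<open>auto intro: NN_const\<close>)

lemma nets_coord: "j < d \<Longrightarrow> nets d (\<lambda>N i v. v j)"
  by (rule nets_I[where L = 0 and k = 1 and c = 1 and e = 0]) (auto intro: NN_coord)

lemma nets_scale:
  assumes "nets d h" "\<And>N. 2 \<le> N \<Longrightarrow> \<bar>c N\<bar> \<le> K * real N ^ m"
  shows "nets d (\<lambda>N i v. c N * h N i v)"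
proof -
  obtain L k e where h: "\<And>N i. 2 \<le> N \<Longrightarrow> h N i \<in> NN d L (k * N) (real N ^ e)"
    using nets_E[OF assms(1)] by blast
  show ?thesis
  proof (rule nets_I[OF NN_mono[OF NN_scale[OF h]]])
    fix N :: nat assume N: "2 \<le> N"
    have "\<bar>c N\<bar> * real N ^ e \<le> (K * real N ^ m) * real N ^ e"
      using assms(2)[OF N] by (rule mult_right_mono) simp
    also have "\<dots> \<le> \<bar>K\<bar> * real N ^ m * real N ^ e"
      by (intro mult_right_mono) auto
    finally have 1: "\<bar>c N\<bar> * real N ^ e \<le> \<bar>K\<bar> * real N ^ (m + e)" by (simp add: power_add mult.assoc)
    have "real N ^ e \<le> real N ^ (m + e)" using N by (intro power_increasing) auto
    then show "max (real N ^ e) (\<bar>c N\<bar> * real N ^ e) \<le> (1 + \<bar>K\<bar>) * real N ^ (m + e)"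
      using 1 by (simp add: distrib_right add_increasing2 add_increasing)
  qed auto
qed

lemma nets_sum:
  assumes "finite J" "\<And>j. j \<in> J \<Longrightarrow> nets d (h j)"
  shows "nets d (\<lambda>N i v. \<Sum>j\<in>J. h j N i v)"
proof (cases "J = {}")
  case True
  then show ?thesis using nets_const[of "\<lambda>_ _. 0" 0 0] by simp
next
  case False
  obtain L k e where h: "\<And>j N i. j \<in> J \<Longrightarrow> 2 \<le> N \<Longrightarrow> h j N i \<in> NN d L (k * N) (real N ^ e)"
    using nets_Efin[of J d h, OF assms] by metis
  have "(\<lambda>v. \<Sum>j\<in>J. h j N i v) \<in> NN d L ((card J * k) * N) (card J * real N ^ e)" if "2 \<le> N" for N i
    using NN_sum[OF assms(1) False h[OF _ that], of "\<lambda>j. j"] by (simp add: mult.assoc)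
  then show ?thesis by (rule nets_I)
qed

lemma nets_add:
  assumes "nets d f" "nets d g"
  shows "nets d (\<lambda>N i v. f N i v + g N i v)"
  using nets_sum[of "{True, False}" d "\<lambda>b. if b then f else g"] assms by simp

lemma nets_uminus: "nets d f \<Longrightarrow> nets d (\<lambda>N i v. - f N i v)"
  using nets_scale[of d f "\<lambda>_. -1" 1 0] by simp

lemma nets_diff: "nets d f \<Longrightarrow> nets d g \<Longrightarrow> nets d (\<lambda>N i v. f N i v - g N i v)"
  using nets_add[OF _ nets_uminus, of d f g] by simp

lemma nets_relu:
  assumes "nets d h"
  shows "nets d (\<lambda>N i v. relu (h N i v))"
proof -
  obtain L k e where h: "1 \<le> k" "1 \<le> e" "\<And>N i. 2 \<le> N \<Longrightarrow> h N i \<in> NN d L (k * N) (real N ^ e)"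
    using nets_E[OF assms] by blast
  show ?thesis
    by (rule nets_I[where L = "Suc L" and k = k and c = 1 and e = e]) (use h in \<open>auto intro!: NN_relu\<close>)
qed

lemma nets_max:
  assumes "nets d f" "nets d g"
  shows "nets d (\<lambda>N i v. max (f N i v) (g N i v))"
proof -
  have "max x y = x + relu (y - x)" for x y by (simp add: relu_def)
  then show ?thesis using assms by (simp only:) (intro nets_add nets_relu nets_diff)
qed

lemma nets_Max:
  assumes "finite J" "J \<noteq> {}" "\<And>j. j \<in> J \<Longrightarrow> nets d (h j)"
  shows "nets d (\<lambda>N i v. MAX j\<in>J. h j N i v)"
  using assms by (induction J rule: finite_ne_induct) (auto intro: nets_max)

text \<open>The outer family has the trivial index type: it will be the polynomial, which is the
  same for all target functions. Merging two affine maps sums over up to O(N) neurons, whence the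
  additional factor \<open>N\<close> in the exponent \<open>1 + e2 + e\<close>.\<close>

lemma nets_compose:
  assumes "nets n (\<lambda>N (_::unit). \<phi> N)" "0 < n" "\<And>j. j < n \<Longrightarrow> nets d (f j)"
  shows "nets d (\<lambda>N i v. \<phi> N (\<lambda>j. f j N i v))"
proof -
  obtain L2 k2 e2 where \<phi>: "\<And>N. 2 \<le> N \<Longrightarrow> \<phi> N \<in> NN n L2 (k2 * N) (real N ^ e2)"
    using nets_E[OF assms(1)] by blast
  obtain L k e where f: "\<And>j N i. j \<in> {..<n} \<Longrightarrow> 2 \<le> N \<Longrightarrow> f j N i \<in> NN d L (k * N) (real N ^ e)"
    using nets_Efin[of "{..<n}" d f] assms(3) by (metis finite_lessThan lessThan_iff)
  show ?thesis
  proof (rule nets_I[OF NN_mono])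
    fix N i assume N: "2 \<le> (N::nat)"
    show "(\<lambda>v. \<phi> N (\<lambda>j. f j N i v)) \<in> NN d (L + L2) (n * (k * N) + k2 * N)
        (real N ^ e + real N ^ e2 + real (n + k2 * N) * (real N ^ e2 * real N ^ e))"
      using NN_compose[OF \<phi>[OF N] assms(2) f[OF _ N]] N by simp
    show "n * (k * N) + k2 * N \<le> (n * k + k2) * N" by (simp add: algebra_simps)
    have N1: "1 \<le> real N" using N by simp
    have le: "real N ^ e \<le> real N ^ (1 + e2 + e)" "real N ^ e2 \<le> real N ^ (1 + e2 + e)"
      using N by (auto intro!: power_increasing simp del: power.simps)
    have "real (n + k2 * N) \<le> real ((n + k2) * N)"
      using N by (simp add: algebra_simps mult_le_cancel_left1 del: of_nat_mult of_nat_add)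
    then have "real (n + k2 * N) * (real N ^ e2 * real N ^ e)
        \<le> real ((n + k2) * N) * (real N ^ e2 * real N ^ e)"
      by (rule mult_right_mono) simp
    also have "\<dots> = real (n + k2) * real N ^ (1 + e2 + e)"
      by (simp add: power_add algebra_simps)
    finally show "real N ^ e + real N ^ e2 + real (n + k2 * N) * (real N ^ e2 * real N ^ e)
       \<le> (2 + real (n + k2)) * real N ^ (1 + e2 + e)"
      unfolding distrib_right using le by linarith
  qed
qed

lemma nets_cong_fun: "nets d f \<Longrightarrow> (\<And>N i v. f N i v = g N i v) \<Longrightarrow> nets d g"
proof -
  assume *: "nets d f" "\<And>N i v. f N i v = g N i v"
  then have "f = g" by blast
  with * show "nets d g" by simp
qed

text \<open>The basic use of the width: O(N) rectifiers of one and the same value give a piecewise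
  linear function with O(N) breaks in a single layer. Triangle waves and digit extraction are both
  of this form.\<close>

lemma nets_PL:
  assumes "nets d h" and n: "\<And>N. 2 \<le> N \<Longrightarrow> n N \<le> k0 * N"
    and c: "\<And>N k. 2 \<le> N \<Longrightarrow> k < n N \<Longrightarrow> \<bar>c N k\<bar> \<le> K * real N ^ m"
    and \<alpha>: "\<And>N. 2 \<le> N \<Longrightarrow> \<bar>\<alpha> N\<bar> \<le> K * real N ^ m"
    and \<beta>: "\<And>N k. 2 \<le> N \<Longrightarrow> k < n N \<Longrightarrow> \<bar>\<beta> N k\<bar> \<le> K * real N ^ m"
  shows "nets d (\<lambda>N i v. \<Sum>k<n N. c N k * relu (\<alpha> N * h N i v + \<beta> N k))"
proof -
  obtain L k e where h: "\<And>N i. 2 \<le> N \<Longrightarrow> h N i \<in> NN d L (k * N) (real N ^ e)"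
    using nets_E[OF assms(1)] by blast
  show ?thesis
  proof (rule nets_I)
    fix N :: nat and i assume N: "2 \<le> N"
    \<comment> \<open>Sized for three demands: the weights of the given network (\<open>B1\<close>),
      slope and offset of the new rectifiers (\<open>B2\<close>), and the sum of all output
      coefficients (\<open>B3\<close>).\<close>
    define B where "B = (1 + \<bar>K\<bar> * (1 + real k0)) * real N ^ (1 + m + e)"
    define D where "D = \<bar>K\<bar> * real N ^ m"
    have KD: "K * real N ^ m \<le> D" unfolding D_def by (intro mult_right_mono) auto
    have N1: "1 \<le> real N ^ j" for j using N by simp
    have D0: "0 \<le> D" by (simp add: D_def)
    obtain F where F: "layers d (k * N) (real N ^ e) L F" "affine_in (real N ^ e) F (h N i)"
      using h[OF N] by (auto simp: NN_def)
    have pw: "real N ^ j \<le> real N ^ (1 + m + e)" if "j \<le> 1 + m + e" for j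
      using N that by (intro power_increasing) auto
    have B1: "real N ^ e \<le> B"
    proof -
      have "1 * real N ^ e \<le> B" unfolding B_def using pw[of e]
        by (intro mult_mono) auto
      then show ?thesis by simp
    qed
    have B2: "D * real N ^ e + D \<le> B" if "0 < n N"
    proof -
      have "D * real N ^ e + D \<le> D * real N ^ e + D * real N ^ e"
        using N1[of e] D0 by (simp add: mult_le_cancel_left1)
      also have "\<dots> = 2 * D * real N ^ e" by simp
      also have "\<dots> \<le> real N * D * real N ^ e" using N D0 by (intro mult_right_mono) auto
      also have "\<dots> = \<bar>K\<bar> * real N ^ (1 + m + e)" by (simp add: D_def power_add algebra_simps)
      also have "\<dots> \<le> B" unfolding B_def by (intro mult_right_mono) (auto simp: algebra_simps)
      finally show ?thesis .
    qed
    have B3: "real (n N) * D \<le> B"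
    proof -
      have "real (n N) * D \<le> real (k0 * N) * D" using n[OF N] D0
        by (intro mult_right_mono) (simp_all del: of_nat_mult)
      also have "\<dots> = (\<bar>K\<bar> * real k0) * real N ^ (1 + m)" by (simp add: D_def algebra_simps)
      also have "\<dots> \<le> (\<bar>K\<bar> * real k0) * real N ^ (1 + m + e)"
        using pw[of "1 + m"] by (intro mult_left_mono) auto
      also have "\<dots> \<le> B" unfolding B_def by (intro mult_right_mono) (auto simp: algebra_simps)
      finally show ?thesis .
    qed
    let ?h = "\<lambda>j v. \<alpha> N * h N i v + \<beta> N j"
    have lh: "affine_in B F (?h j)" if "j < n N" for j
    proof -
      have "affine_in (\<bar>\<alpha> N\<bar> * real N ^ e + \<bar>\<beta> N j\<bar>) F (?h j)"
        by (intro affine_in_add affine_in_scale affine_in_const F(2)) simp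
      moreover have "\<bar>\<alpha> N\<bar> * real N ^ e + \<bar>\<beta> N j\<bar> \<le> D * real N ^ e + D"
        using \<alpha>[OF N] \<beta>[OF N that] KD by (intro add_mono mult_right_mono) auto
      ultimately show ?thesis using B2 that by (auto elim!: affine_in_mono)
    qed
    let ?G = "(\<lambda>j v. relu (?h j v)) ` {..<n N}"
    have "layers d ((k + k0) * N) B L F"
      using F(1) B1 by (elim layers_mono) auto
    then have L: "layers d ((k + k0) * N) B (Suc L) ?G"
      using lh n[OF N] by (intro layers_step) (auto simp: algebra_simps)
    \<comment> \<open>Different \<open>j\<close> may yield the same function and hence the same
      neuron, on which their coefficients accumulate; therefore the bounds are summed.\<close>
    have "affine_in (\<Sum>j<n N. \<bar>c N j\<bar> * 1) ?G (\<lambda>v. \<Sum>j<n N. c N j * relu (?h j v))"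
      by (intro affine_in_sum affine_in_scale affine_in_base) auto
    moreover have "(\<Sum>j<n N. \<bar>c N j\<bar> * 1) \<le> (\<Sum>j<n N. D)"
      using c[OF N] KD by (intro sum_mono) fastforce
    ultimately have "affine_in B ?G (\<lambda>v. \<Sum>j<n N. c N j * relu (?h j v))"
      using B3 by (elim affine_in_mono) simp
    with L show "(\<lambda>v. \<Sum>j<n N. c N j * relu (?h j v))
        \<in> NN d (Suc L) ((k + k0) * N) ((1 + \<bar>K\<bar> * (1 + real k0)) * real N ^ (1 + m + e))"
      unfolding B_def by (rule NN_I)
  qed
qed


section \<open>Table lookup and multiplication\<close>

definition tent :: "real \<Rightarrow> real" where
  "tent t = relu (t + 1) - 2 * relu t + relu (t - 1)"

text \<open>
  At integers \<open>a\<close>, \<open>b\<close> the inner sum selects the row \<open>T a\<close>, and the outer rectifier keeps only its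
  entry \<open>b\<close>, because the entries lie in \<open>[0, 1]\<close>.
\<close>

definition lookup :: "nat \<Rightarrow> (nat \<Rightarrow> nat \<Rightarrow> real) \<Rightarrow> real \<Rightarrow> real \<Rightarrow> real" where
  "lookup n T a b = (\<Sum>m<n. relu ((\<Sum>k<n. T k m * tent (a - real k)) + tent (b - real m) - 1))"

lemma tent_nat: "tent (real k - real j) = (if j = k then 1 else 0)"
proof -
  consider "j = k" | "real j + 1 \<le> real k" | "real k + 1 \<le> real j"
    by (cases j k rule: linorder_cases) auto
  then show ?thesis by cases (auto simp: tent_def relu_def)
qed

lemma lookup_eq:
  assumes "k < n" "m < n" "\<And>k m. 0 \<le> T k m \<and> T k m \<le> 1"
  shows "lookup n T (real k) (real m) = T k m"
proof -
  have "lookup n T (real k) (real m) = (\<Sum>j<n. if j = m then T k m else 0)"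
    unfolding lookup_def tent_nat
    using assms by (intro sum.cong refl) (auto simp: relu_def if_distrib[of "\<lambda>x. _ * x"] cong: if_cong)
  also have "\<dots> = T k m" using assms by simp
  finally show ?thesis .
qed

text \<open>The entries \<open>T N i k m\<close> occur as weights between the layer of tents and the
  layer of the outer rectifiers. This is where O(N^2) numbers are stored at width O(N), and the
  index \<open>i\<close> enters nowhere but in these weights and in the addresses.\<close>

lemma nets_lookup:
  assumes "nets d a" "nets d b" and n: "\<And>N. 2 \<le> N \<Longrightarrow> n N \<le> k0 * N"
    and T: "\<And>N i k m. \<bar>T N i k m\<bar> \<le> 1"
  shows "nets d (\<lambda>N i v. lookup (n N) (T N i) (a N i v) (b N i v))"
proof -
  define q where "q j = (if j then a else b)" for j
  have "nets d (q j)" for j using assms(1,2) by (cases j) (simp_all add: q_def)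
  then have "\<exists>L k e. 1 \<le> k \<and> 1 \<le> e \<and>
    (\<forall>j\<in>UNIV. \<forall>N\<ge>2. \<forall>i. q j N i \<in> NN d L (k * N) (real N ^ e))"
    by (intro nets_Efin) auto
  then obtain L k e where
    ab: "\<And>j N i. 2 \<le> N \<Longrightarrow> q j N i \<in> NN d L (k * N) (real N ^ e)"
    by blast
  show ?thesis
  proof (rule nets_I)
    fix N :: nat and i assume N: "2 \<le> N"
    \<comment> \<open>A tent has coefficients of total size \<open>1 + 2 + 1 = 4\<close> and the
      entries are at most 1, so a row costs at most \<open>4 n\<close>; the column tent and the
      constants account for the remainder.\<close>
    define B where "B = real N ^ e + 4 * real (n N) + 6"
    have B0: "B \<le> (7 + 4 * real k0) * real N ^ (1 + e)"
    proof -
      have "real (n N) \<le> real (k0 * N)" using n[OF N] by (simp only: of_nat_le_iff)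
      also have "\<dots> \<le> real k0 * real N ^ (1 + e)" using N by (simp add: mult_left_mono)
      finally have 1: "real (n N) \<le> real k0 * real N ^ (1 + e)" .
      have 2: "real N ^ e \<le> real N ^ (1 + e)" using N by (intro power_increasing) auto
      have 3: "1 \<le> real N ^ (1 + e)" using N by (intro one_le_power) auto
      show ?thesis unfolding B_def distrib_right using 1 2 3 by linarith
    qed
    have Bpos: "1 \<le> B" "real N ^ e \<le> B" by (auto simp: B_def)
    define h where "h j = q j N i" for j
    have hNN: "h j \<in> NN d L (k * N) (real N ^ e)" for j
      using ab[OF N, of j i] by (simp add: h_def)
    obtain F where F: "layers d (2 * (k * N)) (real N ^ e) L F" "\<And>j. affine_in (real N ^ e) F (h j)"
      using NN_sum_joint[of "UNIV :: bool set" h d L "k * N" "real N ^ e"] hNN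
      by (auto simp: card_UNIV_bool)
    \<comment> \<open>\<open>True\<close> stands for the row address and \<open>False\<close> for
      the column address. The tent at \<open>l\<close> uses the offsets \<open>l\<close>,
      \<open>l + 1\<close> and \<open>l + 2\<close>, so \<open>n\<close> tents share
      \<open>n + 2\<close> rectifiers.\<close>
    let ?K = "(UNIV :: bool set) \<times> {..<n N + 2}"
    let ?g = "\<lambda>p v. h (fst p) v + (1 - real (snd p))"
    let ?G = "(\<lambda>p v. relu (?g p v)) ` ?K"
    let ?w = "(2 * k + 2 * k0 + 4) * N"
    have lg: "affine_in B F (?g p)" if "p \<in> ?K" for p
    proof (rule affine_in_mono[OF affine_in_add[OF F(2) affine_in_const]])
      show "\<bar>1 - real (snd p)\<bar> \<le> real (n N) + 1" using that by auto
    qed (simp add: B_def)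
    have cardK: "card ?K \<le> ?w"
      using n[OF N] N by (simp add: card_cartesian_product card_UNIV_bool algebra_simps)
    have "layers d ?w B L F" using F(1) Bpos by (elim layers_mono) (auto simp: algebra_simps)
    then have LG: "layers d ?w B (Suc L) ?G" using lg cardK by (intro layers_step) auto
    have base: "affine_in 1 ?G (\<lambda>v. relu (h j v - real l + 1))"
        "affine_in 1 ?G (\<lambda>v. relu (h j v - real l))" "affine_in 1 ?G (\<lambda>v. relu (h j v - real l - 1))"
      if "l < n N" for j l
    proof -
      have fin: "finite ?G" by simp
      have mem: "(\<lambda>v. relu (h j v + (1 - real l'))) \<in> ?G" if "l' < n N + 2" for l'
        using that by (intro image_eqI[of _ _ "(j, l')"]) auto
      have "affine_in 1 ?G (\<lambda>v. relu (h j v + (1 - real l)))" using that by (intro affine_in_base mem fin) auto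
      then show "affine_in 1 ?G (\<lambda>v. relu (h j v - real l + 1))" by (simp add: algebra_simps)
      have "affine_in 1 ?G (\<lambda>v. relu (h j v + (1 - real (Suc l))))"
        using that by (intro affine_in_base mem fin) auto
      then show "affine_in 1 ?G (\<lambda>v. relu (h j v - real l))" by (simp add: algebra_simps)
      have "affine_in 1 ?G (\<lambda>v. relu (h j v + (1 - real (Suc (Suc l)))))"
        using that by (intro affine_in_base mem fin) auto
      then show "affine_in 1 ?G (\<lambda>v. relu (h j v - real l - 1))" by (simp add: algebra_simps)
    qed
    have lt: "affine_in 4 ?G (\<lambda>v. tent (h j v - real l))" if "l < n N" for j l
    proof -
      have "affine_in (1 + \<bar>2\<bar> * 1 + 1) ?G (\<lambda>v. tent (h j v - real l))"
        unfolding tent_def by (intro affine_in_add affine_in_diff affine_in_scale base that)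
      then show ?thesis by simp
    qed
    let ?y = "\<lambda>m v. (\<Sum>k<n N. T N i k m * tent (h True v - real k)) + tent (h False v - real m) - 1"
    have ly: "affine_in B ?G (?y m)" if m: "m < n N" for m
    proof (rule affine_in_mono)
      show "affine_in ((\<Sum>k<n N. \<bar>T N i k m\<bar> * 4) + 4 + 1) ?G (?y m)"
        using m by (intro affine_in_diff affine_in_add affine_in_sum affine_in_scale lt affine_in_const) auto
      have "(\<Sum>k<n N. \<bar>T N i k m\<bar> * 4) \<le> (\<Sum>k<n N. 4)" using T by (intro sum_mono) auto
      moreover have "0 \<le> real N ^ e" by simp
      ultimately show "(\<Sum>k<n N. \<bar>T N i k m\<bar> * 4) + 4 + 1 \<le> B" unfolding B_def
        by (simp only: sum_constant card_lessThan)
    qed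
    let ?H = "(\<lambda>m v. relu (?y m v)) ` {..<n N}"
    have LH: "layers d ?w B (Suc (Suc L)) ?H"
      proof (rule layers_step[OF LG])
      show "card {..<n N} \<le> ?w" using n[OF N] by (simp add: algebra_simps)
      show "affine_in B ?G (?y m)" if "m \<in> {..<n N}" for m using that by (intro ly) simp
    qed simp
    have "affine_in (\<Sum>m<n N. 1) ?H (\<lambda>v. \<Sum>m<n N. relu (?y m v))"
      by (intro affine_in_sum affine_in_base) auto
    then have "affine_in B ?H (\<lambda>v. lookup (n N) (T N i) (h True v) (h False v))"
      unfolding lookup_def by (elim affine_in_mono) (simp add: B_def)
    then have "(\<lambda>v. lookup (n N) (T N i) (a N i v) (b N i v)) \<in> NN d (Suc (Suc L)) ?w B"
      using LH by (intro NN_I) (auto simp: h_def q_def)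
    then show "(\<lambda>v. lookup (n N) (T N i) (a N i v) (b N i v))
        \<in> NN d (Suc (Suc L)) ?w ((7 + 4 * real k0) * real N ^ (1 + e))"
      by (rule NN_mono) (use B0 in auto)
  qed
qed

section \<open>Squares by iterated triangle waves\<close>

definition triw :: "nat \<Rightarrow> real \<Rightarrow> real" where
  "triw N t = (\<Sum>k<N. (if k = 0 then 1 else 2 * (-1) ^ k) * relu (real N * t + - real k))"

text \<open>In \<open>x = N t\<close> the slope is \<open>2 p + 1\<close> on
  \<open>[p, p + 1]\<close>: this is the chord interpolant of \<open>x^2\<close> at the integers.
  Its slope increases by 2 at every break; letting the jumps alternate in sign gives the zigzag
  \<open>triw\<close>.\<close>

definition sqs :: "nat \<Rightarrow> real \<Rightarrow> real" where
  "sqs N t = (\<Sum>k<N. (if k = 0 then 1 else 2) * relu (real N * t + - real k))"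

lemma sum_relu_truncate:
  assumes "real p \<le> x" "x \<le> real p + 1" "p < N"
  shows "(\<Sum>k<N. c k * relu (x + - real k)) = (\<Sum>k\<le>p. c k * (x - real k))"
proof -
  have "(\<Sum>k<N. c k * relu (x + - real k)) = (\<Sum>k\<le>p. c k * relu (x + - real k))"
    using assms by (intro sum.mono_neutral_right) (auto simp: relu_def)
  also have "\<dots> = (\<Sum>k\<le>p. c k * (x - real k))"
    using assms by (intro sum.cong) (auto simp: relu_def)
  finally show ?thesis .
qed

lemma triw_closed:
  "(\<Sum>k\<le>p. (if k = 0 then 1 else 2 * (-1) ^ k) * (x - real k))
     = (if even p then x - real p else real p + 1 - x)"
  by (induction p) (auto simp: algebra_simps)

lemma sqs_closed:
  "(\<Sum>k\<le>p. (if k = 0 then 1 else 2) * (x - real k)) = (2 * real p + 1) * x - real p ^ 2 - real p"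
  by (induction p) (auto simp: algebra_simps power2_eq_square)

text \<open>On \<open>[p, p + 1]\<close> the chord exceeds \<open>x^2\<close> by
  \<open>(x - p) (p + 1 - x)\<close>. One factor is the zigzag value \<tau> and the other is
  \<open>1 - \<tau>\<close>, in an order that depends on the parity of \<open>p\<close>; the product
  is \<tau> - \<tau>^2 in both cases.\<close>

lemma square_triw:
  assumes N: "1 \<le> N" and t: "0 \<le> t" "t \<le> 1"
  shows "0 \<le> triw N t" "triw N t \<le> 1"
    and "t ^ 2 = (sqs N t - triw N t + (triw N t) ^ 2) / real N ^ 2"
proof -
  define x where "x = real N * t"
  have "\<exists>p. real p \<le> x \<and> x \<le> real p + 1 \<and> p < N"
  proof (cases "t = 1")
    case True
    then show ?thesis using N by (intro exI[of _ "N - 1"]) (auto simp: x_def of_nat_diff)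
  next
    case False
    have x0: "0 \<le> x" using t by (simp add: x_def)
    have "x < real N" using False t N by (simp add: x_def)
    then have "real (nat \<lfloor>x\<rfloor>) \<le> x \<and> x \<le> real (nat \<lfloor>x\<rfloor>) + 1 \<and> nat \<lfloor>x\<rfloor> < N"
      using x0 by (auto simp: nat_less_iff floor_less_iff)
    then show ?thesis by blast
  qed
  then obtain p where p: "real p \<le> x" "x \<le> real p + 1" "p < N" by blast
  have tri: "triw N t = (if even p then x - real p else real p + 1 - x)"
    unfolding triw_def x_def[symmetric] sum_relu_truncate[OF p] triw_closed ..
  have sq: "sqs N t = (2 * real p + 1) * x - real p ^ 2 - real p"
    unfolding sqs_def x_def[symmetric] sum_relu_truncate[OF p] sqs_closed ..
  show "0 \<le> triw N t" "triw N t \<le> 1" using p by (auto simp: tri)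
  have "x ^ 2 = sqs N t - triw N t + (triw N t) ^ 2"
    unfolding tri sq by (auto simp: power2_eq_square algebra_simps)
  then show "t ^ 2 = (sqs N t - triw N t + (triw N t) ^ 2) / real N ^ 2"
    using N by (simp add: x_def field_simps)
qed

text \<open>
  Piecewise linear interpolation of \<open>t\<^sup>2\<close> at the points \<open>k / N\<close> has the error \<open>(\<tau> - \<tau>\<^sup>2) / N\<^sup>2\<close>, where
  \<open>\<tau>\<close> is the triangle wave. This again contains a square, so that the error decreases by the factor
  \<open>N\<^sup>-\<^sup>2\<close> with every recursion step.
\<close>

primrec square_net :: "nat \<Rightarrow> nat \<Rightarrow> real \<Rightarrow> real" where
  "square_net 0 N t = 0"
| "square_net (Suc m) N t = (1 / real N ^ 2) * ((sqs N t - triw N t) + square_net m N (triw N t))"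

text \<open>Unfolding one level reproduces the error of the previous level at the point
  \<open>triw N t\<close>, divided by \<open>N^2\<close>; at level 0 the constant 0 misses a number
  in [0, 1] by at most 1.\<close>

lemma square_net_error:
  assumes "1 \<le> N" "0 \<le> t" "t \<le> 1"
  shows "\<bar>square_net m N t - t ^ 2\<bar> \<le> 1 / real N ^ m"
  using assms(2,3)
proof (induction m arbitrary: t)
  case 0
  then show ?case by (simp add: power_le_one)
next
  case (Suc m)
  note t = square_triw[OF assms(1) Suc.prems]
  have "\<bar>square_net (Suc m) N t - t ^ 2\<bar> = \<bar>square_net m N (triw N t) - (triw N t) ^ 2\<bar> / real N ^ 2"
  proof -
    have "square_net (Suc m) N t - t ^ 2 = (square_net m N (triw N t) - (triw N t) ^ 2) / real N ^ 2"
      unfolding t(3) by (simp add: diff_divide_distrib add_divide_distrib)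
    then show ?thesis by simp
  qed
  also have "\<dots> \<le> (1 / real N ^ m) / real N ^ 2"
    using Suc.IH[OF t(1,2)] by (rule divide_right_mono) simp
  also have "\<dots> \<le> 1 / real N ^ Suc m"
  proof -
    have "real N ^ Suc m \<le> real N ^ (m + 2)" using assms(1) by (intro power_increasing) auto
    then have "1 / real N ^ (m + 2) \<le> 1 / real N ^ Suc m"
      using assms(1) by (intro divide_left_mono) auto
    then show ?thesis by (simp add: power_add power2_eq_square algebra_simps)
  qed
  finally show ?case .
qed

lemma nets_square_net:
  assumes "nets d h"
  shows "nets d (\<lambda>N i v. square_net m N (h N i v))"
  using assms
proof (induction m arbitrary: h)
  case 0
  then show ?case using nets_const[of "\<lambda>_ _. 0" 0 0] by simp
next
  case (Suc m)
  have s: "nets d (\<lambda>N i v. sqs N (h N i v))" unfolding sqs_def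
    by (rule nets_PL[OF Suc.prems, where ?k0.0 = 1 and K = 2 and m = 1]) auto
  have t: "nets d (\<lambda>N i v. triw N (h N i v))" unfolding triw_def
    by (rule nets_PL[OF Suc.prems, where ?k0.0 = 1 and K = 2 and m = 1]) (auto simp: abs_mult)
  have "\<And>N. 2 \<le> N \<Longrightarrow> \<bar>1 / real N ^ 2\<bar> \<le> 1 * real N ^ 0" by simp
  from nets_scale[OF nets_add[OF nets_diff[OF s t] Suc.IH[OF t]] this]
  show ?case by simp
qed

section \<open>Polynomials up to an arbitrary power of 1/N\<close>

definition fast_approx :: "nat \<Rightarrow> fn \<Rightarrow> bool" where
  "fast_approx n Q \<longleftrightarrow> (\<exists>K. \<forall>v. sup_le n 1 v \<longrightarrow> \<bar>Q v\<bar> \<le> K) \<and>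
     (\<forall>\<gamma>. \<exists>\<phi>. nets n (\<lambda>N (_::unit). \<phi> N) \<and>
        (\<forall>N\<ge>2. \<forall>v. sup_le n 1 v \<longrightarrow> \<bar>\<phi> N v - Q v\<bar> \<le> 1 / real N ^ \<gamma>))"

lemma const_over_power: "\<exists>m. \<forall>N\<ge>2. (c::real) * (1 / real N ^ m) \<le> 1 / real N ^ \<gamma>"
proof -
  obtain m where m: "\<forall>N\<ge>2. c \<le> real N ^ m" using const_le_power by blast
  have "c * (1 / real N ^ (m + \<gamma>)) \<le> 1 / real N ^ \<gamma>" if "2 \<le> N" for N
    using m that by (simp add: power_add field_simps)
  then show ?thesis by blast
qed

lemma fast_approx_exact:
  assumes "nets n (\<lambda>N (_::unit). Q)" "\<And>v. (\<And>j. j < n \<Longrightarrow> \<bar>v j\<bar> \<le> 1) \<Longrightarrow> \<bar>Q v\<bar> \<le> K"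
  shows "fast_approx n Q"
  unfolding fast_approx_def using assms by (fastforce intro: exI[of _ K] exI[of _ "\<lambda>_. Q"])

lemma fast_approx_const: "fast_approx n (\<lambda>v. c)"
  by (rule fast_approx_exact[of _ _ "\<bar>c\<bar>"], rule nets_const[of _ "\<bar>c\<bar>" 0]) auto

lemma fast_approx_coord: "j < n \<Longrightarrow> fast_approx n (\<lambda>v. v j)"
  by (rule fast_approx_exact[of _ _ 1], rule nets_coord) auto

lemma fast_approx_add:
  assumes "fast_approx n P" "fast_approx n Q"
  shows "fast_approx n (\<lambda>v. P v + Q v)"
proof -
  obtain K K' where K: "\<And>v. (\<And>j. j < n \<Longrightarrow> \<bar>v j\<bar> \<le> 1) \<Longrightarrow> \<bar>P v\<bar> \<le> K"
      "\<And>v. (\<And>j. j < n \<Longrightarrow> \<bar>v j\<bar> \<le> 1) \<Longrightarrow> \<bar>Q v\<bar> \<le> K'"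
    using assms unfolding fast_approx_def by metis
  have "\<exists>\<phi>. nets n (\<lambda>N (_::unit). \<phi> N) \<and>
        (\<forall>N\<ge>2. \<forall>v. sup_le n 1 v \<longrightarrow> \<bar>\<phi> N v - (P v + Q v)\<bar> \<le> 1 / real N ^ \<gamma>)" for \<gamma>
  proof -
    obtain m where m: "\<And>N. 2 \<le> N \<Longrightarrow> 2 * (1 / real N ^ m) \<le> 1 / real N ^ \<gamma>"
      using const_over_power by blast
    obtain \<phi> where \<phi>: "nets n (\<lambda>N (_::unit). \<phi> N)"
        "\<And>N v. 2 \<le> N \<Longrightarrow> (\<And>j. j < n \<Longrightarrow> \<bar>v j\<bar> \<le> 1) \<Longrightarrow> \<bar>\<phi> N v - P v\<bar> \<le> 1 / real N ^ m"
      using assms(1) unfolding fast_approx_def by metis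
    obtain \<psi> where \<psi>: "nets n (\<lambda>N (_::unit). \<psi> N)"
        "\<And>N v. 2 \<le> N \<Longrightarrow> (\<And>j. j < n \<Longrightarrow> \<bar>v j\<bar> \<le> 1) \<Longrightarrow> \<bar>\<psi> N v - Q v\<bar> \<le> 1 / real N ^ m"
      using assms(2) unfolding fast_approx_def by metis
    have "\<bar>\<phi> N v + \<psi> N v - (P v + Q v)\<bar> \<le> 1 / real N ^ \<gamma>"
      if "2 \<le> N" "sup_le n 1 v" for N v
      using \<phi>(2)[of N v] \<psi>(2)[of N v] m[of N] that by (simp add: abs_le_iff)
    then show ?thesis using nets_add[OF \<phi>(1) \<psi>(1)]
      by (intro exI[of _ "\<lambda>N v. \<phi> N v + \<psi> N v"]) auto
  qed
  moreover have "\<exists>K. \<forall>v. sup_le n 1 v \<longrightarrow> \<bar>P v + Q v\<bar> \<le> K"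
    using K by (intro exI[of _ "K + K'"]) (meson abs_triangle_ineq add_mono order_trans)
  ultimately show ?thesis unfolding fast_approx_def by blast
qed

text \<open>Polarization, \<open>2 x y = (x + y)^2 - x^2 - y^2\<close>. Division by
  \<open>2 K\<close> and the absolute values bring all three arguments into [0, 1], the only range
  on which \<open>square_net\<close> approximates squares.\<close>

definition mulq :: "real \<Rightarrow> nat \<Rightarrow> nat \<Rightarrow> real \<Rightarrow> real \<Rightarrow> real" where
  "mulq K m N x y = 2 * K ^ 2 *
     (square_net m N (1 / (2 * K) * \<bar>x + y\<bar>) - square_net m N (1 / (2 * K) * \<bar>x\<bar>) - square_net m N (1 / (2 * K) * \<bar>y\<bar>))"

lemma mulq_error:
  assumes "1 \<le> K" "\<bar>x\<bar> \<le> K" "\<bar>y\<bar> \<le> K" "1 \<le> N"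
  shows "\<bar>mulq K m N x y - x * y\<bar> \<le> 6 * K ^ 2 * (1 / real N ^ m)"
proof -
  have s: "\<bar>square_net m N (1 / (2 * K) * \<bar>z\<bar>) - (1 / (2 * K) * \<bar>z\<bar>) ^ 2\<bar> \<le> 1 / real N ^ m"
    if "\<bar>z\<bar> \<le> 2 * K" for z
    using that assms by (intro square_net_error) (auto simp: field_simps)
  define E where "E z = square_net m N (1 / (2 * K) * \<bar>z\<bar>) - (1 / (2 * K) * \<bar>z\<bar>) ^ 2" for z
  have E: "\<bar>E (x + y)\<bar> \<le> 1 / real N ^ m" "\<bar>E x\<bar> \<le> 1 / real N ^ m" "\<bar>E y\<bar> \<le> 1 / real N ^ m"
    using s[of "x + y"] s[of x] s[of y] assms by (auto simp: E_def)
  have "x * y = 2 * K ^ 2 * ((1 / (2 * K) * \<bar>x + y\<bar>) ^ 2 - (1 / (2 * K) * \<bar>x\<bar>) ^ 2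
      - (1 / (2 * K) * \<bar>y\<bar>) ^ 2)"
    using assms(1) by (simp add: field_simps power2_eq_square)
  then have "mulq K m N x y - x * y = 2 * K ^ 2 * (E (x + y) - E x - E y)"
    unfolding mulq_def E_def by (simp only: right_diff_distrib)
  also have "\<bar>\<dots>\<bar> = 2 * K ^ 2 * \<bar>E (x + y) - E x - E y\<bar>" by (simp add: abs_mult)
  also have "\<dots> \<le> 2 * K ^ 2 * (3 * (1 / real N ^ m))"
    using E by (intro mult_left_mono) auto
  finally show ?thesis by simp
qed

lemma nets_abs:
  assumes "nets d f"
  shows "nets d (\<lambda>N i v. \<bar>f N i v\<bar>)"
proof -
  have "\<bar>x\<bar> = relu x + relu (- x)" for x by (simp add: relu_def)
  then show ?thesis using assms by (simp only:) (intro nets_add nets_relu nets_uminus)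
qed

lemma nets_scale_const: "nets d f \<Longrightarrow> nets d (\<lambda>N i v. c * f N i v)"
  using nets_scale[of d f "\<lambda>_. c" "\<bar>c\<bar>" 0] by simp

lemma nets_mulq: "nets d f \<Longrightarrow> nets d g \<Longrightarrow> nets d (\<lambda>N i v. mulq K m N (f N i v) (g N i v))"
  unfolding mulq_def by (intro nets_scale_const nets_diff nets_square_net nets_abs nets_add)

text \<open>Products are the reason why \<open>fast_approx\<close> includes boundedness: the scale
  \<open>K\<close> of \<open>mulq\<close> must be fixed in advance, and replacing one factor by its
  approximation is amplified by the other factor.\<close>

lemma fast_approx_mult:
  assumes "fast_approx n P" "fast_approx n Q"
  shows "fast_approx n (\<lambda>v. P v * Q v)"
proof -
  obtain K1 K2 where K12: "\<And>v. (\<And>j. j < n \<Longrightarrow> \<bar>v j\<bar> \<le> 1) \<Longrightarrow> \<bar>P v\<bar> \<le> K1"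
      "\<And>v. (\<And>j. j < n \<Longrightarrow> \<bar>v j\<bar> \<le> 1) \<Longrightarrow> \<bar>Q v\<bar> \<le> K2"
    using assms unfolding fast_approx_def by metis
  \<comment> \<open>The summand 1 is room for the approximation error, so that the approximating
    factors are still bounded by \<open>K\<close>.\<close>
  define K where "K = 1 + \<bar>K1\<bar> + \<bar>K2\<bar>"
  have K: "1 \<le> K" by (simp add: K_def)
  have PQ: "\<bar>P v\<bar> \<le> K - 1" "\<bar>Q v\<bar> \<le> K - 1" if "\<And>j. j < n \<Longrightarrow> \<bar>v j\<bar> \<le> 1" for v
    using K12[of v] that by (auto simp: K_def)
  have "\<exists>\<phi>. nets n (\<lambda>N (_::unit). \<phi> N) \<and>
        (\<forall>N\<ge>2. \<forall>v. sup_le n 1 v \<longrightarrow> \<bar>\<phi> N v - P v * Q v\<bar> \<le> 1 / real N ^ \<gamma>)" for \<gamma>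
  proof -
    \<comment> \<open>\<open>6 K^2\<close> is the error of \<open>mulq\<close> itself,
      \<open>2 K\<close> comes from replacing both factors by their approximations.\<close>
    obtain m where m: "\<And>N. 2 \<le> N \<Longrightarrow> (6 * K ^ 2 + 2 * K) * (1 / real N ^ m) \<le> 1 / real N ^ \<gamma>"
      using const_over_power by blast
    obtain \<phi> where \<phi>: "nets n (\<lambda>N (_::unit). \<phi> N)"
        "\<And>N v. 2 \<le> N \<Longrightarrow> (\<And>j. j < n \<Longrightarrow> \<bar>v j\<bar> \<le> 1) \<Longrightarrow> \<bar>\<phi> N v - P v\<bar> \<le> 1 / real N ^ m"
      using assms(1) unfolding fast_approx_def by metis
    obtain \<psi> where \<psi>: "nets n (\<lambda>N (_::unit). \<psi> N)"
        "\<And>N v. 2 \<le> N \<Longrightarrow> (\<And>j. j < n \<Longrightarrow> \<bar>v j\<bar> \<le> 1) \<Longrightarrow> \<bar>\<psi> N v - Q v\<bar> \<le> 1 / real N ^ m"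
      using assms(2) unfolding fast_approx_def by metis
    have "\<bar>mulq K m N (\<phi> N v) (\<psi> N v) - P v * Q v\<bar> \<le> 1 / real N ^ \<gamma>"
      if N: "2 \<le> N" and "sup_le n 1 v" for N v
    proof -
      have v: "\<And>j. j < n \<Longrightarrow> \<bar>v j\<bar> \<le> 1" using that by blast
      let ?\<epsilon> = "1 / real N ^ m"
      have \<epsilon>1: "?\<epsilon> \<le> 1" using N by simp
      have b: "\<bar>\<phi> N v\<bar> \<le> K" "\<bar>\<psi> N v\<bar> \<le> K"
        using \<phi>(2)[of N v, OF N v] \<psi>(2)[of N v, OF N v] PQ[of v, OF v] \<epsilon>1 by linarith+
      have 1: "\<bar>mulq K m N (\<phi> N v) (\<psi> N v) - \<phi> N v * \<psi> N v\<bar> \<le> 6 * K ^ 2 * ?\<epsilon>"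
        using N by (intro mulq_error K b) auto
      have "\<phi> N v * \<psi> N v - P v * Q v = (\<phi> N v - P v) * \<psi> N v + P v * (\<psi> N v - Q v)"
        by (simp add: algebra_simps)
      also have "\<bar>\<dots>\<bar> \<le> \<bar>\<phi> N v - P v\<bar> * \<bar>\<psi> N v\<bar> + \<bar>P v\<bar> * \<bar>\<psi> N v - Q v\<bar>"
        by (metis abs_mult abs_triangle_ineq)
      also have "\<dots> \<le> ?\<epsilon> * K + K * ?\<epsilon>"
        using \<phi>(2)[of N v, OF N v] \<psi>(2)[of N v, OF N v] PQ(1)[of v, OF v] b K
        by (intro add_mono mult_mono) auto
      finally have "\<bar>\<phi> N v * \<psi> N v - P v * Q v\<bar> \<le> 2 * K * ?\<epsilon>" by simp
      with 1 have "\<bar>mulq K m N (\<phi> N v) (\<psi> N v) - P v * Q v\<bar> \<le> (6 * K ^ 2 + 2 * K) * ?\<epsilon>"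
        unfolding distrib_right by linarith
      with m[OF N] show ?thesis by linarith
    qed
    then show ?thesis using nets_mulq[OF \<phi>(1) \<psi>(1), of K m]
      by (intro exI[of _ "\<lambda>N v. mulq K m N (\<phi> N v) (\<psi> N v)"]) auto
  qed
  moreover have "\<bar>P v * Q v\<bar> \<le> K * K" if "sup_le n 1 v" for v
    unfolding abs_mult using PQ[of v] that K by (intro mult_mono) auto
  ultimately show ?thesis unfolding fast_approx_def by blast
qed

lemma fast_approx_sum: "(\<And>j. j \<in> J \<Longrightarrow> fast_approx n (P j)) \<Longrightarrow> fast_approx n (\<lambda>v. \<Sum>j\<in>J. P j v)"
  by (induction J rule: infinite_finite_induct) (auto intro: fast_approx_const fast_approx_add)

lemma fast_approx_prod: "(\<And>j. j \<in> J \<Longrightarrow> fast_approx n (P j)) \<Longrightarrow> fast_approx n (\<lambda>v. \<Prod>j\<in>J. P j v)"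
  by (induction J rule: infinite_finite_induct) (auto intro: fast_approx_const fast_approx_mult)

lemma fast_approx_poly: "fast_approx n Q \<Longrightarrow> fast_approx n (\<lambda>v. poly p (Q v))"
  by (induction p) (auto intro: fast_approx_const fast_approx_add fast_approx_mult)


section \<open>Digit extraction\<close>

text \<open>A unit jump at 0 smeared over the ramp \<open>[-1/8, 1/8]\<close>; outside the ramp the
  value is exactly 0 or 1.\<close>

definition step :: "real \<Rightarrow> real" where
  "step t = relu (4 * t + 1 / 2) - relu (4 * t - 1 / 2)"

text \<open>Marks the ramp of \<open>step\<close>: at least 2 on it, zero from distance 1/4 on. The
  threshold 2 is the length of the interval [-1, 1] into which outputs are clipped.\<close>

definition bump :: "real \<Rightarrow> real" where
  "bump t = 4 * tent (4 * t)"

text \<open>Counts the multiples of \<open>M\<close> that \<open>u\<close> has passed. The index of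
  a unit cell is \<open>a M + b\<close>, where \<open>a\<close> is this count and
  \<open>b < M\<close> is found by \<open>fine\<close> from what remains.\<close>

definition coarse :: "nat \<Rightarrow> real \<Rightarrow> real" where
  "coarse M u = (\<Sum>k<M. step (u - real (Suc k) * real M))"

definition fine :: "nat \<Rightarrow> real \<Rightarrow> real" where
  "fine M w = (\<Sum>k<M - 1. step (w - real (Suc k) * 1))"

text \<open>
  Vanishes at distance at least \<open>1 / 4\<close> from the integers; when it is below 2, both digits are correct.
\<close>

definition bad :: "nat \<Rightarrow> real \<Rightarrow> real" where
  "bad M u = (\<Sum>k<M. bump (u - real (Suc k) * real M))
     + (\<Sum>k<M - 1. bump (u - coarse M u * real M - real (Suc k) * 1))"

lemma tent_eq: "tent t = max 0 (1 - \<bar>t\<bar>)"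
  by (auto simp: tent_def relu_def)

lemma bump_nonneg: "0 \<le> bump t"
  by (simp add: bump_def tent_eq)

lemma bump_zero: "1 / 4 \<le> \<bar>t\<bar> \<Longrightarrow> bump t = 0"
  by (auto simp: bump_def tent_eq)

lemma bump_ge: "\<bar>t\<bar> \<le> 1 / 8 \<Longrightarrow> 2 \<le> bump t"
  by (auto simp: bump_def tent_eq)

lemma bad_nonneg: "0 \<le> bad M u"
  unfolding bad_def by (intro add_nonneg_nonneg sum_nonneg bump_nonneg)

lemma step_count:
  assumes "\<And>k. k < n \<Longrightarrow> 1 / 8 \<le> \<bar>u - real (Suc k) * s\<bar>" "0 < s"
    and a: "real a * s \<le> u" "u < (real a + 1) * s" "a \<le> n"
  shows "(\<Sum>k<n. step (u - real (Suc k) * s)) = real a"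
proof -
  have "step (u - real (Suc k) * s) = (if k < a then 1 else 0)" if k: "k < n" for k
  proof (cases "k < a")
    case True
    then have "real (Suc k) * s \<le> real a * s" using assms(2) by (intro mult_right_mono) auto
    then have "1 / 8 \<le> u - real (Suc k) * s" using assms(1)[OF k] a by linarith
    then show ?thesis using True by (simp add: step_def relu_def)
  next
    case False
    then have "(real a + 1) * s \<le> real (Suc k) * s" using assms(2) by (intro mult_right_mono) auto
    then have "u - real (Suc k) * s \<le> - 1 / 8" using assms(1)[OF k] a by linarith
    then show ?thesis using False by (simp add: step_def relu_def)
  qed
  then have "(\<Sum>k<n. step (u - real (Suc k) * s)) = (\<Sum>k<n. if k < a then 1 else 0)"
    by (intro sum.cong) auto
  also have "\<dots> = (\<Sum>k<a. 1)"
    using a(3) by (intro sum.mono_neutral_cong_right) auto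
  finally show ?thesis by simp
qed

lemma coarse_eq:
  assumes "1 \<le> M" "0 \<le> u" "u < real M ^ 2 + real M"
    and "\<And>k. k < M \<Longrightarrow> 1 / 8 \<le> \<bar>u - real (Suc k) * real M\<bar>"
  shows "\<exists>a\<le>M. coarse M u = real a \<and> real a * real M \<le> u \<and> u < (real a + 1) * real M"
proof -
  define a where "a = nat \<lfloor>u / real M\<rfloor>"
  have M: "0 < real M" using assms(1) by simp
  have 0: "0 \<le> u / real M" using assms by simp
  have r: "real a \<le> u / real M" "u / real M < real a + 1"
    using 0 unfolding a_def by linarith+
  have "u / real M < real M + 1" using assms(3) M by (simp add: field_simps power2_eq_square)
  then have "a \<le> M" using r by linarith
  moreover have 1: "real a * real M \<le> u" "u < (real a + 1) * real M"
    using r M by (simp_all add: field_simps)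
  ultimately show ?thesis
    using step_count[of M u "real M" a, OF assms(4) M 1] by (auto simp: coarse_def)
qed

lemma sum_less_imp:
  assumes "(\<Sum>k<n. f k) < (c::real)" "\<And>k. 0 \<le> f k" "k < (n::nat)"
  shows "f k < c"
proof -
  have "f k \<le> (\<Sum>k<n. f k)" using assms by (intro member_le_sum) auto
  then show ?thesis using assms by linarith
qed

text \<open>All bumps are nonnegative, so a total below 2 keeps \<open>u\<close> off every single
  ramp. The coarse digit is settled first; only then does the second sum in \<open>bad\<close> refer
  to the true remainder.\<close>

lemma digits_good:
  assumes "1 \<le> M" "0 \<le> u" "u < real M ^ 2 + real M" "bad M u < 2"
  shows "\<exists>a b. a \<le> M \<and> b < M \<and> coarse M u = real a \<and> fine M (u - real a * real M) = real b
     \<and> real a * real M + real b \<le> u \<and> u < real a * real M + real b + 1"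
proof -
  let ?w = "u - coarse M u * real M"
  have nn: "0 \<le> (\<Sum>k<n. bump (f k))" for n and f :: "nat \<Rightarrow> real"
    by (intro sum_nonneg bump_nonneg)
  have b1: "(\<Sum>k<M. bump (u - real (Suc k) * real M)) < 2"
    and b2: "(\<Sum>k<M - 1. bump (?w - real (Suc k) * 1)) < 2"
    using assms(4) nn[of "\<lambda>k. u - real (Suc k) * real M" M] nn[of "\<lambda>k. ?w - real (Suc k) * 1" "M - 1"]
    unfolding bad_def by linarith+
  have "1 / 8 \<le> \<bar>u - real (Suc k) * real M\<bar>" if "k < M" for k
    using sum_less_imp[OF b1 bump_nonneg that] bump_ge[of "u - real (Suc k) * real M"] by linarith
  from coarse_eq[OF assms(1-3) this] obtain a where
    a: "a \<le> M" "coarse M u = real a" "real a * real M \<le> u" "u < (real a + 1) * real M"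
    by blast
  define w where "w = u - real a * real M"
  have w: "0 \<le> w" "w < real M" using a by (auto simp: w_def algebra_simps)
  have far: "1 / 8 \<le> \<bar>w - real (Suc k) * 1\<bar>" if "k < M - 1" for k
    using sum_less_imp[OF b2 bump_nonneg that] bump_ge[of "w - real (Suc k) * 1"]
    unfolding w_def a(2) by linarith
  define b where "b = nat \<lfloor>w\<rfloor>"
  have b: "real b \<le> w" "w < real b + 1" using w unfolding b_def by linarith+
  have "b < M" using b w by linarith
  moreover have "fine M w = real b" unfolding fine_def
    using b \<open>b < M\<close> by (intro step_count far) auto
  ultimately show ?thesis
    using a b unfolding w_def by (intro exI[of _ a] exI[of _ b]) auto
qed

text \<open>The breaks of the coarse steps are integers, and the coarse digit comes out as an
  integer, so the arguments of the fine bumps also differ from \<open>u\<close> by an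
  integer.\<close>

lemma bad_zero:
  assumes "1 \<le> M" "0 \<le> u" "u < real M ^ 2 + real M" "\<And>k::nat. 1 / 4 \<le> \<bar>u - real k\<bar>"
  shows "bad M u = 0"
proof -
  have 1: "1 / 4 \<le> \<bar>u - real (Suc k) * real M\<bar>" for k
    using assms(4)[of "Suc k * M"] by (simp only: of_nat_mult)
  then have "1 / 8 \<le> \<bar>u - real (Suc k) * real M\<bar>" for k using 1[of k] by linarith
  from coarse_eq[OF assms(1-3) this] obtain a where a: "coarse M u = real a" by blast
  have "1 / 4 \<le> \<bar>u - coarse M u * real M - real (Suc k) * 1\<bar>" for k
    using assms(4)[of "a * M + Suc k"] by (simp add: a algebra_simps)
  then show ?thesis unfolding bad_def using 1 by (simp add: bump_zero)
qed

text \<open>A point less than 1/4 from an integer moves, under a shift by 1/2, to a distance above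
  1/4 from all integers. A shift by half a cell therefore repairs each bad coordinate.\<close>

lemma far_or_far:
  fixes u :: real
  shows "(\<forall>k::nat. 1 / 4 \<le> \<bar>u - real k\<bar>) \<or> (\<forall>k::nat. 1 / 4 \<le> \<bar>u + 1 / 2 - real k\<bar>)"
proof (rule ccontr)
  assume "\<not> ?thesis"
  then obtain k k' :: nat where "\<bar>u - real k\<bar> < 1 / 4" "\<bar>u + 1 / 2 - real k'\<bar> < 1 / 4"
    by (auto simp: not_le)
  then have "real k < real k'" "real k' < real (Suc k)" unfolding of_nat_Suc by linarith+
  then show False by (simp only: of_nat_less_iff)
qed

section \<open>The digit functions as network families\<close>

context
  fixes M :: "nat \<Rightarrow> nat"
  assumes M: "\<And>N. 2 \<le> N \<Longrightarrow> M N \<le> N"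
begin

lemma mult_bound:
  assumes "2 \<le> N" "k < n" "n \<le> N" "s \<le> real N" "0 \<le> s"
  shows "real (Suc k) * s \<le> real N ^ 2"
  unfolding power2_eq_square using assms by (intro mult_mono) auto

lemma nets_shifted_relus:
  assumes "nets d h" "\<And>N. n N \<le> M N" "\<And>N. 2 \<le> N \<Longrightarrow> 0 \<le> s N \<and> s N \<le> real N" "\<bar>\<beta>\<bar> \<le> 2"
  shows "nets d (\<lambda>N i v. \<Sum>k<n N. relu (4 * (h N i v - real (Suc k) * s N) + \<beta>))"
proof -
  have "nets d (\<lambda>N i v. \<Sum>k<n N. 1 * relu (4 * h N i v + (\<beta> - 4 * (real (Suc k) * s N))))"
  proof (rule nets_PL[OF assms(1), where ?k0.0 = 1 and K = 6 and m = 2])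
    fix N :: nat assume N: "2 \<le> N"
    have n: "n N \<le> N" using M[OF N] assms(2)[of N] by simp
    then show "n N \<le> 1 * N" by simp
    have N1: "1 \<le> real N ^ 2" using N by simp
    then show "\<bar>1\<bar> \<le> 6 * real N ^ 2" "\<bar>4\<bar> \<le> 6 * real N ^ 2" by linarith+
    show "\<bar>\<beta> - 4 * (real (Suc k) * s N)\<bar> \<le> 6 * real N ^ 2" if "k < n N" for k
      using mult_bound[OF N that n, of "s N"] assms(3)[OF N] assms(4) N1
      by (smt (verit) mult_nonneg_nonneg of_nat_0_le_iff)
  qed
  then show ?thesis by (rule nets_cong_fun) (simp add: algebra_simps)
qed

lemma nets_step_sum:
  assumes "nets d h" "\<And>N. n N \<le> M N" "\<And>N. 2 \<le> N \<Longrightarrow> 0 \<le> s N \<and> s N \<le> real N"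
  shows "nets d (\<lambda>N i v. \<Sum>k<n N. step (h N i v - real (Suc k) * s N))"
proof -
  have "nets d (\<lambda>N i v. (\<Sum>k<n N. relu (4 * (h N i v - real (Suc k) * s N) + 1 / 2))
      - (\<Sum>k<n N. relu (4 * (h N i v - real (Suc k) * s N) + (- 1 / 2))))"
    by (intro nets_diff nets_shifted_relus assms) auto
  then show ?thesis by (rule nets_cong_fun) (simp add: step_def sum_subtractf)
qed

lemma nets_bump_sum:
  assumes "nets d h" "\<And>N. n N \<le> M N" "\<And>N. 2 \<le> N \<Longrightarrow> 0 \<le> s N \<and> s N \<le> real N"
  shows "nets d (\<lambda>N i v. \<Sum>k<n N. bump (h N i v - real (Suc k) * s N))"
proof -
  have "nets d (\<lambda>N i v. 4 * (((\<Sum>k<n N. relu (4 * (h N i v - real (Suc k) * s N) + 1))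
      - 2 * (\<Sum>k<n N. relu (4 * (h N i v - real (Suc k) * s N) + 0)))
      + (\<Sum>k<n N. relu (4 * (h N i v - real (Suc k) * s N) + (- 1)))))"
    by (intro nets_scale_const nets_add nets_diff nets_shifted_relus assms) auto
  then show ?thesis
    by (rule nets_cong_fun)
       (simp add: bump_def tent_def sum_subtractf sum.distrib sum_distrib_left algebra_simps)
qed

lemma nets_coarse:
  assumes "nets d h"
  shows "nets d (\<lambda>N i v. coarse (M N) (h N i v))"
  unfolding coarse_def by (intro nets_step_sum assms) (use M in auto)

lemma nets_fine:
  assumes "nets d h"
  shows "nets d (\<lambda>N i v. fine (M N) (h N i v))"
  unfolding fine_def by (intro nets_step_sum assms) auto

lemma nets_bad:
  assumes "nets d h"
  shows "nets d (\<lambda>N i v. bad (M N) (h N i v))"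
proof -
  have "nets d (\<lambda>N i v. real (M N) * coarse (M N) (h N i v))"
    by (rule nets_scale[OF nets_coarse[OF assms], where K = 1 and m = 1]) (use M in auto)
  then have "nets d (\<lambda>N i v. h N i v - coarse (M N) (h N i v) * real (M N))"
    using nets_diff[OF assms] by (simp add: mult.commute)
  then show ?thesis unfolding bad_def
    by (intro nets_add nets_bump_sum assms) (use M in auto)
qed

end

text \<open>Serves two purposes: in base \<open>Suc M\<close> it packs the digits of all coordinates
  into one table address, in base \<open>Suc q\<close> it numbers the multi-indices of interpolation
  nodes.\<close>

definition digit :: "nat \<Rightarrow> nat \<Rightarrow> nat \<Rightarrow> nat" where
  "digit n j A = A div n ^ j mod n"

lemma digit_add_low: "0 < n \<Longrightarrow> j < m \<Longrightarrow> digit n j (X + c * n ^ m) = digit n j X"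
proof -
  assume n: "0 < n" and j: "j < m"
  have "c * n ^ m = (n * (c * n ^ (m - j - 1))) * n ^ j"
  proof -
    have "n ^ m = n ^ (1 + (m - j - 1) + j)" using j by simp
    then show ?thesis by (simp only: power_add) simp
  qed
  then have "(X + c * n ^ m) div n ^ j = X div n ^ j + n * (c * n ^ (m - j - 1))"
    using n by (metis add.commute div_mult_self1 power_not_zero less_not_refl)
  then show ?thesis by (simp add: digit_def)
qed

lemma digit_add_top: "X < n ^ m \<Longrightarrow> c < n \<Longrightarrow> digit n m (X + c * n ^ m) = c"
  by (simp add: digit_def)

lemma digit_less: "0 < n \<Longrightarrow> digit n j A < n"
  by (simp add: digit_def)

lemma flat_less:
  assumes "\<And>j. j < d \<Longrightarrow> f j < n"
  shows "(\<Sum>j<d. f j * n ^ j) < (n::nat) ^ d"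
  using assms
proof (induction d)
  case (Suc d)
  have "(\<Sum>j<d. f j * n ^ j) + f d * n ^ d < n ^ d + f d * n ^ d"
    using Suc by simp
  also have "\<dots> = Suc (f d) * n ^ d" by simp
  also have "\<dots> \<le> n * n ^ d" using Suc.prems[of d] by (intro mult_right_mono) auto
  finally show ?case by simp
qed simp

lemma digit_flat:
  assumes "\<And>j. j < d \<Longrightarrow> f j < n" "j < d"
  shows "digit n j (\<Sum>j<d. f j * n ^ j) = f j"
  using assms
proof (induction d)
  case (Suc d)
  have n: "0 < n" using Suc.prems(1)[OF Suc.prems(2)] by simp
  show ?case
  proof (cases "j = d")
    case True
    have "(\<Sum>j<d. f j * n ^ j) < n ^ d" using Suc.prems by (intro flat_less) auto
    then show ?thesis using True Suc.prems(1)[of d] digit_add_top by simp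
  next
    case False
    then show ?thesis using Suc digit_add_low[OF n, of j d] by simp
  qed
qed simp


section \<open>Local tensor-product interpolation\<close>

text \<open>The denominator \<open>Suc q\<close> keeps \<open>q = 0\<close> meaningful: there is
  then the single node 0, and interpolation is the constant function.\<close>

definition node :: "nat \<Rightarrow> nat \<Rightarrow> real" where
  "node q k = real k / real (Suc q)"

definition lagrange :: "nat \<Rightarrow> nat \<Rightarrow> real poly" where
  "lagrange q k = (\<Prod>m\<in>{..q} - {k}. smult (1 / (node q k - node q m)) [:- node q m, 1:])"

lemma node_inj: "node q k = node q m \<longleftrightarrow> k = m"
  by (simp add: node_def)

lemma node_range: "k \<le> q \<Longrightarrow> 0 \<le> node q k \<and> node q k \<le> 1"
  by (simp add: node_def)

lemma lagrange_node:
  assumes "k \<le> q" "m \<le> q"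
  shows "poly (lagrange q k) (node q m) = (if m = k then 1 else 0)"
proof (cases "m = k")
  case True
  then show ?thesis
    by (auto simp: lagrange_def poly_prod node_inj diff_divide_distrib[symmetric] intro!: prod.neutral)
next
  case False
  then have "\<exists>j\<in>{..q} - {k}. poly (smult (1 / (node q k - node q j)) [:- node q j, 1:]) (node q m) = 0"
    using assms by (intro bexI[of _ m]) auto
  then show ?thesis using False by (simp add: lagrange_def poly_prod prod_zero)
qed

lemma degree_lagrange: "k \<le> q \<Longrightarrow> degree (lagrange q k) \<le> q"
proof -
  assume k: "k \<le> q"
  have "degree (lagrange q k) \<le> (\<Sum>m\<in>{..q} - {k}. degree (smult (1 / (node q k - node q m)) [:- node q m, 1:]))"
    unfolding lagrange_def
    using degree_prod_sum_le[of "{..q} - {k}" "\<lambda>m. smult (1 / (node q k - node q m)) [:- node q m, 1:]"]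
    unfolding o_def by blast
  also have "\<dots> \<le> (\<Sum>m\<in>{..q} - {k}. 1)"
    by (intro sum_mono) (simp add: degree_smult_eq)
  finally show ?thesis using k by simp
qed

lemma lagrange_reproduce:
  assumes "degree p \<le> q"
  shows "p = (\<Sum>k\<le>q. smult (poly p (node q k)) (lagrange q k))"
proof (rule poly_eqI_degree[of "node q ` {..q}"])
  have "inj_on (node q) {..q}" by (auto simp: inj_on_def node_inj)
  then have card: "card (node q ` {..q}) = Suc q" by (simp add: card_image)
  show "degree p < card (node q ` {..q})" using assms card by simp
  have "degree (\<Sum>k\<le>q. smult (poly p (node q k)) (lagrange q k)) \<le> q"
    by (intro degree_sum_le order_trans[OF degree_smult_le degree_lagrange]) auto
  then show "degree (\<Sum>k\<le>q. smult (poly p (node q k)) (lagrange q k)) < card (node q ` {..q})"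
    using card by simp
  show "poly p x = poly (\<Sum>k\<le>q. smult (poly p (node q k)) (lagrange q k)) x" if x: "x \<in> node q ` {..q}" for x
  proof -
    obtain m where m: "m \<le> q" "x = node q m" using x by auto
    have "poly (\<Sum>k\<le>q. smult (poly p (node q k)) (lagrange q k)) x
        = (\<Sum>k\<le>q. if k = m then poly p x else 0)"
      unfolding poly_sum using m by (intro sum.cong) (auto simp: lagrange_node)
    then show ?thesis using m by simp
  qed
qed

lemma poly_bounded:
  fixes p :: "real poly"
  shows "\<exists>K. \<forall>r. \<bar>r\<bar> \<le> \<rho> \<longrightarrow> \<bar>poly p r\<bar> \<le> K"
proof (intro exI allI impI)
  fix r :: real assume r: "\<bar>r\<bar> \<le> \<rho>"
  have "\<bar>poly p r\<bar> \<le> (\<Sum>i\<le>degree p. \<bar>coeff p i * r ^ i\<bar>)"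
    unfolding poly_altdef by (rule sum_abs)
  also have "\<dots> \<le> (\<Sum>i\<le>degree p. \<bar>coeff p i\<bar> * \<rho> ^ i)"
    using r by (intro sum_mono) (auto simp: abs_mult power_abs intro!: mult_left_mono power_mono)
  finally show "\<bar>poly p r\<bar> \<le> (\<Sum>i\<le>degree p. \<bar>coeff p i\<bar> * \<rho> ^ i)" .
qed

text \<open>The radius \<rho> is left free: it is 1 for local coordinates inside a grid cell and
  large when values are extrapolated from the unit cube.\<close>

lemma lagrange_bounded: "\<exists>K\<ge>1. \<forall>k\<le>q. \<forall>r. \<bar>r\<bar> \<le> \<rho> \<longrightarrow> \<bar>poly (lagrange q k) r\<bar> \<le> K"
proof -
  obtain K where K: "\<And>k r. \<bar>r\<bar> \<le> \<rho> \<Longrightarrow> \<bar>poly (lagrange q k) r\<bar> \<le> K k"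
    using poly_bounded[of \<rho> "lagrange q _"] by metis
  have "\<bar>poly (lagrange q k) r\<bar> \<le> 1 + (\<Sum>k\<le>q. \<bar>K k\<bar>)" if "k \<le> q" "\<bar>r\<bar> \<le> \<rho>" for k r
  proof -
    have "\<bar>K k\<bar> \<le> (\<Sum>k\<le>q. \<bar>K k\<bar>)" using that by (intro member_le_sum) auto
    then show ?thesis using K[OF that(2), of k] by linarith
  qed
  then show ?thesis by (intro exI[of _ "1 + (\<Sum>k\<le>q. \<bar>K k\<bar>)"]) (auto intro: sum_nonneg)
qed

section \<open>One variable: Taylor expansion, interpolation and Lipschitz bounds\<close>

definition smooth1 :: "nat \<Rightarrow> real \<Rightarrow> real \<Rightarrow> (real \<Rightarrow> real) \<Rightarrow> bool" where
  "smooth1 q s C f \<longleftrightarrow> (\<exists>D. D 0 = f \<and>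
     (\<forall>m<q. \<forall>t. (D m has_real_derivative D (Suc m) t) (at t)) \<and>
     (\<forall>x y. \<bar>D q x - D q y\<bar> \<le> C * \<bar>x - y\<bar> powr s))"

lemma abs_powr_add_nat: "0 < s \<Longrightarrow> \<bar>h\<bar> powr (real q + s) = \<bar>h\<bar> ^ q * \<bar>h\<bar> powr s"
  by (cases "h = 0") (auto simp: powr_add powr_realpow)

text \<open>In the Lagrange form of the remainder the top derivative is taken at an intermediate
  point. Moving it to \<open>e\<close> changes it by at most \<open>C\<close> times
  \<open>\<bar>h\<bar> powr s\<close>, which raises the order from \<open>q\<close> to
  \<open>q + s\<close>. The coefficient at \<open>h\<close> is recorded because
  \<open>lipschitz1\<close> reads the derivative from it.\<close>

lemma taylor1:
  assumes D: "D 0 = f" "\<And>m t. m < q \<Longrightarrow> (D m has_real_derivative D (Suc m) t) (at t)"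
    and H: "\<And>x y. \<bar>D q x - D q y\<bar> \<le> C * \<bar>x - y\<bar> powr s"
    and C: "0 \<le> C" and s: "0 < s"
  shows "\<exists>p. degree p \<le> q \<and> (1 \<le> q \<longrightarrow> coeff p 1 = D 1 e) \<and>
    (\<forall>h. \<bar>f (e + h) - poly p h\<bar> \<le> C * \<bar>h\<bar> powr (real q + s))"
proof -
  define p where "p = (\<Sum>m\<le>q. monom (D m e / fact m) m)"
  have "degree p \<le> q" unfolding p_def
    by (intro degree_sum_le) (auto intro: order_trans[OF degree_monom_le])
  moreover have "coeff p 1 = D 1 e" if "1 \<le> q"
  proof -
    have "coeff p 1 = (\<Sum>m\<le>q. if m = 1 then D m e / fact m else 0)"
      unfolding p_def coeff_sum by (intro sum.cong) auto
    then show ?thesis using that by simp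
  qed
  moreover have "\<bar>f (e + h) - poly p h\<bar> \<le> C * \<bar>h\<bar> powr (real q + s)" for h
  proof -
    have p: "poly p h = (\<Sum>m<q. D m e / fact m * h ^ m) + D q e / fact q * h ^ q"
      unfolding p_def by (simp add: poly_sum poly_monom lessThan_Suc_atMost[symmetric])
    show ?thesis
    proof (cases "h = 0 \<or> q = 0")
      case True
      then show ?thesis
      proof
        assume "h = 0"
        moreover have "poly p 0 = f e"
          unfolding p_def D(1)[symmetric] by (simp add: poly_sum poly_monom power_0_left if_distrib cong: if_cong)
        ultimately show ?thesis by simp
      next
        assume "q = 0"
        then show ?thesis using p H[of "e + h" e] D(1) by simp
      qed
    next
      case False
      have "\<exists>t. (if e + h < e then e + h < t \<and> t < e else e < t \<and> t < e + h) \<and>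
         f (e + h) = (\<Sum>m<q. (D m e / fact m) * (e + h - e) ^ m) + (D q t / fact q) * (e + h - e) ^ q"
        using False D by (intro Taylor[where a = "min e (e + h)" and b = "max e (e + h)"]) auto
      then obtain t where t0: "if e + h < e then e + h < t \<and> t < e else e < t \<and> t < e + h"
        and t1: "f (e + h) = (\<Sum>m<q. (D m e / fact m) * (e + h - e) ^ m) + (D q t / fact q) * (e + h - e) ^ q"
        by blast
      have t: "\<bar>t - e\<bar> \<le> \<bar>h\<bar>" using t0 by (auto split: if_splits)
      have t2: "f (e + h) = (\<Sum>m<q. (D m e / fact m) * h ^ m) + (D q t / fact q) * h ^ q"
        using t1 by simp
      have "f (e + h) - poly p h = (D q t - D q e) / fact q * h ^ q"
        unfolding p t2 by (simp add: diff_divide_distrib algebra_simps)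
      also have "\<bar>\<dots>\<bar> = \<bar>D q t - D q e\<bar> / fact q * \<bar>h\<bar> ^ q"
        by (simp add: abs_mult power_abs)
      also have "\<dots> \<le> (C * \<bar>h\<bar> powr s) * \<bar>h\<bar> ^ q"
      proof (rule mult_right_mono)
        have "\<bar>D q t - D q e\<bar> / fact q \<le> \<bar>D q t - D q e\<bar>"
          using fact_ge_1[of q, where 'a = real] by (simp add: divide_le_eq mult_le_cancel_left1)
        also have "\<dots> \<le> C * \<bar>t - e\<bar> powr s" by (rule H)
        also have "\<dots> \<le> C * \<bar>h\<bar> powr s"
          using C s t by (intro mult_left_mono powr_mono2) auto
        finally show "\<bar>D q t - D q e\<bar> / fact q \<le> C * \<bar>h\<bar> powr s" .
      qed simp
      finally show ?thesis using abs_powr_add_nat[OF s, of h q] by (simp add: mult_ac)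
    qed
  qed
  ultimately show ?thesis by blast
qed

text \<open>Interpolation reproduces the Taylor polynomial, so only its error survives: once at the
  target point, which gives the power of \<rho>, and once at each node, weighted by a Lagrange
  polynomial. The target may lie outside the range of the nodes.\<close>

lemma interp1:
  assumes f: "smooth1 q s C f" and C: "0 \<le> C" and s: "0 < s"
    and K: "\<And>k r. k \<le> q \<Longrightarrow> \<bar>r\<bar> \<le> \<rho> \<Longrightarrow> \<bar>poly (lagrange q k) r\<bar> \<le> K" "0 \<le> K"
    and \<rho>: "\<bar>r\<bar> \<le> \<rho>" and \<delta>: "0 \<le> \<delta>"
  shows "\<bar>(\<Sum>k\<le>q. f (e + \<delta> * node q k) * poly (lagrange q k) r) - f (e + \<delta> * r)\<bar>
    \<le> C * (\<rho> powr (real q + s) + real (Suc q) * K) * \<delta> powr (real q + s)"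
proof -
  let ?\<beta> = "real q + s"
  obtain D where D: "D 0 = f" "\<And>m t. m < q \<Longrightarrow> (D m has_real_derivative D (Suc m) t) (at t)"
      "\<And>x y. \<bar>D q x - D q y\<bar> \<le> C * \<bar>x - y\<bar> powr s"
    using f unfolding smooth1_def by blast
  obtain p where p: "degree p \<le> q" "\<And>h. \<bar>f (e + h) - poly p h\<bar> \<le> C * \<bar>h\<bar> powr ?\<beta>"
    using taylor1[of D f q C s e, OF D C s] by blast
  define P where "P = pcompose p [:0, \<delta>:]"
  have Pe: "poly P x = poly p (\<delta> * x)" for x by (simp add: P_def poly_pcompose mult.commute)
  have "degree P \<le> degree p * degree [:0, \<delta>:]" unfolding P_def by (rule degree_pcompose_le)
  also have "\<dots> \<le> degree p * 1" by (intro mult_left_mono) auto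
  finally have "degree P \<le> q" using p(1) by simp
  from arg_cong[OF lagrange_reproduce[OF this], of "\<lambda>P. poly P r"]
  have rep: "poly p (\<delta> * r) = (\<Sum>k\<le>q. poly p (\<delta> * node q k) * poly (lagrange q k) r)"
    by (simp add: poly_sum Pe)
  have e1: "\<bar>f (e + \<delta> * node q k) - poly p (\<delta> * node q k)\<bar> \<le> C * \<delta> powr ?\<beta>" if "k \<le> q" for k
  proof -
    have "\<bar>\<delta> * node q k\<bar> \<le> \<delta>" using node_range[OF that] \<delta> by (simp add: abs_mult mult_left_le)
    then have "C * \<bar>\<delta> * node q k\<bar> powr ?\<beta> \<le> C * \<delta> powr ?\<beta>"
      using C s by (intro mult_left_mono powr_mono2) auto
    then show ?thesis using p(2)[of "\<delta> * node q k"] by linarith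
  qed
  have e2: "\<bar>f (e + \<delta> * r) - poly p (\<delta> * r)\<bar> \<le> C * (\<delta> powr ?\<beta> * \<rho> powr ?\<beta>)"
  proof -
    have "\<bar>\<delta> * r\<bar> \<le> \<delta> * \<rho>" using \<rho> \<delta> by (simp add: abs_mult mult_left_mono)
    then have "\<bar>\<delta> * r\<bar> powr ?\<beta> \<le> (\<delta> * \<rho>) powr ?\<beta>"
      using s by (intro powr_mono2) auto
    also have "\<dots> = \<delta> powr ?\<beta> * \<rho> powr ?\<beta>" by (rule powr_mult)
    finally show ?thesis using p(2)[of "\<delta> * r"] C by (meson mult_left_mono order_trans)
  qed
  have "(\<Sum>k\<le>q. f (e + \<delta> * node q k) * poly (lagrange q k) r) - f (e + \<delta> * r)
      = (\<Sum>k\<le>q. (f (e + \<delta> * node q k) - poly p (\<delta> * node q k)) * poly (lagrange q k) r)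
        - (f (e + \<delta> * r) - poly p (\<delta> * r))"
    unfolding rep by (simp add: left_diff_distrib sum_subtractf)
  also have "\<bar>\<dots>\<bar> \<le> \<bar>\<Sum>k\<le>q. (f (e + \<delta> * node q k) - poly p (\<delta> * node q k)) * poly (lagrange q k) r\<bar>
      + \<bar>f (e + \<delta> * r) - poly p (\<delta> * r)\<bar>" by (rule abs_triangle_ineq4)
  also have "\<bar>\<Sum>k\<le>q. (f (e + \<delta> * node q k) - poly p (\<delta> * node q k)) * poly (lagrange q k) r\<bar>
      \<le> (\<Sum>k\<le>q. (C * \<delta> powr ?\<beta>) * K)"
    using e1 K \<rho> C by (intro order_trans[OF sum_abs sum_mono]) (auto simp: abs_mult intro!: mult_mono)
  finally show ?thesis using e2 by (simp add: algebra_simps)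
qed

text \<open>The derivative at \<open>t\<close> is the linear coefficient of the Taylor polynomial,
  hence a fixed linear combination of its values at \<open>q + 1\<close> nodes in
  \<open>[t, t + 1]\<close>; there it differs from the bounded \<open>f\<close> by at most
  \<open>C\<close>. This explains the interval up to \<open>b + 1\<close>. For \<open>q = 0\<close>
  the exponent \<open>s\<close> is 1 and the Hoelder condition is the claim.\<close>

lemma lipschitz1:
  assumes "0 \<le> C" "0 < s" "s \<le> 1" "1 \<le> real q + s"
  shows "\<exists>L\<ge>0. \<forall>f a b. smooth1 q s C f \<and> (\<forall>t. a \<le> t \<and> t \<le> b + 1 \<longrightarrow> \<bar>f t\<bar> \<le> R) \<longrightarrow>
    (\<forall>x y. a \<le> x \<and> x \<le> b \<and> a \<le> y \<and> y \<le> b \<longrightarrow> \<bar>f x - f y\<bar> \<le> L * \<bar>x - y\<bar>)"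
proof (cases "q = 0")
  case True
  then have "s = 1" using assms by simp
  then show ?thesis using assms(1) True
    by (intro exI[of _ C]) (auto simp: smooth1_def)
next
  case False
  define L where "L = (\<Sum>k\<le>q. (\<bar>R\<bar> + C) * \<bar>coeff (lagrange q k) 1\<bar>)"
  have L0: "0 \<le> L" unfolding L_def using assms(1) by (intro sum_nonneg) auto
  have "\<bar>f x - f y\<bar> \<le> L * \<bar>x - y\<bar>"
    if f: "smooth1 q s C f" "\<And>t. a \<le> t \<Longrightarrow> t \<le> b + 1 \<Longrightarrow> \<bar>f t\<bar> \<le> R"
      and xy: "a \<le> x" "x \<le> b" "a \<le> y" "y \<le> b" for f a b x y
  proof -
    obtain D where D: "D 0 = f" "\<And>m t. m < q \<Longrightarrow> (D m has_real_derivative D (Suc m) t) (at t)"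
        "\<And>x y. \<bar>D q x - D q y\<bar> \<le> C * \<bar>x - y\<bar> powr s"
      using f(1) unfolding smooth1_def by blast
    have D1: "\<bar>D 1 t\<bar> \<le> L" if t: "a \<le> t" "t \<le> b" for t
    proof -
      obtain p where p: "degree p \<le> q" "coeff p 1 = D 1 t"
          "\<And>h. \<bar>f (t + h) - poly p h\<bar> \<le> C * \<bar>h\<bar> powr (real q + s)"
        using taylor1[of D f q C s t, OF D assms(1,2)] False by auto
      have pk: "\<bar>poly p (node q k)\<bar> \<le> \<bar>R\<bar> + C" if "k \<le> q" for k
      proof -
        have "\<bar>node q k\<bar> powr (real q + s) \<le> 1"
          using node_range[OF that] assms(2) by (intro powr_le1) auto
        then have "C * \<bar>node q k\<bar> powr (real q + s) \<le> C"
          using mult_left_mono[OF _ assms(1)] by fastforce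
        moreover have "\<bar>f (t + node q k)\<bar> \<le> R" using node_range[OF that] t by (intro f(2)) auto
        ultimately show ?thesis using p(3)[of "node q k"] by linarith
      qed
      have "D 1 t = (\<Sum>k\<le>q. poly p (node q k) * coeff (lagrange q k) 1)"
        using arg_cong[OF lagrange_reproduce[OF p(1)], of "\<lambda>p. coeff p 1"] p(2)
        by (simp add: coeff_sum)
      also have "\<bar>\<dots>\<bar> \<le> L"
        unfolding L_def using pk
        by (intro order_trans[OF sum_abs sum_mono]) (auto simp: abs_mult intro!: mult_right_mono)
      finally show ?thesis .
    qed
    have main: "\<bar>f v - f u\<bar> \<le> L * \<bar>v - u\<bar>" if uv: "a \<le> u" "u < v" "v \<le> b" for u v
    proof -
      have "(f has_real_derivative D 1 t) (at t)" for t using D(2)[of 0 t] D(1) False by simp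
      then obtain z where "u < z" "z < v" "f v - f u = (v - u) * D 1 z"
        using MVT2[OF uv(2), of f "D 1"] by blast
      then show ?thesis using D1[of z] uv by (simp add: abs_mult mult.commute mult_left_mono)
    qed
    show ?thesis
      using main[of x y] main[of y x] xy L0
      by (cases x y rule: linorder_cases) (auto simp: abs_minus_commute)
  qed
  then show ?thesis using L0 by blast
qed

section \<open>Several variables: tensor-product interpolation\<close>

definition smoothd :: "nat \<Rightarrow> nat \<Rightarrow> real \<Rightarrow> real \<Rightarrow> fn \<Rightarrow> bool" where
  "smoothd d q s C F \<longleftrightarrow> (\<forall>x. \<forall>j<d. smooth1 q s C (\<lambda>t. F (x(j := t)))) \<and>
     (\<forall>v w. (\<forall>j<d. v j = w j) \<longrightarrow> F v = F w)"

definition tensor_interp :: "nat \<Rightarrow> nat \<Rightarrow> fn \<Rightarrow> (nat \<Rightarrow> real) \<Rightarrow> real \<Rightarrow> (nat \<Rightarrow> real) \<Rightarrow> real" where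
  "tensor_interp q d F e \<delta> r = (\<Sum>\<nu><Suc q ^ d. F (\<lambda>j. e j + \<delta> * node q (digit (Suc q) j \<nu>))
     * (\<Prod>j<d. poly (lagrange q (digit (Suc q) j \<nu>)) (r j)))"

text \<open>Telescoping over the coordinates: \<open>E m\<close> interpolates in the first
  \<open>m\<close> of them and keeps the exact point in the others. Passing from \<open>m\<close> to
  \<open>m + 1\<close> applies \<open>interp1\<close> along one axis at each of the points already
  fixed, weighted by products of at most \<open>d\<close> Lagrange factors.\<close>

lemma tensor_interp_error:
  fixes K :: real
  assumes F: "smoothd d q s C F" and C: "0 \<le> C" and s: "0 < s"
    and K: "\<And>k r. k \<le> q \<Longrightarrow> \<bar>r\<bar> \<le> \<rho> \<Longrightarrow> \<bar>poly (lagrange q k) r\<bar> \<le> K" "1 \<le> K"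
    and r: "\<And>j. j < d \<Longrightarrow> \<bar>r j\<bar> \<le> \<rho>" and \<delta>: "0 \<le> \<delta>"
  shows "\<bar>tensor_interp q d F e \<delta> r - F (\<lambda>j. e j + \<delta> * r j)\<bar>
    \<le> C * (real d * (real (Suc q) * K) ^ d * (\<rho> powr (real q + s) + real (Suc q) * K)) * \<delta> powr (real q + s)"
proof -
  let ?n = "Suc q"
  define \<epsilon> where "\<epsilon> = C * (\<rho> powr (real q + s) + real (Suc q) * K) * \<delta> powr (real q + s)"
  have \<epsilon>0: "0 \<le> \<epsilon>" unfolding \<epsilon>_def using C K by simp
  define pt where "pt m \<nu> = (\<lambda>j. if j < m then e j + \<delta> * node q (digit ?n j \<nu>) else e j + \<delta> * r j)"
    for m \<nu>
  define W where "W m \<nu> = (\<Prod>j<m. poly (lagrange q (digit ?n j \<nu>)) (r j))" for m \<nu>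
  define E where "E m = (\<Sum>\<nu><?n ^ m. F (pt m \<nu>) * W m \<nu>)" for m
  have Wb: "\<bar>W m \<nu>\<bar> \<le> K ^ m" if "m \<le> d" for m \<nu>
  proof -
    have "\<bar>W m \<nu>\<bar> = (\<Prod>j<m. \<bar>poly (lagrange q (digit ?n j \<nu>)) (r j)\<bar>)" by (simp add: W_def abs_prod)
    also have "\<dots> \<le> (\<Prod>j<m. K)"
    proof (rule prod_mono)
      fix j assume "j \<in> {..<m}"
      moreover have "digit ?n j \<nu> \<le> q" using digit_less[of ?n j \<nu>] by simp
      ultimately show "0 \<le> \<bar>poly (lagrange q (digit ?n j \<nu>)) (r j)\<bar>
          \<and> \<bar>poly (lagrange q (digit ?n j \<nu>)) (r j)\<bar> \<le> K" using K(1) r that by simp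
    qed
    finally show ?thesis by simp
  qed
  have step: "\<bar>E (Suc m) - E m\<bar> \<le> (real ?n * K) ^ d * \<epsilon>" if m: "m < d" for m
  proof -
    have W: "W (Suc m) (c * ?n ^ m + \<nu>) = W m \<nu> * poly (lagrange q c) (r m)"
      if "c < ?n" "\<nu> < ?n ^ m" for c \<nu>
    proof -
      have "W m (c * ?n ^ m + \<nu>) = W m \<nu>"
        unfolding W_def using digit_add_low[of ?n _ m \<nu> c]
        by (intro prod.cong refl) (simp add: add.commute)
      moreover have "digit ?n m (c * ?n ^ m + \<nu>) = c"
        using digit_add_top[OF that(2,1)] by (simp add: add.commute)
      ultimately show ?thesis unfolding W_def by simp
    qed
    have P: "pt (Suc m) (c * ?n ^ m + \<nu>) = (pt m \<nu>)(m := e m + \<delta> * node q c)"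
      if "c < ?n" "\<nu> < ?n ^ m" for c \<nu>
    proof
      fix j
      show "pt (Suc m) (c * ?n ^ m + \<nu>) j = ((pt m \<nu>)(m := e m + \<delta> * node q c)) j"
        using digit_add_low[of ?n j m \<nu> c] digit_add_top[OF that(2,1)]
        by (cases j m rule: linorder_cases) (auto simp: pt_def add.commute)
    qed
    have P0: "pt m \<nu> = (pt m \<nu>)(m := e m + \<delta> * r m)" for \<nu> by (auto simp: pt_def)
    \<comment> \<open>Codes below \<open>n^(m + 1)\<close> are cut into blocks by their top digit
      \<open>c\<close>, which is the node index of the coordinate just added; the lower digits are
      unchanged.\<close>
    have "E (Suc m) = (\<Sum>c<?n. \<Sum>\<nu>\<in>{c * ?n ^ m..<c * ?n ^ m + ?n ^ m}. F (pt (Suc m) \<nu>) * W (Suc m) \<nu>)"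
      unfolding E_def by (simp add: sum.nat_group del: sum.lessThan_Suc)
    also have "\<dots> = (\<Sum>c<?n. \<Sum>\<nu><?n ^ m. F (pt (Suc m) (c * ?n ^ m + \<nu>)) * W (Suc m) (c * ?n ^ m + \<nu>))"
    proof (rule sum.cong[OF refl])
      fix c
      show "(\<Sum>\<nu>\<in>{c * ?n ^ m..<c * ?n ^ m + ?n ^ m}. F (pt (Suc m) \<nu>) * W (Suc m) \<nu>)
        = (\<Sum>\<nu><?n ^ m. F (pt (Suc m) (c * ?n ^ m + \<nu>)) * W (Suc m) (c * ?n ^ m + \<nu>))"
        using sum.shift_bounds_nat_ivl[of "\<lambda>\<nu>. F (pt (Suc m) \<nu>) * W (Suc m) \<nu>" 0 "c * ?n ^ m" "?n ^ m"]
        by (simp add: atLeast0LessThan add.commute)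
    qed
    also have "\<dots> = (\<Sum>c<?n. \<Sum>\<nu><?n ^ m. W m \<nu> *
        (F ((pt m \<nu>)(m := e m + \<delta> * node q c)) * poly (lagrange q c) (r m)))"
      by (intro sum.cong refl) (simp add: W P mult_ac del: sum.lessThan_Suc)
    also have "\<dots> = (\<Sum>\<nu><?n ^ m. W m \<nu> *
        (\<Sum>c<?n. F ((pt m \<nu>)(m := e m + \<delta> * node q c)) * poly (lagrange q c) (r m)))"
      by (subst sum.swap) (simp add: sum_distrib_left del: sum.lessThan_Suc)
    finally have ES: "E (Suc m) = (\<Sum>\<nu><?n ^ m. W m \<nu> *
        (\<Sum>c<?n. F ((pt m \<nu>)(m := e m + \<delta> * node q c)) * poly (lagrange q c) (r m)))" .
    have "E (Suc m) - E m = (\<Sum>\<nu><?n ^ m. W m \<nu> *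
        ((\<Sum>c\<le>q. F ((pt m \<nu>)(m := e m + \<delta> * node q c)) * poly (lagrange q c) (r m))
          - F ((pt m \<nu>)(m := e m + \<delta> * r m))))"
      unfolding ES unfolding E_def P0[symmetric]
      by (simp add: right_diff_distrib sum_subtractf mult.commute lessThan_Suc_atMost
          del: sum.lessThan_Suc)
    also have "\<bar>\<dots>\<bar> \<le> (\<Sum>\<nu><?n ^ m. K ^ d * \<epsilon>)"
    proof (intro order_trans[OF sum_abs sum_mono])
      fix \<nu> assume "\<nu> \<in> {..<?n ^ m}"
      have "smooth1 q s C (\<lambda>t. F ((pt m \<nu>)(m := t)))" using F m by (auto simp: smoothd_def)
      from interp1[OF this C s K(1) _ r[OF m] \<delta>, of "e m"] K(2)
      have 1: "\<bar>(\<Sum>c\<le>q. F ((pt m \<nu>)(m := e m + \<delta> * node q c)) * poly (lagrange q c) (r m))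
          - F ((pt m \<nu>)(m := e m + \<delta> * r m))\<bar> \<le> \<epsilon>" unfolding \<epsilon>_def by simp
      have "\<bar>W m \<nu>\<bar> \<le> K ^ m" using Wb m by simp
      also have "\<dots> \<le> K ^ d" using m K(2) by (intro power_increasing) auto
      finally have "\<bar>W m \<nu>\<bar> \<le> K ^ d" .
      with 1 show "\<bar>W m \<nu> * ((\<Sum>c\<le>q. F ((pt m \<nu>)(m := e m + \<delta> * node q c)) * poly (lagrange q c) (r m))
          - F ((pt m \<nu>)(m := e m + \<delta> * r m)))\<bar> \<le> K ^ d * \<epsilon>"
        unfolding abs_mult using K(2) by (intro mult_mono) auto
    qed
    also have "\<dots> = real (?n ^ m) * (K ^ d * \<epsilon>)" by simp
    also have "\<dots> \<le> real (?n ^ d) * (K ^ d * \<epsilon>)"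
      using m K(2) \<epsilon>0 by (intro mult_right_mono) (auto intro!: power_increasing simp del: of_nat_power)
    finally show ?thesis by (simp add: power_mult_distrib mult_ac)
  qed
  have "\<bar>E m - E 0\<bar> \<le> real m * ((real ?n * K) ^ d * \<epsilon>)" if "m \<le> d" for m
    using that
  proof (induction m)
    case (Suc m)
    then show ?case using step[of m] by (simp add: algebra_simps)
  qed simp
  from this[of d] have "\<bar>E d - E 0\<bar> \<le> real d * ((real ?n * K) ^ d * \<epsilon>)" by simp
  moreover have "E 0 = F (\<lambda>j. e j + \<delta> * r j)" by (simp add: E_def W_def pt_def)
  moreover have "E d = tensor_interp q d F e \<delta> r"
    unfolding E_def tensor_interp_def W_def
  proof (intro sum.cong refl)
    fix \<nu>
    have "F (pt d \<nu>) = F (\<lambda>j. e j + \<delta> * node q (digit ?n j \<nu>))"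
      using F unfolding smoothd_def by (auto simp: pt_def)
    then show "F (pt d \<nu>) * (\<Prod>j<d. poly (lagrange q (digit ?n j \<nu>)) (r j)) =
         F (\<lambda>j. e j + \<delta> * node q (digit ?n j \<nu>)) * (\<Prod>j<d. poly (lagrange q (digit ?n j \<nu>)) (r j))" by simp
  qed
  ultimately show ?thesis by (simp add: \<epsilon>_def mult_ac)
qed


section \<open>Networks for locally interpolable functions\<close>

definition clip :: "real \<Rightarrow> real" where
  "clip x = relu (x + 1) - relu (x - 1) - 1"

lemma clip_bounds: "-1 \<le> clip x" "clip x \<le> 1"
  by (auto simp: clip_def relu_def)

lemma clip_id: "\<bar>x\<bar> \<le> 1 \<Longrightarrow> clip x = x"
  by (auto simp: clip_def relu_def)

lemma clip_lipschitz: "\<bar>clip x - clip y\<bar> \<le> \<bar>x - y\<bar>"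
  by (auto simp: clip_def relu_def)

lemma nets_clip: "nets d f \<Longrightarrow> nets d (\<lambda>N i v. clip (f N i v))"
  unfolding clip_def
  by (intro nets_diff nets_relu nets_add nets_const[of "\<lambda>_ _. 1" 1 0]) auto

text \<open>
  All that the network construction needs to know about a smooth function.
\<close>

definition interp_class :: "nat \<Rightarrow> nat \<Rightarrow> real \<Rightarrow> fn set" where
  "interp_class d q \<beta> = {g. (\<forall>v. (\<forall>j<d. 0 \<le> v j \<and> v j \<le> 2) \<longrightarrow> \<bar>g v\<bar> \<le> 1) \<and>
     (\<forall>e \<delta> r. (\<forall>j<d. 0 \<le> e j \<and> e j \<le> 1) \<and> 0 \<le> \<delta> \<and> \<delta> \<le> 1 \<and> sup_le d 1 r \<longrightarrow>
        \<bar>tensor_interp q d g e \<delta> r - g (\<lambda>j. e j + \<delta> * r j)\<bar> \<le> \<delta> powr \<beta>) \<and>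
     (\<forall>v w. (\<forall>j<d. v j = w j) \<longrightarrow> g v = g w)}"

text \<open>
  \<open>\<sigma>\<close> is the set of coordinates in which the grid is shifted by half a cell.
\<close>

definition shft :: "nat set \<Rightarrow> nat \<Rightarrow> real" where
  "shft \<sigma> j = (if j \<in> \<sigma> then 1 / 2 else 0)"

definition ucoord :: "nat \<Rightarrow> nat set \<Rightarrow> nat \<Rightarrow> (nat \<Rightarrow> real) \<Rightarrow> real" where
  "ucoord M \<sigma> j v = real M ^ 2 * v j + shft \<sigma> j"

definition acoord :: "nat \<Rightarrow> nat set \<Rightarrow> nat \<Rightarrow> (nat \<Rightarrow> real) \<Rightarrow> real" where
  "acoord M \<sigma> j v = coarse M (ucoord M \<sigma> j v)"

definition wcoord :: "nat \<Rightarrow> nat set \<Rightarrow> nat \<Rightarrow> (nat \<Rightarrow> real) \<Rightarrow> real" where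
  "wcoord M \<sigma> j v = ucoord M \<sigma> j v - real M * acoord M \<sigma> j v"

definition bcoord :: "nat \<Rightarrow> nat set \<Rightarrow> nat \<Rightarrow> (nat \<Rightarrow> real) \<Rightarrow> real" where
  "bcoord M \<sigma> j v = fine M (wcoord M \<sigma> j v)"

text \<open>The shift is taken off again: the nodes belong to the same base points
  \<open>(a M + b) / M^2\<close> in every grid, and only the assignment of a point to its base point
  is shifted. With correct digits the value lies in \<open>[-1/2, 1)\<close>, and one table serves
  all grids.\<close>

definition rcoord :: "nat \<Rightarrow> nat set \<Rightarrow> nat \<Rightarrow> (nat \<Rightarrow> real) \<Rightarrow> real" where
  "rcoord M \<sigma> j v = wcoord M \<sigma> j v - bcoord M \<sigma> j v - shft \<sigma> j"

text \<open>\<open>lookup\<close> requires entries in [0, 1] for all addresses, including those of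
  cells far outside the cube where \<open>g\<close> is not controlled; hence clipping before the
  rescaling. It changes nothing at the nodes that are really used.\<close>

definition nodeval :: "nat \<Rightarrow> nat \<Rightarrow> fn \<Rightarrow> nat \<Rightarrow> nat \<Rightarrow> nat \<Rightarrow> real" where
  "nodeval M q g \<nu> k m = (clip (g (\<lambda>j.
      1 / real M ^ 2 * (real (digit (Suc M) j k) * real M + real (digit (Suc M) j m))
        + 1 / real M ^ 2 * node q (digit (Suc q) j \<nu>))) + 1) / 2"

text \<open>The base is \<open>Suc M\<close> because the coarse digit can be \<open>M\<close>
  itself, close to the upper faces of the cube.\<close>

definition coef :: "nat \<Rightarrow> nat \<Rightarrow> nat \<Rightarrow> fn \<Rightarrow> nat set \<Rightarrow> nat \<Rightarrow> (nat \<Rightarrow> real) \<Rightarrow> real" where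
  "coef M q d g \<sigma> \<nu> v = lookup (Suc M ^ d) (nodeval M q g \<nu>)
     (\<Sum>j<d. real (Suc M) ^ j * acoord M \<sigma> j v) (\<Sum>j<d. real (Suc M) ^ j * bcoord M \<sigma> j v)"

definition lvars :: "nat \<Rightarrow> nat \<Rightarrow> nat \<Rightarrow> fn \<Rightarrow> nat set \<Rightarrow> (nat \<Rightarrow> real) \<Rightarrow> nat \<Rightarrow> real" where
  "lvars M q d g \<sigma> v i = (if i < Suc q ^ d then coef M q d g \<sigma> i v
     else rcoord M \<sigma> (i - Suc q ^ d) v)"

text \<open>
  Variables \<open>\<nu> < (q + 1)\<^sup>d\<close> are the nodal values rescaled to \<open>[0, 1]\<close>, with multi-indices coded by
  their digits in base \<open>q + 1\<close>; the \<open>d\<close> variables after them are the local coordinates.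
\<close>

definition lpoly :: "nat \<Rightarrow> nat \<Rightarrow> fn" where
  "lpoly q d v = (\<Sum>\<nu><Suc q ^ d. (2 * v \<nu> + - 1) *
     (\<Prod>j<d. poly (lagrange q (digit (Suc q) j \<nu>)) (v (Suc q ^ d + j))))"

lemma fast_approx_lpoly: "fast_approx (Suc q ^ d + d) (lpoly q d)"
  unfolding lpoly_def
  by (intro fast_approx_sum fast_approx_mult fast_approx_add fast_approx_const fast_approx_prod fast_approx_poly fast_approx_coord) auto

text \<open>Clipping precedes the penalty: with wrong digits the local variables leave [-1, 1],
  where nothing is known about \<open>\<phi> N\<close>.\<close>

definition netout :: "(nat \<Rightarrow> fn) \<Rightarrow> nat \<Rightarrow> nat \<Rightarrow> nat \<Rightarrow> nat \<Rightarrow> fn \<Rightarrow> nat set \<Rightarrow> fn" where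
  "netout \<phi> N M q d g \<sigma> v = clip (\<phi> N (lvars M q d g \<sigma> v)) - (\<Sum>j<d. bad M (ucoord M \<sigma> j v))"

text \<open>The index of the family is the target function \<open>g\<close>. It enters through the
  table only, so depth, width and weight bounds are uniform over all targets.\<close>

lemma nets_netout:
  fixes M :: "nat \<Rightarrow> nat"
  assumes M: "\<And>N. 2 \<le> N \<Longrightarrow> M N \<le> N" "\<And>N. 2 \<le> N \<Longrightarrow> Suc (M N) ^ d \<le> k0 * N"
    and \<phi>: "nets (Suc q ^ d + d) (\<lambda>N (_::unit). \<phi> N)"
  shows "nets d (\<lambda>N g v. netout \<phi> N (M N) q d g \<sigma> v)"
proof -
  have Mb: "\<bar>real (M N)\<bar> \<le> 1 * real N ^ 1" if "2 \<le> N" for N using M(1)[OF that] by simp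
  have u: "nets d (\<lambda>N (g::fn) v. ucoord (M N) \<sigma> j v)" if "j < d" for j
  proof -
    have "nets d (\<lambda>N (g::fn) v. real (M N) ^ 2 * v j)"
      by (rule nets_scale[OF nets_coord[OF that], where K = 1 and m = 2])
         (use M(1) in \<open>auto intro!: power_mono\<close>)
    moreover have "nets d (\<lambda>N (g::fn) v. shft \<sigma> j)"
      by (rule nets_const[of _ 1 0]) (auto simp: shft_def)
    ultimately show ?thesis unfolding ucoord_def by (rule nets_add)
  qed
  have a: "nets d (\<lambda>N (g::fn) v. acoord (M N) \<sigma> j v)" if "j < d" for j
    unfolding acoord_def by (rule nets_coarse[OF _ u[OF that]]) (rule M(1))
  have w: "nets d (\<lambda>N (g::fn) v. wcoord (M N) \<sigma> j v)" if "j < d" for j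
    unfolding wcoord_def
    by (intro nets_diff u[OF that] nets_scale[OF a[OF that], where K = 1 and m = 1] Mb)
  have b: "nets d (\<lambda>N (g::fn) v. bcoord (M N) \<sigma> j v)" if "j < d" for j
    unfolding bcoord_def by (rule nets_fine[OF _ w[OF that]]) (rule M(1))
  have r: "nets d (\<lambda>N (g::fn) v. rcoord (M N) \<sigma> j v)" if "j < d" for j
    unfolding rcoord_def
    by (intro nets_diff w[OF that] b[OF that] nets_const[of _ 1 0]) (auto simp: shft_def)
  have pb: "\<bar>real (Suc (M N)) ^ j\<bar> \<le> 2 ^ j * real N ^ j" if "2 \<le> N" for N j
  proof -
    have "real (Suc (M N)) ^ j \<le> (2 * real N) ^ j"
      using M(1)[OF that] that by (intro power_mono) auto
    then show ?thesis by (simp add: power_mult_distrib)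
  qed
  have c: "nets d (\<lambda>N g v. coef (M N) q d g \<sigma> \<nu> v)" for \<nu>
    unfolding coef_def
  proof (rule nets_lookup)
    show "nets d (\<lambda>N (i::fn) v. \<Sum>j<d. real (Suc (M N)) ^ j * acoord (M N) \<sigma> j v)"
      using a by (intro nets_sum nets_scale[OF _ pb]) auto
    show "nets d (\<lambda>N (i::fn) v. \<Sum>j<d. real (Suc (M N)) ^ j * bcoord (M N) \<sigma> j v)"
      using b by (intro nets_sum nets_scale[OF _ pb]) auto
    show "Suc (M N) ^ d \<le> k0 * N" if "2 \<le> N" for N by (rule M(2)[OF that])
    show "\<bar>nodeval (M N) q g \<nu> k m\<bar> \<le> 1" for N g k m
      using clip_bounds by (auto simp: nodeval_def abs_le_iff) (smt (verit) clip_bounds)+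
  qed
  have "nets d (\<lambda>N g v. \<phi> N (\<lambda>i. lvars (M N) q d g \<sigma> v i))"
  proof (rule nets_compose[OF \<phi>])
    show "0 < Suc q ^ d + d" by simp
    show "nets d (\<lambda>N g v. lvars (M N) q d g \<sigma> v i)" if "i < Suc q ^ d + d" for i
    proof (cases "i < Suc q ^ d")
      case True
      then show ?thesis using c by (simp add: lvars_def)
    next
      case False
      then show ?thesis using r[of "i - Suc q ^ d"] that by (simp add: lvars_def)
    qed
  qed
  then show ?thesis
    unfolding netout_def using u by (intro nets_diff nets_clip nets_sum nets_bad[OF M(1)]) auto
qed

text \<open>Stated without the penalty, so that it serves both directions: for every grid with
  correct digits it bounds the output from above, and for a grid with zero penalty also from
  below.\<close>

lemma netout_good:
  assumes g: "g \<in> interp_class d q \<beta>" and v: "\<And>j. j < d \<Longrightarrow> 0 \<le> v j \<and> v j \<le> 1"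
    and M: "1 \<le> M"
    and \<phi>: "\<And>v. (\<And>j. j < Suc q ^ d + d \<Longrightarrow> \<bar>v j\<bar> \<le> 1) \<Longrightarrow> \<bar>\<phi> N v - lpoly q d v\<bar> \<le> \<epsilon>"
    and good: "\<And>j. j < d \<Longrightarrow> bad M (ucoord M \<sigma> j v) < 2"
  shows "\<bar>clip (\<phi> N (lvars M q d g \<sigma> v)) - g v\<bar> \<le> \<epsilon> + (1 / real M ^ 2) powr \<beta>"
proof -
  let ?\<delta> = "1 / real M ^ 2"
  have M0: "0 < real M" "1 \<le> real M" using M by auto
  have \<delta>: "0 < ?\<delta>" "?\<delta> \<le> 1" using M0 by (auto simp: one_le_power)
  have gb: "\<bar>g v\<bar> \<le> 1" if "\<And>j. j < d \<Longrightarrow> 0 \<le> v j \<and> v j \<le> 2" for v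
    using g that unfolding interp_class_def by blast
  have sh: "0 \<le> shft \<sigma> j" "shft \<sigma> j \<le> 1 / 2" for j by (auto simp: shft_def)
  have ub: "0 \<le> ucoord M \<sigma> j v" "ucoord M \<sigma> j v \<le> real M ^ 2 + 1 / 2" if "j < d" for j
  proof -
    have "real M ^ 2 * v j \<le> real M ^ 2 * 1" using v[OF that] by (intro mult_left_mono) auto
    then show "ucoord M \<sigma> j v \<le> real M ^ 2 + 1 / 2" using sh[of j] by (simp add: ucoord_def)
    show "0 \<le> ucoord M \<sigma> j v" using v[OF that] sh[of j] by (simp add: ucoord_def)
  qed
  have ex: "\<exists>a b. a \<le> M \<and> b < M \<and> acoord M \<sigma> j v = real a \<and> bcoord M \<sigma> j v = real b
     \<and> real a * real M + real b \<le> ucoord M \<sigma> j v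
     \<and> ucoord M \<sigma> j v < real a * real M + real b + 1" if j: "j < d" for j
  proof -
    have "ucoord M \<sigma> j v < real M ^ 2 + real M" using ub[OF j] M0 by linarith
    from digits_good[OF M ub(1)[OF j] this good[OF j]] show ?thesis
      unfolding bcoord_def wcoord_def acoord_def by (auto simp: mult.commute)
  qed
  have "\<forall>j. \<exists>p. j < d \<longrightarrow> fst p \<le> M \<and> snd p < M \<and> acoord M \<sigma> j v = real (fst p)
     \<and> bcoord M \<sigma> j v = real (snd p) \<and> real (fst p) * real M + real (snd p) \<le> ucoord M \<sigma> j v
     \<and> ucoord M \<sigma> j v < real (fst p) * real M + real (snd p) + 1"
    using ex by auto
  from choice[OF this] obtain p where p: "\<And>j. j < d \<Longrightarrow> fst (p j) \<le> M \<and> snd (p j) < M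
     \<and> acoord M \<sigma> j v = real (fst (p j)) \<and> bcoord M \<sigma> j v = real (snd (p j))
     \<and> real (fst (p j)) * real M + real (snd (p j)) \<le> ucoord M \<sigma> j v
     \<and> ucoord M \<sigma> j v < real (fst (p j)) * real M + real (snd (p j)) + 1"
    by blast
  define a where "a j = fst (p j)" for j
  define b where "b j = snd (p j)" for j
  have ab: "\<And>j. j < d \<Longrightarrow> a j \<le> M" "\<And>j. j < d \<Longrightarrow> b j < M"
      "\<And>j. j < d \<Longrightarrow> acoord M \<sigma> j v = real (a j)" "\<And>j. j < d \<Longrightarrow> bcoord M \<sigma> j v = real (b j)"
      "\<And>j. j < d \<Longrightarrow> real (a j) * real M + real (b j) \<le> ucoord M \<sigma> j v"
      "\<And>j. j < d \<Longrightarrow> ucoord M \<sigma> j v < real (a j) * real M + real (b j) + 1"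
    unfolding a_def b_def using p by blast+
  define k where "k = (\<Sum>j<d. a j * Suc M ^ j)"
  define m where "m = (\<Sum>j<d. b j * Suc M ^ j)"
  have ab': "\<And>j. j < d \<Longrightarrow> a j < Suc M" "\<And>j. j < d \<Longrightarrow> b j < Suc M"
    using ab(1,2) by (auto simp: le_imp_less_Suc less_SucI)
  have k: "k < Suc M ^ d" "\<And>j. j < d \<Longrightarrow> digit (Suc M) j k = a j"
    unfolding k_def using flat_less[of d a "Suc M"] digit_flat[of d a "Suc M"] ab' by auto
  have m: "m < Suc M ^ d" "\<And>j. j < d \<Longrightarrow> digit (Suc M) j m = b j"
    unfolding m_def using flat_less[of d b "Suc M"] digit_flat[of d b "Suc M"] ab' by auto
  have sums: "(\<Sum>j<d. real (Suc M) ^ j * acoord M \<sigma> j v) = real k"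
      "(\<Sum>j<d. real (Suc M) ^ j * bcoord M \<sigma> j v) = real m"
    unfolding k_def m_def by (auto simp: ab mult.commute intro!: sum.cong)
  have T01: "0 \<le> nodeval M q g \<nu> k m \<and> nodeval M q g \<nu> k m \<le> 1" for \<nu> k m
    unfolding nodeval_def
    using clip_bounds[of "g (\<lambda>j. 1 / real M ^ 2 * (real (digit (Suc M) j k) * real M
      + real (digit (Suc M) j m)) + 1 / real M ^ 2 * node q (digit (Suc q) j \<nu>))"] by auto
  have coef: "coef M q d g \<sigma> \<nu> v = nodeval M q g \<nu> k m" for \<nu>
    unfolding coef_def sums by (rule lookup_eq[OF k(1) m(1) T01])
  define e where "e j = ?\<delta> * (real (a j) * real M + real (b j))" for j
  define r where "r j = rcoord M \<sigma> j v" for j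
  have e01: "0 \<le> e j \<and> e j \<le> 1" if "j < d" for j
  proof -
    have "real (a j * M + b j) \<le> real (M ^ 2) + 1 / 2" using ab(5)[OF that] ub(2)[OF that] by simp
    \<comment> \<open>An integer that is at most \<open>M^2 + 1/2\<close> is at most
      \<open>M^2\<close>; the half comes from the shift.\<close>
    then have "a j * M + b j \<le> M ^ 2" by linarith
    then have "real (a j * M + b j) \<le> real (M ^ 2)" by (simp only: of_nat_le_iff)
    then show ?thesis using M0 by (simp add: e_def field_simps)
  qed
  have r_eq: "r j = ucoord M \<sigma> j v - (real (a j) * real M + real (b j)) - shft \<sigma> j" if "j < d" for j
    by (simp add: r_def rcoord_def wcoord_def ab(3,4)[OF that] mult.commute)
  have r1: "\<bar>r j\<bar> \<le> 1" if "j < d" for j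
    using ab(5,6)[OF that] sh[of j] unfolding r_eq[OF that] by linarith
  have vj: "e j + ?\<delta> * r j = v j" if "j < d" for j
    unfolding r_eq[OF that] e_def ucoord_def using M0 by (simp add: field_simps)
  have node: "2 * nodeval M q g \<nu> k m + - 1 = g (\<lambda>j. e j + ?\<delta> * node q (digit (Suc q) j \<nu>))" for \<nu>
  proof -
    let ?p = "\<lambda>j. e j + ?\<delta> * node q (digit (Suc q) j \<nu>)"
    have "g (\<lambda>j. ?\<delta> * (real (digit (Suc M) j k) * real M + real (digit (Suc M) j m))
        + ?\<delta> * node q (digit (Suc q) j \<nu>)) = g ?p"
      using g k(2) m(2) unfolding interp_class_def e_def by auto
    \<comment> \<open>A cell may have its base point on the face \<open>e j = 1\<close>, so nodes
      can exceed 1. For this reason \<open>interp_class\<close> bounds \<open>g\<close> for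
      coordinates up to 2.\<close>
    moreover have "\<bar>g ?p\<bar> \<le> 1"
    proof (rule gb)
      fix j assume j: "j < d"
      have "digit (Suc q) j \<nu> \<le> q" using digit_less[of "Suc q" j \<nu>] by simp
      note node_range[OF this]
      then have "0 \<le> ?\<delta> * node q (digit (Suc q) j \<nu>)" "?\<delta> * node q (digit (Suc q) j \<nu>) \<le> 1"
        using \<delta> by (auto intro!: mult_nonneg_nonneg mult_le_one simp del: times_divide_eq_left)
      then show "0 \<le> ?p j \<and> ?p j \<le> 2" using e01[OF j] by linarith
    qed
    ultimately show ?thesis unfolding nodeval_def by (simp add: clip_id add_divide_distrib)
  qed
  have lv: "lpoly q d (lvars M q d g \<sigma> v) = tensor_interp q d g e ?\<delta> r"
    unfolding lpoly_def tensor_interp_def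
  proof (rule sum.cong[OF refl])
    fix \<nu> assume "\<nu> \<in> {..<Suc q ^ d}"
    then have "lvars M q d g \<sigma> v \<nu> = nodeval M q g \<nu> k m" by (simp add: lvars_def coef)
    moreover have "lvars M q d g \<sigma> v (Suc q ^ d + j) = r j" for j by (simp add: lvars_def r_def)
    ultimately show "(2 * lvars M q d g \<sigma> v \<nu> + - 1) *
         (\<Prod>j<d. poly (lagrange q (digit (Suc q) j \<nu>)) (lvars M q d g \<sigma> v (Suc q ^ d + j))) =
         g (\<lambda>j. e j + ?\<delta> * node q (digit (Suc q) j \<nu>)) * (\<Prod>j<d. poly (lagrange q (digit (Suc q) j \<nu>)) (r j))"
      by (simp only: node)
  qed
  have "\<bar>lvars M q d g \<sigma> v j\<bar> \<le> 1" if "j < Suc q ^ d + d" for j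
    using that T01[of j k m] r1[of "j - Suc q ^ d"] by (auto simp: lvars_def coef r_def)
  from \<phi>[of "lvars M q d g \<sigma> v", OF this]
  have 1: "\<bar>\<phi> N (lvars M q d g \<sigma> v) - tensor_interp q d g e ?\<delta> r\<bar> \<le> \<epsilon>" unfolding lv .
  have dep: "g v = g w" if "\<forall>j<d. v j = w j" for v w using g that unfolding interp_class_def by blast
  have "g (\<lambda>j. e j + ?\<delta> * r j) = g v" using vj by (intro dep) simp
  moreover have "\<bar>tensor_interp q d g e ?\<delta> r - g (\<lambda>j. e j + ?\<delta> * r j)\<bar> \<le> ?\<delta> powr \<beta>"
  proof -
    have "\<And>e \<delta> r. (\<forall>j<d. 0 \<le> e j \<and> e j \<le> 1) \<and> 0 \<le> \<delta> \<and> \<delta> \<le> 1 \<and> sup_le d 1 r \<Longrightarrow>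
        \<bar>tensor_interp q d g e \<delta> r - g (\<lambda>j. e j + \<delta> * r j)\<bar> \<le> \<delta> powr \<beta>"
      using g unfolding interp_class_def by blast
    from this[of e ?\<delta> r] show ?thesis using e01 r1 \<delta> less_imp_le[OF \<delta>(1)] by blast
  qed
  ultimately have 2: "\<bar>tensor_interp q d g e ?\<delta> r - g v\<bar> \<le> ?\<delta> powr \<beta>" by simp
  have "\<bar>g v\<bar> \<le> 1"
  proof (rule gb)
    fix j assume "j < d"
    from v[OF this] show "0 \<le> v j \<and> v j \<le> 2" by linarith
  qed
  then have "clip (g v) = g v" by (rule clip_id)
  then show ?thesis using 1 2 clip_lipschitz[of "\<phi> N (lvars M q d g \<sigma> v)" "g v"] by linarith
qed

lemma netout_Max:
  assumes g: "g \<in> interp_class d q \<beta>" and v: "\<And>j. j < d \<Longrightarrow> 0 \<le> v j \<and> v j \<le> 1"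
    and M: "1 \<le> M" and \<epsilon>: "0 \<le> \<epsilon>"
    and \<phi>: "\<And>v. (\<And>j. j < Suc q ^ d + d \<Longrightarrow> \<bar>v j\<bar> \<le> 1) \<Longrightarrow> \<bar>\<phi> N v - lpoly q d v\<bar> \<le> \<epsilon>"
  shows "\<bar>(MAX \<sigma>\<in>Pow {..<d}. netout \<phi> N M q d g \<sigma> v) - g v\<bar> \<le> \<epsilon> + (1 / real M ^ 2) powr \<beta>"
proof -
  let ?E = "\<epsilon> + (1 / real M ^ 2) powr \<beta>"
  let ?S = "(\<lambda>\<sigma>. netout \<phi> N M q d g \<sigma> v) ` Pow {..<d}"
  have E0: "0 \<le> ?E" using \<epsilon> by simp
  have M0: "1 \<le> real M" using M by simp
  have v2: "\<forall>j<d. 0 \<le> v j \<and> v j \<le> 2"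
  proof (intro allI impI)
    fix j assume "j < d"
    from v[OF this] show "0 \<le> v j \<and> v j \<le> 2" by linarith
  qed
  then have gb: "-1 \<le> g v" using g unfolding interp_class_def by (auto simp: abs_le_iff)
  have upper: "netout \<phi> N M q d g \<sigma> v \<le> g v + ?E" for \<sigma>
  proof (cases "\<forall>j<d. bad M (ucoord M \<sigma> j v) < 2")
    case True
    have "0 \<le> (\<Sum>j<d. bad M (ucoord M \<sigma> j v))" by (intro sum_nonneg bad_nonneg)
    moreover have "\<bar>clip (\<phi> N (lvars M q d g \<sigma> v)) - g v\<bar> \<le> ?E"
      using True by (intro netout_good g v M \<phi>) auto
    ultimately show ?thesis unfolding netout_def by linarith
  next
    \<comment> \<open>The clipped part is at most 1 and the penalty at least 2, so the output is at
      most -1, which no value of \<open>g\<close> on the cube undercuts.\<close>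
    case False
    then obtain j where j: "j < d" "2 \<le> bad M (ucoord M \<sigma> j v)" by (auto simp: not_less)
    have "bad M (ucoord M \<sigma> j v) \<le> (\<Sum>j<d. bad M (ucoord M \<sigma> j v))"
      using j by (intro member_le_sum bad_nonneg) auto
    then show ?thesis
      using j(2) clip_bounds(2)[of "\<phi> N (lvars M q d g \<sigma> v)"] gb E0 unfolding netout_def by linarith
  qed
  \<comment> \<open>Shift exactly those coordinates in which the unshifted grid has an integer
    within 1/4; by \<open>far_or_far\<close> this grid has zero penalty.\<close>
  define \<sigma> where "\<sigma> = {j. j < d \<and> \<not> (\<forall>k::nat. 1 / 4 \<le> \<bar>real M ^ 2 * v j - real k\<bar>)}"
  have bad0: "bad M (ucoord M \<sigma> j v) = 0" if j: "j < d" for j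
  proof (rule bad_zero[OF M])
    have *: "real M ^ 2 * v j \<le> real M ^ 2 * 1" "0 \<le> real M ^ 2 * v j"
      using v[OF j] by (auto intro!: mult_left_mono simp del: mult_1_right)
    then show "0 \<le> ucoord M \<sigma> j v" "ucoord M \<sigma> j v < real M ^ 2 + real M"
      using * M0 unfolding ucoord_def by (cases "j \<in> \<sigma>"; simp only: shft_def if_True if_False; linarith)+
    show "1 / 4 \<le> \<bar>ucoord M \<sigma> j v - real k\<bar>" for k :: nat
    proof (cases "j \<in> \<sigma>")
      case True
      then have "\<forall>k::nat. 1 / 4 \<le> \<bar>real M ^ 2 * v j + 1 / 2 - real k\<bar>"
        using far_or_far[of "real M ^ 2 * v j"] unfolding \<sigma>_def by blast
      then show ?thesis using True by (simp add: ucoord_def shft_def)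
    next
      case False
      then show ?thesis using j by (simp add: ucoord_def shft_def \<sigma>_def)
    qed
  qed
  have "\<bar>clip (\<phi> N (lvars M q d g \<sigma> v)) - g v\<bar> \<le> ?E"
    by (intro netout_good g v M \<phi>) (auto simp: bad0)
  then have "g v - ?E \<le> netout \<phi> N M q d g \<sigma> v" by (simp add: netout_def bad0)
  also have "\<dots> \<le> Max ?S" by (intro Max_ge) (auto simp: \<sigma>_def)
  finally have "g v - ?E \<le> Max ?S" .
  moreover have "Max ?S \<le> g v + ?E" using upper by (intro Max.boundedI) auto
  ultimately show ?thesis by (simp add: abs_le_iff)
qed

theorem interp_class_approx:
  assumes d: "1 \<le> d" and \<beta>: "0 < \<beta>"
  shows "\<exists>\<Phi> c. nets d \<Phi> \<and> 0 \<le> c \<and> (\<forall>N\<ge>2. \<forall>g\<in>interp_class d q \<beta>. \<forall>v. (\<forall>j<d. 0 \<le> v j \<and> v j \<le> 1) \<longrightarrow>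
    \<bar>\<Phi> N g v - g v\<bar> \<le> c * real N powr (- (2 * \<beta> / real d)))"
proof -
  define M where "M N = nat \<lfloor>real N powr (1 / real d)\<rfloor>" for N
  have d0: "0 < real d" using d by simp
  have M1: "1 \<le> M N" and Mle: "real (M N) \<le> real N powr (1 / real d)"
    and Mge: "real N powr (1 / real d) \<le> 2 * real (M N)" if "2 \<le> N" for N
  proof -
    have "1 powr (1 / real d) \<le> real N powr (1 / real d)" using that d0 by (intro powr_mono2) auto
    then have *: "1 \<le> real N powr (1 / real d)" by simp
    then have "1 \<le> \<lfloor>real N powr (1 / real d)\<rfloor>" by (simp add: le_floor_iff)
    then show M1: "1 \<le> M N" unfolding M_def by linarith
    show "real (M N) \<le> real N powr (1 / real d)" unfolding M_def using * by (simp add: of_nat_floor)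
    have "real N powr (1 / real d) < real (M N) + 1" unfolding M_def using * by linarith
    then show "real N powr (1 / real d) \<le> 2 * real (M N)" using M1 by linarith
  qed
  have pw: "(real N powr (1 / real d)) ^ d = real N" if "2 \<le> N" for N
    using that d0 by (simp add: powr_realpow[symmetric] powr_powr)
  have Md: "real (M N) ^ d \<le> real N" if "2 \<le> N" for N
    using power_mono[OF Mle[OF that], of d] pw[OF that] by simp
  have MN: "M N \<le> N" if "2 \<le> N" for N
  proof -
    have "real (M N) ^ 1 \<le> real (M N) ^ d" using M1[OF that] d by (intro power_increasing) auto
    then show ?thesis using Md[OF that] by simp
  qed
  have MS: "Suc (M N) ^ d \<le> 2 ^ d * N" if "2 \<le> N" for N
  proof -
    have "real (Suc (M N) ^ d) \<le> (2 * real (M N)) ^ d"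
      unfolding of_nat_power using M1[OF that] by (intro power_mono) auto
    also have "\<dots> \<le> 2 ^ d * real N" using Md[OF that] by (simp add: power_mult_distrib)
    finally have "real (Suc (M N) ^ d) \<le> real (2 ^ d * N)" by simp
    then show ?thesis by (simp only: of_nat_le_iff)
  qed
  \<comment> \<open>Makes the error of the polynomial network no larger than the interpolation
    error.\<close>
  define \<gamma> where "\<gamma> = nat \<lceil>2 * \<beta> / real d\<rceil>"
  obtain \<phi> where \<phi>: "nets (Suc q ^ d + d) (\<lambda>N (_::unit). \<phi> N)"
    "\<And>N v. 2 \<le> N \<Longrightarrow> (\<And>j. j < Suc q ^ d + d \<Longrightarrow> \<bar>v j\<bar> \<le> 1) \<Longrightarrow>
       \<bar>\<phi> N v - lpoly q d v\<bar> \<le> 1 / real N ^ \<gamma>"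
    using fast_approx_lpoly[of q d] unfolding fast_approx_def by metis
  define \<Phi> where "\<Phi> N g v = (MAX \<sigma>\<in>Pow {..<d}. netout \<phi> N (M N) q d g \<sigma> v)" for N g v
  have "nets d \<Phi>"
  proof -
    have "nets d (\<lambda>N g v. MAX \<sigma>\<in>Pow {..<d}. netout \<phi> N (M N) q d g \<sigma> v)"
      by (intro nets_Max nets_netout[OF MN MS \<phi>(1)]) auto
    then show ?thesis by (simp add: \<Phi>_def[abs_def])
  qed
  \<comment> \<open>The 1 is for the polynomial network; the power of 2 is lost by rounding, as
    \<open>M N\<close> is only known to be at least half of \<open>N powr (1 / d)\<close>.\<close>
  moreover have "\<bar>\<Phi> N g v - g v\<bar> \<le> (1 + 2 powr (2 * \<beta>)) * real N powr (- (2 * \<beta> / real d))"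
    if N: "2 \<le> N" and g: "g \<in> interp_class d q \<beta>" and v: "\<forall>j<d. 0 \<le> v j \<and> v j \<le> 1" for N g v
  proof -
    have 1: "\<bar>\<Phi> N g v - g v\<bar> \<le> 1 / real N ^ \<gamma> + (1 / real (M N) ^ 2) powr \<beta>"
      unfolding \<Phi>_def using v by (intro netout_Max g M1[OF N] \<phi>(2)[OF N]) auto
    have N0: "1 < real N" using N by simp
    have "1 / real N ^ \<gamma> = real N powr (- real \<gamma>)"
      using N0 by (simp add: powr_minus powr_realpow field_simps)
    also have "\<dots> \<le> real N powr (- (2 * \<beta> / real d))"
    proof (rule powr_mono)
      show "- real \<gamma> \<le> - (2 * \<beta> / real d)" unfolding \<gamma>_def using \<beta> d0 by linarith
    qed (use N0 in simp)
    finally have 2: "1 / real N ^ \<gamma> \<le> real N powr (- (2 * \<beta> / real d))" .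
    have Mp: "0 < real (M N)" using M1[OF N] by simp
    have "(1 / real (M N) ^ 2) powr \<beta> = real (M N) powr (- (2 * \<beta>))"
    proof -
      have "1 / real (M N) ^ 2 = real (M N) powr (- real 2)"
        using Mp by (simp only: powr_minus powr_realpow inverse_eq_divide)
      then show ?thesis by (simp only: powr_powr) simp
    qed
    also have "\<dots> \<le> (real N powr (1 / real d) / 2) powr (- (2 * \<beta>))"
      using Mge[OF N] N0 \<beta> by (intro powr_mono2') auto
    also have "\<dots> = 2 powr (2 * \<beta>) * real N powr (- (2 * \<beta> / real d))"
    proof -
      have "(real N powr (1 / real d) / 2) powr (- (2 * \<beta>))
          = (real N powr (1 / real d)) powr (- (2 * \<beta>)) / 2 powr (- (2 * \<beta>))"
        by (rule powr_divide)
      also have "(real N powr (1 / real d)) powr (- (2 * \<beta>)) = real N powr (- (2 * \<beta> / real d))"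
        unfolding powr_powr by simp
      also have "2 powr (- (2 * \<beta>)) = inverse (2 powr (2 * \<beta>))" by (rule powr_minus)
      finally show ?thesis by (simp only: divide_inverse inverse_inverse_eq mult.commute)
    qed
    finally show ?thesis using 1 2 by (simp add: algebra_simps)
  qed
  ultimately show ?thesis by (intro exI[of _ \<Phi>] exI[of _ "1 + 2 powr (2 * \<beta>)"]) auto
qed


section \<open>Smooth functions\<close>

lemma iterated_partial_sequence:
  assumes "has_iterated_partial n (replicate q j) h h'"
  shows "\<exists>D. D 0 = h \<and> (\<forall>m<q. has_partial n j (D m) (D (Suc m))) \<and>
    (\<forall>x\<in>carrier_vec n. D q x = h' x)"
  using assms
proof (induction q arbitrary: h)
  case 0
  then show ?case by (intro exI[of _ "\<lambda>_. h"]) simp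
next
  case (Suc q)
  then obtain k where k: "has_partial n j h k" "has_iterated_partial n (replicate q j) k h'"
    by auto
  obtain D where D: "D 0 = k" "\<And>m. m < q \<Longrightarrow> has_partial n j (D m) (D (Suc m))"
      "\<And>x. x \<in> carrier_vec n \<Longrightarrow> D q x = h' x"
    using Suc.IH[OF k(2)] by blast
  show ?case
    using D k(1)
    by (intro exI[of _ "case_nat h D"]) (auto simp: less_Suc_eq_0_disj)
qed

lemma has_partial_line:
  assumes "has_partial n j f f'" "j < n"
  shows "((\<lambda>t. f (vec n (x(j := t)))) has_real_derivative f' (vec n (x(j := t)))) (at t)"
proof -
  let ?y = "vec n (x(j := t))"
  have "((\<lambda>u. f (?y + u \<cdot>\<^sub>v unit_vec n j)) has_real_derivative f' ?y) (at 0)"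
    using assms(1) unfolding has_partial_def by simp
  moreover have "?y + u \<cdot>\<^sub>v unit_vec n j = vec n (x(j := u + t))" for u
    using assms(2) by (intro eq_vecI) (auto simp: unit_vec_def)
  ultimately have "((\<lambda>u. f (vec n (x(j := u + t)))) has_real_derivative f' ?y) (at 0)" by simp
  then show ?thesis using DERIV_shift[of "\<lambda>t. f (vec n (x(j := t)))" "f' ?y" 0 t] by simp
qed

text \<open>The hypothesis is applied to the multi-index with all \<open>q\<close> derivatives in
  direction \<open>j\<close>. On a line parallel to that axis the Euclidean distance is the distance
  of the parameters.\<close>

lemma holder_smoothd:
  assumes h: "holder_smooth d \<beta> C h" and \<beta>: "\<beta> = real q + s" "0 < s" "s \<le> 1"
  shows "smoothd d q s C (\<lambda>v. h (vec d v))"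
proof -
  obtain q' s' where q': "\<beta> = real q' + s'" "0 < s'" "s' \<le> 1"
    and H: "\<And>\<alpha>. (\<Sum>j<d. \<alpha> j) = q' \<Longrightarrow> \<exists>h'. has_multi_partial d \<alpha> h h' \<and>
         (\<forall>x\<in>carrier_vec d. \<forall>z\<in>carrier_vec d.
            \<bar>h' x - h' z\<bar> \<le> C * L2_set (\<lambda>i. x $ i - z $ i) {..<d} powr s')"
    using h unfolding holder_smooth_def by blast
  \<comment> \<open>The condition \<open>0 < s \<le> 1\<close> makes the decomposition of \<beta>
    unique.\<close>
  have "real q < real q' + 1" "real q' < real q + 1" using q' \<beta> by linarith+
  then have qq: "q' = q" by linarith
  have ss: "s' = s" using q'(1) \<beta>(1) unfolding qq by linarith
  have "smooth1 q s C (\<lambda>t. h (vec d (x(j := t))))" if j: "j < d" for x j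
  proof -
    have "(\<Sum>i<d. if i = j then q else 0) = q'" using j qq by simp
    from H[OF this] obtain h' where h': "has_multi_partial d (\<lambda>i. if i = j then q else 0) h h'"
      "\<And>x z. x \<in> carrier_vec d \<Longrightarrow> z \<in> carrier_vec d \<Longrightarrow>
            \<bar>h' x - h' z\<bar> \<le> C * L2_set (\<lambda>i. x $ i - z $ i) {..<d} powr s"
      unfolding ss by blast
    have "count_list (replicate q j) i = (if i = j then q else 0)" for i
      by (induction q) auto
    then have "has_iterated_partial d (replicate q j) h h'"
      using h'(1) j unfolding has_multi_partial_def by (auto simp: set_replicate_conv_if)
    from iterated_partial_sequence[OF this] obtain D where
      D: "D 0 = h" "\<And>m. m < q \<Longrightarrow> has_partial d j (D m) (D (Suc m))"
         "\<And>x. x \<in> carrier_vec d \<Longrightarrow> D q x = h' x" by blast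
    have L: "L2_set (\<lambda>i. vec d (x(j := t)) $ i - vec d (x(j := t')) $ i) {..<d} = \<bar>t - t'\<bar>" for t t'
    proof -
      have "(\<Sum>i<d. (vec d (x(j := t)) $ i - vec d (x(j := t')) $ i)\<^sup>2)
          = (\<Sum>i<d. if i = j then (t - t')\<^sup>2 else 0)"
        by (intro sum.cong) auto
      then show ?thesis using j by (simp add: L2_set_def)
    qed
    have "\<bar>h' (vec d (x(j := t))) - h' (vec d (x(j := t')))\<bar> \<le> C * \<bar>t - t'\<bar> powr s" for t t'
      using h'(2)[of "vec d (x(j := t))" "vec d (x(j := t'))"] unfolding L by simp
    then show ?thesis
      unfolding smooth1_def using D has_partial_line[OF D(2) j, of _ x]
      by (intro exI[of _ "\<lambda>m t. D m (vec d (x(j := t)))"]) auto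
  qed
  moreover have "h (vec d v) = h (vec d w)" if "\<forall>j<d. v j = w j" for v w
  proof -
    have "vec d v = vec d w" using that by (intro eq_vecI) auto
    then show ?thesis by simp
  qed
  ultimately show ?thesis unfolding smoothd_def by blast
qed

section \<open>Bounds and Lipschitz constants on larger cubes\<close>

lemma tensor_interp_bound:
  fixes K :: real
  assumes K: "\<And>k r. k \<le> q \<Longrightarrow> \<bar>r\<bar> \<le> \<rho> \<Longrightarrow> \<bar>poly (lagrange q k) r\<bar> \<le> K" "1 \<le> K"
    and r: "\<And>j. j < d \<Longrightarrow> \<bar>r j\<bar> \<le> \<rho>"
    and F: "\<And>\<nu>. \<bar>F (\<lambda>j. e j + \<delta> * node q (digit (Suc q) j \<nu>))\<bar> \<le> R"
  shows "\<bar>tensor_interp q d F e \<delta> r\<bar> \<le> (real (Suc q) * K) ^ d * R"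
proof -
  have "\<bar>tensor_interp q d F e \<delta> r\<bar> \<le> (\<Sum>\<nu><Suc q ^ d. R * K ^ d)"
    unfolding tensor_interp_def
  proof (intro order_trans[OF sum_abs sum_mono])
    fix \<nu>
    have "\<bar>\<Prod>j<d. poly (lagrange q (digit (Suc q) j \<nu>)) (r j)\<bar> \<le> (\<Prod>j<d. K)"
      unfolding abs_prod
    proof (rule prod_mono)
      fix j assume "j \<in> {..<d}"
      moreover have "digit (Suc q) j \<nu> \<le> q" using digit_less[of "Suc q" j \<nu>] by simp
      ultimately show "0 \<le> \<bar>poly (lagrange q (digit (Suc q) j \<nu>)) (r j)\<bar>
          \<and> \<bar>poly (lagrange q (digit (Suc q) j \<nu>)) (r j)\<bar> \<le> K" using K(1) r by simp
    qed
    then show "\<bar>F (\<lambda>j. e j + \<delta> * node q (digit (Suc q) j \<nu>)) *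
        (\<Prod>j<d. poly (lagrange q (digit (Suc q) j \<nu>)) (r j))\<bar> \<le> R * K ^ d"
      unfolding abs_mult using F[of \<nu>] K(2) by (intro mult_mono) auto
  qed
  then show ?thesis by (simp add: power_mult_distrib mult_ac)
qed

text \<open>The unit cube is taken as one big cell (\<open>e = 0\<close>,
  \<open>\<delta> = 1\<close>) and \<open>v\<close> as a local coordinate: all nodes lie in the unit
  cube, so the interpolating polynomial is bounded at \<open>v\<close>, and its distance from
  \<open>F v\<close> is the interpolation error.\<close>

lemma smoothd_extend_bound:
  assumes "0 \<le> C" "0 < s"
  shows "\<exists>K. \<forall>F. smoothd d q s C F \<and> cube_le d R F \<longrightarrow>
    (\<forall>v. sup_le d \<rho> v \<longrightarrow> \<bar>F v\<bar> \<le> K)"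
proof -
  obtain K where K: "1 \<le> K" "\<And>k r. k \<le> q \<Longrightarrow> \<bar>r\<bar> \<le> \<rho> \<Longrightarrow> \<bar>poly (lagrange q k) r\<bar> \<le> K"
    using lagrange_bounded[of q \<rho>] by blast
  let ?E = "C * (real d * (real (Suc q) * K) ^ d * (\<rho> powr (real q + s) + real (Suc q) * K))"
  have "\<bar>F v\<bar> \<le> (real (Suc q) * K) ^ d * R + ?E"
    if F: "smoothd d q s C F" "cube_le d R F"
      and v: "sup_le d \<rho> v" for F v
  proof -
    have "\<bar>tensor_interp q d F (\<lambda>_. 0) 1 v\<bar> \<le> (real (Suc q) * K) ^ d * R"
    proof (rule tensor_interp_bound[OF K(2,1)])
      show "\<bar>F (\<lambda>j. 0 + 1 * node q (digit (Suc q) j \<nu>))\<bar> \<le> R" for \<nu>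
      proof -
        have "digit (Suc q) j \<nu> \<le> q" for j using digit_less[of "Suc q" j \<nu>] by simp
        then show ?thesis using F(2) node_range by simp
      qed
    qed (use v in auto)
    moreover have "\<bar>tensor_interp q d F (\<lambda>_. 0) 1 v - F v\<bar> \<le> ?E"
      using tensor_interp_error[OF F(1) assms K(2,1), where r = v and \<delta> = 1 and e = "\<lambda>_. 0"] v by simp
    ultimately show ?thesis by linarith
  qed
  then show ?thesis by blast
qed

text \<open>One coordinate is exchanged at a time. Since \<open>lipschitz1\<close> looks one unit
  beyond the interval, \<open>F\<close> must first be bounded for the radius
  \<open>\<rho> + 1\<close>.\<close>

lemma smoothd_lipschitz:
  assumes "0 \<le> C" "0 < s" "s \<le> 1" "1 \<le> real q + s"
  shows "\<exists>L\<ge>0. \<forall>F. smoothd d q s C F \<and> cube_le d R F \<longrightarrow>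
    (\<forall>v w. sup_le d \<rho> v \<and> sup_le d \<rho> w \<longrightarrow> \<bar>F v - F w\<bar> \<le> L * (\<Sum>j<d. \<bar>v j - w j\<bar>))"
proof -
  obtain K where K: "\<And>F v. smoothd d q s C F \<Longrightarrow>
      cube_le d R F \<Longrightarrow>
      sup_le d (\<rho> + 1) v \<Longrightarrow> \<bar>F v\<bar> \<le> K"
    using smoothd_extend_bound[OF assms(1,2), of d q R "\<rho> + 1"] by blast
  obtain L where L: "0 \<le> L" "\<And>f a b x y. smooth1 q s C f \<Longrightarrow>
      (\<forall>t. a \<le> t \<and> t \<le> b + 1 \<longrightarrow> \<bar>f t\<bar> \<le> K) \<Longrightarrow>
      a \<le> x \<and> x \<le> b \<and> a \<le> y \<and> y \<le> b \<Longrightarrow> \<bar>f x - f y\<bar> \<le> L * \<bar>x - y\<bar>"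
    using lipschitz1[OF assms, of K] by blast
  have "\<bar>F v - F w\<bar> \<le> L * (\<Sum>j<d. \<bar>v j - w j\<bar>)"
    if F: "smoothd d q s C F" "cube_le d R F"
      and vw: "sup_le d \<rho> v" "sup_le d \<rho> w" for F v w
  proof -
    define X where "X m = (\<lambda>j. if j < m then v j else w j)" for m
    have "\<bar>F (X m) - F (X 0)\<bar> \<le> L * (\<Sum>j<m. \<bar>v j - w j\<bar>)" if "m \<le> d" for m
      using that
    proof (induction m)
      case (Suc m)
      then have m: "m < d" by simp
      have "smooth1 q s C (\<lambda>t. F ((X m)(m := t)))" using F(1) m by (simp add: smoothd_def)
      moreover have "\<forall>t. - \<rho> \<le> t \<and> t \<le> \<rho> + 1 \<longrightarrow> \<bar>F ((X m)(m := t))\<bar> \<le> K"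
      proof (intro allI impI K[OF F])
        fix t j assume t: "- \<rho> \<le> t \<and> t \<le> \<rho> + 1" and j: "j < d"
        have "\<bar>v j\<bar> \<le> \<rho>" "\<bar>w j\<bar> \<le> \<rho>" using vw j by auto
        with t show "\<bar>((X m)(m := t)) j\<bar> \<le> \<rho> + 1" by (auto simp: X_def abs_le_iff)
      qed
      moreover have "- \<rho> \<le> v m \<and> v m \<le> \<rho> \<and> - \<rho> \<le> w m \<and> w m \<le> \<rho>"
        using vw m by (auto simp: abs_le_iff)
      ultimately have "\<bar>F ((X m)(m := v m)) - F ((X m)(m := w m))\<bar> \<le> L * \<bar>v m - w m\<bar>"
        by (rule L(2))
      moreover have "(X m)(m := v m) = X (Suc m)" "(X m)(m := w m) = X m"
        by (auto simp: X_def less_Suc_eq)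
      ultimately show ?case using Suc by (simp add: distrib_left)
    qed simp
    from this[of d] have "\<bar>F (X d) - F (X 0)\<bar> \<le> L * (\<Sum>j<d. \<bar>v j - w j\<bar>)" by simp
    moreover have "F (X d) = F v" "F (X 0) = F w"
      using F(1) unfolding smoothd_def by (auto simp: X_def)
    ultimately show ?thesis by simp
  qed
  then show ?thesis using L(1) by blast
qed

section \<open>Networks for smooth functions on arbitrary cubes\<close>

definition holder_approx :: "real \<Rightarrow> nat \<Rightarrow> real \<Rightarrow> nat \<Rightarrow> real \<Rightarrow> real \<Rightarrow> real \<Rightarrow> bool" where
  "holder_approx \<beta> t C m R B K \<longleftrightarrow> (\<forall>h. holder_smooth t \<beta> C h \<and> (\<forall>x\<in>box t 0 1. \<bar>h x\<bar> \<le> R) \<longrightarrow>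
     (\<forall>v. sup_le t B v \<longrightarrow> \<bar>h (vec t v)\<bar> \<le> K) \<and>
     (1 \<le> \<beta> \<longrightarrow> (\<forall>v w. sup_le t B v \<and> sup_le t B w \<longrightarrow>
        \<bar>h (vec t v) - h (vec t w)\<bar> \<le> K * (\<Sum>j<t. \<bar>v j - w j\<bar>))) \<and>
     (\<forall>N\<ge>2. \<exists>\<phi>\<in>NN t m (m * N) (K * real N ^ m). \<forall>v. sup_le t B v \<longrightarrow>
        \<bar>\<phi> v - h (vec t v)\<bar> \<le> K * real N powr (- (2 * \<beta> / real t))))"

lemma tensor_interp_affine:
  "tensor_interp q d (\<lambda>y. F (\<lambda>j. a * y j + b) / S) e \<delta> r = tensor_interp q d F (\<lambda>j. a * e j + b) (a * \<delta>) r / S"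
  unfolding tensor_interp_def by (simp add: sum_divide_distrib algebra_simps)

text \<open>The substitution sends [0, 1] to \<open>[-B, B]\<close> and the range [0, 2] required by
  \<open>interp_class\<close> to \<open>[-B, 3 B]\<close>, hence the radius \<open>3 * B\<close>.
  The divisor \<open>S\<close> dominates the size of \<open>F\<close> and also its interpolation
  constant, which the dilation multiplies by \<open>(2 B) powr (q + s)\<close>.\<close>

lemma normalized_in_interp_class:
  assumes "0 \<le> C" "0 < s" "1 \<le> B"
  shows "\<exists>S\<ge>1. \<forall>F. smoothd d q s C F \<and> cube_le d R F \<longrightarrow>
    (\<lambda>y. F (\<lambda>j. 2 * B * y j + - B) / S) \<in> interp_class d q (real q + s)"
proof -
  obtain R' where R': "\<And>F v. smoothd d q s C F \<Longrightarrow>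
      cube_le d R F \<Longrightarrow>
      sup_le d (3 * B) v \<Longrightarrow> \<bar>F v\<bar> \<le> R'"
    using smoothd_extend_bound[OF assms(1,2), of d q R "3 * B"] by blast
  obtain K where K: "1 \<le> K" "\<And>k r. k \<le> q \<Longrightarrow> \<bar>r\<bar> \<le> 1 \<Longrightarrow> \<bar>poly (lagrange q k) r\<bar> \<le> K"
    using lagrange_bounded[of q 1] by blast
  define E where "E = C * (real d * (real (Suc q) * K) ^ d * (1 powr (real q + s) + real (Suc q) * K))"
  define S where "S = 1 + \<bar>R'\<bar> + \<bar>E\<bar> * (2 * B) powr (real q + s)"
  have S1: "1 \<le> S" "R' \<le> S" "E * (2 * B) powr (real q + s) \<le> S"
  proof -
    have "0 \<le> \<bar>E\<bar> * (2 * B) powr (real q + s)" by simp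
    moreover have "E * (2 * B) powr (real q + s) \<le> \<bar>E\<bar> * (2 * B) powr (real q + s)"
      by (intro mult_right_mono) auto
    ultimately show "1 \<le> S" "R' \<le> S" "E * (2 * B) powr (real q + s) \<le> S"
      unfolding S_def by linarith+
  qed
  have "(\<lambda>y. F (\<lambda>j. 2 * B * y j + - B) / S) \<in> interp_class d q (real q + s)"
    if F: "smoothd d q s C F" "cube_le d R F" for F
    unfolding interp_class_def mem_Collect_eq
  proof (intro conjI allI impI)
    fix v :: "nat \<Rightarrow> real" assume v: "\<forall>j<d. 0 \<le> v j \<and> v j \<le> 2"
    have "\<bar>F (\<lambda>j. 2 * B * v j + - B)\<bar> \<le> R'"
    proof (rule R'[OF F], intro allI impI)
      fix j assume "j < d"
      then have "0 \<le> v j" "v j \<le> 2" using v by auto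
      then have "0 \<le> 2 * B * v j" "2 * B * v j \<le> 2 * B * 2"
        using assms(3) by (auto intro!: mult_left_mono simp del: mult_le_cancel_left_pos)
      then show "\<bar>2 * B * v j + - B\<bar> \<le> 3 * B" using assms(3) by linarith
    qed
    then show "\<bar>F (\<lambda>j. 2 * B * v j + - B) / S\<bar> \<le> 1" using S1 by (simp add: divide_le_eq)
  next
    fix e r :: "nat \<Rightarrow> real" and \<delta> :: real
    assume *: "(\<forall>j<d. 0 \<le> e j \<and> e j \<le> 1) \<and> 0 \<le> \<delta> \<and> \<delta> \<le> 1 \<and> sup_le d 1 r"
    let ?e = "\<lambda>j. 2 * B * e j + - B"
    have pt: "(\<lambda>j. 2 * B * (e j + \<delta> * r j) + - B) = (\<lambda>j. ?e j + (2 * B * \<delta>) * r j)"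
      by (simp add: algebra_simps)
    have "\<bar>tensor_interp q d F ?e (2 * B * \<delta>) r - F (\<lambda>j. ?e j + (2 * B * \<delta>) * r j)\<bar>
        \<le> E * (2 * B * \<delta>) powr (real q + s)"
      unfolding E_def using * assms(3) by (intro tensor_interp_error[OF F(1) assms(1,2) K(2,1)]) auto
    also have "\<dots> = (E * (2 * B) powr (real q + s)) * \<delta> powr (real q + s)"
      using * assms(3) by (simp add: powr_mult)
    also have "\<dots> \<le> S * \<delta> powr (real q + s)" using S1(3) by (intro mult_right_mono) auto
    finally have "\<bar>tensor_interp q d F ?e (2 * B * \<delta>) r / S - F (\<lambda>j. ?e j + (2 * B * \<delta>) * r j) / S\<bar>
        \<le> \<delta> powr (real q + s)"
      using S1(1) by (simp add: diff_divide_distrib[symmetric] divide_le_eq mult.commute)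
    then show "\<bar>tensor_interp q d (\<lambda>y. F (\<lambda>j. 2 * B * y j + - B) / S) e \<delta> r
        - F (\<lambda>j. 2 * B * (e j + \<delta> * r j) + - B) / S\<bar> \<le> \<delta> powr (real q + s)"
      unfolding tensor_interp_affine pt .
  next
    fix v w :: "nat \<Rightarrow> real" assume vw: "\<forall>j<d. v j = w j"
    have "F (\<lambda>j. 2 * B * v j + - B) = F (\<lambda>j. 2 * B * w j + - B)"
      using F(1) vw unfolding smoothd_def by auto
    then show "F (\<lambda>j. 2 * B * v j + - B) / S = F (\<lambda>j. 2 * B * w j + - B) / S" by simp
  qed
  then show ?thesis using S1(1) by blast
qed

lemma NN_rescale_input:
  assumes "\<phi> \<in> NN d L w B" "0 < d" "1 \<le> b"
  shows "(\<lambda>v. \<phi> (\<lambda>j. (v j + b) / (2 * b))) \<in> NN d L (d + w) (1 + B + real (d + w) * B)"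
proof -
  have "(\<lambda>v. (v j + b) / (2 * b)) \<in> NN d 0 1 1" if "j < d" for j
  proof (rule NN_I[of _ _ _ _ "coords d"])
    have "(\<lambda>v. v j) \<in> coords d" using that by (auto simp: coords_def)
    then have "affine_in (1 / 2 + \<bar>1 / (2 * b)\<bar> * 1) (coords d) (\<lambda>v. 1 / 2 + 1 / (2 * b) * v j)"
      by (intro affine_in_add affine_in_scale affine_in_base affine_in_const) auto
    then have "affine_in 1 (coords d) (\<lambda>v. 1 / 2 + 1 / (2 * b) * v j)"
      using assms(3) by (elim affine_in_mono) (simp add: field_simps)
    moreover have "(\<lambda>v. 1 / 2 + 1 / (2 * b) * v j) = (\<lambda>v. (v j + b) / (2 * b))"
      using assms(3) by (auto simp: field_simps)
    ultimately show "affine_in 1 (coords d) (\<lambda>v. (v j + b) / (2 * b))" by simp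
  qed simp
  from NN_compose[OF assms(1,2), where f = "\<lambda>j v. (v j + b) / (2 * b)", OF this]
  show ?thesis by simp
qed

text \<open>\<open>m\<close> stands for depth, width factor and weight exponent at once and is
  chosen before \<open>R\<close> and \<open>B\<close>: normalization reduces all cases to one
  network family, and \<open>R\<close> and \<open>B\<close> return only in the factor
  \<open>S\<close> and thus in \<open>K\<close>.\<close>

lemma holder_approx_exists:
  assumes t: "1 \<le> t" and \<beta>: "0 < \<beta>" and C: "0 < C"
  shows "\<exists>m0. \<forall>m\<ge>m0. \<forall>R B. \<exists>K0. \<forall>K\<ge>K0. holder_approx \<beta> t C m R B K"
proof -
  \<comment> \<open>Rounding up and subtracting 1 gives \<open>s = 1\<close>, not 0, for integer
    \<beta>.\<close>
  define q where "q = nat (\<lceil>\<beta>\<rceil> - 1)"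
  define s where "s = \<beta> - real q"
  have qs: "\<beta> = real q + s" "0 < s" "s \<le> 1"
    using \<beta> unfolding s_def q_def by linarith+
  have C0: "0 \<le> C" and t0: "0 < t" using C t by auto
  obtain \<Phi> c where \<Phi>: "nets t \<Phi>" and c: "0 \<le> c" and err: "\<And>N g v. 2 \<le> N \<Longrightarrow> g \<in> interp_class t q \<beta> \<Longrightarrow>
      \<forall>j<t. 0 \<le> v j \<and> v j \<le> 1 \<Longrightarrow> \<bar>\<Phi> N g v - g v\<bar> \<le> c * real N powr (- (2 * \<beta> / real t))"
    using interp_class_approx[OF t \<beta>, of q] by blast
  obtain L0 k e where ke: "1 \<le> k" "1 \<le> e"
    and NN: "\<And>N g. 2 \<le> N \<Longrightarrow> \<Phi> N g \<in> NN t L0 (k * N) (real N ^ e)"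
    using nets_E[OF \<Phi>] by blast
  \<comment> \<open>Depth \<open>L0\<close>; width factor \<open>t + k\<close>, because the input
    rescaling counts \<open>t\<close> more neurons; exponent \<open>e + 1\<close>, because merging
    that rescaling sums over O(N) weights.\<close>
  have "\<exists>K0. \<forall>K\<ge>K0. holder_approx \<beta> t C m R B K" if m: "L0 + (t + k) + (e + 1) \<le> m" for m R B
  proof -
    define b where "b = max B 1"
    have b: "1 \<le> b" "B \<le> b" by (auto simp: b_def)
    obtain S where S: "1 \<le> S" "\<And>F. smoothd t q s C F \<Longrightarrow>
        cube_le t R F \<Longrightarrow>
        (\<lambda>y. F (\<lambda>j. 2 * b * y j + - b) / S) \<in> interp_class t q \<beta>"
      using normalized_in_interp_class[OF C0 qs(2) b(1), of t q R] unfolding qs(1)[symmetric] by blast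
    obtain K1 where K1: "\<And>F v. smoothd t q s C F \<Longrightarrow>
        cube_le t R F \<Longrightarrow>
        sup_le t B v \<Longrightarrow> \<bar>F v\<bar> \<le> K1"
      using smoothd_extend_bound[OF C0 qs(2), of t q R B] by blast
    have "\<exists>K2. \<forall>F. 1 \<le> \<beta> \<and> smoothd t q s C F \<and>
        cube_le t R F \<longrightarrow>
        (\<forall>v w. sup_le t B v \<and> sup_le t B w \<longrightarrow>
          \<bar>F v - F w\<bar> \<le> K2 * (\<Sum>j<t. \<bar>v j - w j\<bar>))"
    proof (cases "1 \<le> \<beta>")
      case True
      then show ?thesis using smoothd_lipschitz[OF C0 qs(2,3), of q t R B] qs(1) by auto
    qed simp
    then obtain K2 where K2: "\<And>F v w. 1 \<le> \<beta> \<Longrightarrow> smoothd t q s C F \<Longrightarrow>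
        cube_le t R F \<Longrightarrow>
        sup_le t B v \<Longrightarrow> sup_le t B w \<Longrightarrow>
        \<bar>F v - F w\<bar> \<le> K2 * (\<Sum>j<t. \<bar>v j - w j\<bar>)"
      by blast
    define K0 where "K0 = 1 + \<bar>K1\<bar> + \<bar>K2\<bar> + S * c + S * (2 + real (t + k))"
    have Sc: "0 \<le> S * c" "0 \<le> S * (2 + real (t + k))" using S(1) c by auto
    have K0: "K1 \<le> K0" "K2 \<le> K0" "S * c \<le> K0" "S * (2 + real (t + k)) \<le> K0"
      unfolding K0_def using Sc by linarith+
    have "holder_approx \<beta> t C m R B K" if K: "K0 \<le> K" for K
      unfolding holder_approx_def
    proof (intro allI impI, elim conjE)
      fix h assume h: "holder_smooth t \<beta> C h" "\<forall>x\<in>box t 0 1. \<bar>h x\<bar> \<le> R"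
      let ?F = "\<lambda>v. h (vec t v)"
      have F: "smoothd t q s C ?F" using holder_smoothd[OF h(1) qs] .
      have FR: "cube_le t R ?F"
        using h(2) by (auto simp: box_def)
      have bound: "\<bar>?F v\<bar> \<le> K" if "sup_le t B v" for v
        using K1[OF F FR that] K0 K by linarith
      have lip: "\<bar>?F v - ?F w\<bar> \<le> K * (\<Sum>j<t. \<bar>v j - w j\<bar>)"
        if "1 \<le> \<beta>" "sup_le t B v" "sup_le t B w" for v w
      proof -
        have "K2 * (\<Sum>j<t. \<bar>v j - w j\<bar>) \<le> K * (\<Sum>j<t. \<bar>v j - w j\<bar>)"
          using K0 K by (intro mult_right_mono sum_nonneg) auto
        then show ?thesis using K2[OF that(1) F FR that(2,3)] by linarith
      qed
      have app: "\<exists>\<phi>\<in>NN t m (m * N) (K * real N ^ m). \<forall>v. sup_le t B v \<longrightarrow>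
          \<bar>\<phi> v - ?F v\<bar> \<le> K * real N powr (- (2 * \<beta> / real t))" if N: "2 \<le> N" for N
      proof -
        let ?G = "\<lambda>y. ?F (\<lambda>j. 2 * b * y j + - b) / S"
        let ?\<psi> = "\<lambda>v. \<Phi> N ?G (\<lambda>j. (v j + b) / (2 * b))"
        let ?B = "1 + real N ^ e + real (t + k * N) * real N ^ e"
        have G: "?G \<in> interp_class t q \<beta>" by (rule S(2)[OF F FR])
        have N1: "1 \<le> real N" using N by simp
        have "?\<psi> \<in> NN t L0 (t + k * N) ?B"
          by (rule NN_rescale_input[OF NN[OF N] t0 b(1)])
        from NN_scale[OF this, of S]
        have 1: "(\<lambda>v. S * ?\<psi> v) \<in> NN t L0 (t + k * N) (max ?B (\<bar>S\<bar> * ?B))" .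
        have Bpos: "0 \<le> ?B" by simp
        have "?B \<le> (2 + real (t + k)) * real N ^ (e + 1)"
        proof -
          have "1 \<le> real N ^ (e + 1)" using N1 by (rule one_le_power)
          moreover have "real N ^ e \<le> real N ^ (e + 1)" using N1 by (intro power_increasing) auto
          moreover have "real (t + k * N) * real N ^ e \<le> (real (t + k) * real N) * real N ^ e"
          proof (rule mult_right_mono)
            have "t + k * N \<le> (t + k) * N" using N by (simp add: distrib_right)
            then have "real (t + k * N) \<le> real ((t + k) * N)" by (simp only: of_nat_le_iff)
            then show "real (t + k * N) \<le> real (t + k) * real N" by simp
          qed simp
          moreover have "(2 + real (t + k)) * real N ^ (e + 1)
              = real N ^ (e + 1) + real N ^ (e + 1) + (real (t + k) * real N) * real N ^ e"
            by (simp add: algebra_simps)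
          ultimately show ?thesis by linarith
        qed
        then have "\<bar>S\<bar> * ?B \<le> S * ((2 + real (t + k)) * real N ^ (e + 1))"
          using S(1) by (simp add: mult_left_mono)
        also have "\<dots> = (S * (2 + real (t + k))) * real N ^ (e + 1)" by simp
        also have "\<dots> \<le> K * real N ^ (e + 1)" using K0 K by (intro mult_right_mono) auto
        also have "\<dots> \<le> K * real N ^ m"
          using m N1 K0(4) Sc K by (intro mult_left_mono power_increasing) linarith+
        finally have 2: "\<bar>S\<bar> * ?B \<le> K * real N ^ m" .
        have "1 * ?B \<le> \<bar>S\<bar> * ?B" using S(1) Bpos by (intro mult_right_mono) auto
        then have 3: "max ?B (\<bar>S\<bar> * ?B) \<le> K * real N ^ m" using 2 by simp
        have "(\<lambda>v. S * ?\<psi> v) \<in> NN t L0 (m * N) (K * real N ^ m)"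
        proof (rule NN_mono[OF 1 _ 3])
          have "t + k * N \<le> (t + k) * N" using N by (simp add: distrib_right)
          also have "\<dots> \<le> m * N" using m by (intro mult_right_mono) auto
          finally show "t + k * N \<le> m * N" .
        qed
        then have "(\<lambda>v. S * ?\<psi> v) \<in> NN t m (m * N) (K * real N ^ m)"
        proof (rule NN_deepen_le)
          have "1 * 2 \<le> m * N" using m ke N by (intro mult_le_mono) auto
          then show "2 \<le> m * N" by simp
          have "1 * 2 \<le> K * real N ^ m"
          proof (rule mult_mono)
            show "1 \<le> K" using K Sc unfolding K0_def by linarith
            have "real N ^ 1 \<le> real N ^ m" using m N1 by (intro power_increasing) auto
            moreover have "2 \<le> real N" using N by simp
            ultimately show "2 \<le> real N ^ m" unfolding power_one_right by (rule order_trans[rotated])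
          qed (use K Sc K0_def in auto)
          then show "2 \<le> K * real N ^ m" by simp
          show "L0 \<le> m" using m by simp
        qed
        moreover have "\<bar>S * ?\<psi> v - ?F v\<bar> \<le> K * real N powr (- (2 * \<beta> / real t))"
          if v: "sup_le t B v" for v
        proof -
          let ?y = "\<lambda>j. (v j + b) / (2 * b)"
          have "\<forall>j<t. 0 \<le> ?y j \<and> ?y j \<le> 1"
          proof (intro allI impI)
            fix j assume "j < t"
            then have "\<bar>v j\<bar> \<le> b" using v b by force
            then show "0 \<le> ?y j \<and> ?y j \<le> 1" using b(1) by (simp add: divide_le_eq abs_le_iff)
          qed
          from err[OF N G this]
          have "\<bar>?\<psi> v - ?F (\<lambda>j. 2 * b * ?y j + - b) / S\<bar> \<le> c * real N powr (- (2 * \<beta> / real t))" .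
          moreover have "(\<lambda>j. 2 * b * ?y j + - b) = v" using b(1) by auto
          ultimately have "\<bar>?\<psi> v - ?F v / S\<bar> \<le> c * real N powr (- (2 * \<beta> / real t))" by simp
          then have "S * \<bar>?\<psi> v - ?F v / S\<bar> \<le> S * (c * real N powr (- (2 * \<beta> / real t)))"
            using S(1) by (intro mult_left_mono) auto
          moreover have "S * \<bar>?\<psi> v - ?F v / S\<bar> = \<bar>S * (?\<psi> v - ?F v / S)\<bar>"
            using S(1) by (simp add: abs_mult)
          moreover have "S * (?\<psi> v - ?F v / S) = S * ?\<psi> v - ?F v"
            using S(1) by (simp add: right_diff_distrib)
          ultimately have "\<bar>S * ?\<psi> v - ?F v\<bar> \<le> (S * c) * real N powr (- (2 * \<beta> / real t))"
            by (simp only: mult.assoc)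
          also have "\<dots> \<le> K * real N powr (- (2 * \<beta> / real t))"
            using K0 K by (intro mult_right_mono) auto
          finally show ?thesis .
        qed
        ultimately show ?thesis by (intro bexI[of _ "\<lambda>v. S * ?\<psi> v"]) auto
      qed
      show "(\<forall>v. sup_le t B v \<longrightarrow> \<bar>?F v\<bar> \<le> K) \<and>
       (1 \<le> \<beta> \<longrightarrow> (\<forall>v w. sup_le t B v \<and> sup_le t B w \<longrightarrow>
          \<bar>?F v - ?F w\<bar> \<le> K * (\<Sum>j<t. \<bar>v j - w j\<bar>))) \<and>
       (\<forall>N\<ge>2. \<exists>\<phi>\<in>NN t m (m * N) (K * real N ^ m). \<forall>v. sup_le t B v \<longrightarrow>
          \<bar>\<phi> v - ?F v\<bar> \<le> K * real N powr (- (2 * \<beta> / real t)))"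
        using bound lip app by blast
    qed
    then show ?thesis by blast
  qed
  then show ?thesis by blast
qed


section \<open>Hierarchical compositions\<close>

definition approx_bounded :: "nat \<Rightarrow> real \<Rightarrow> nat \<Rightarrow> real \<Rightarrow> real \<Rightarrow> fn \<Rightarrow> bool" where
  "approx_bounded d c m \<gamma> K f \<longleftrightarrow>
     (\<forall>v. sup_le d c v \<longrightarrow> \<bar>f v\<bar> \<le> K) \<and>
     (\<forall>N\<ge>2. \<exists>\<phi>\<in>NN d m (m * N) (K * real N ^ m). \<forall>v. sup_le d c v \<longrightarrow>
        \<bar>\<phi> v - f v\<bar> \<le> K * real N powr (- \<gamma>))"

text \<open>The error has two parts: that of the outer network at the approximate arguments, and the
  effect of these arguments on \<open>h\<close>, which the Lipschitz bound limits to
  \<open>t K2 K1\<close> times the inner rate. So the order \<gamma> survives composition, and the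
  Lipschitz bound is where \<open>1 \<le> \<beta>\<close> matters.\<close>

lemma approx_bounded_compose:
  assumes t: "1 \<le> t" and \<gamma>: "0 \<le> \<gamma>" "\<gamma> \<le> 2 * \<beta> / real t" and \<beta>: "1 \<le> \<beta>"
    and m1: "1 \<le> m1" and K: "1 \<le> K1" "1 \<le> K2"
    and f: "\<And>j. j < t \<Longrightarrow> approx_bounded d c m1 \<gamma> K1 (f j)"
    and g: "holder_approx \<beta> t C m2 R (2 * K1) K2" "holder_smooth t \<beta> C h" "\<forall>x\<in>box t 0 1. \<bar>h x\<bar> \<le> R"
    and m: "t * m1 + 2 * m2 + t + m1 + 1 \<le> m"
    and K': "K1 + K2 + real (t + m2) * (K2 * K1) \<le> K'"
  shows "approx_bounded d c m \<gamma> K' (\<lambda>v. h (vec t (\<lambda>j. f j v)))"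
proof -
  have KK: "1 \<le> K2 * K1" using K by (simp add: mult_le_cancel_left1 order_trans[OF K(2)] mult_ge1_I)
  have K'2: "K2 \<le> K'" "1 \<le> K'"
  proof -
    have "0 \<le> real (t + m2) * (K2 * K1)" using K by (intro mult_nonneg_nonneg) auto
    then show "K2 \<le> K'" "1 \<le> K'" using K' K by linarith+
  qed
  have fb: "\<bar>f j v\<bar> \<le> K1" if "j < t" "sup_le d c v" for j v
    using f[OF that(1)] that(2) unfolding approx_bounded_def by blast
  have hb: "\<bar>h (vec t v)\<bar> \<le> K2" if "sup_le t (2 * K1) v" for v
    using g that unfolding holder_approx_def by blast
  have hl: "\<bar>h (vec t v) - h (vec t w)\<bar> \<le> K2 * (\<Sum>j<t. \<bar>v j - w j\<bar>)"
    if "sup_le t (2 * K1) v" "sup_le t (2 * K1) w" for v w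
    using g \<beta> that unfolding holder_approx_def by blast
  have f2: "\<forall>j<t. \<bar>f j v\<bar> \<le> 2 * K1" if v: "sup_le d c v" for v
  proof (intro allI impI)
    fix j assume "j < t"
    from fb[OF this v] show "\<bar>f j v\<bar> \<le> 2 * K1" using K by linarith
  qed
  have "\<exists>\<phi>\<in>NN d m (m * N) (K' * real N ^ m). \<forall>v. sup_le d c v \<longrightarrow>
        \<bar>\<phi> v - h (vec t (\<lambda>j. f j v))\<bar> \<le> K' * real N powr (- \<gamma>)" if N: "2 \<le> N" for N
  proof -
    have N1: "1 \<le> real N" using N by simp
    have "\<forall>j. \<exists>\<phi>. j < t \<longrightarrow> \<phi> \<in> NN d m1 (m1 * N) (K1 * real N ^ m1) \<and>
        (\<forall>v. sup_le d c v \<longrightarrow> \<bar>\<phi> v - f j v\<bar> \<le> K1 * real N powr (- \<gamma>))"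
      using f N unfolding approx_bounded_def by blast
    from choice[OF this] obtain \<phi> where
      \<phi>: "\<And>j. j < t \<Longrightarrow> \<phi> j \<in> NN d m1 (m1 * N) (K1 * real N ^ m1)"
         "\<And>j v. j < t \<Longrightarrow> sup_le d c v \<Longrightarrow> \<bar>\<phi> j v - f j v\<bar> \<le> K1 * real N powr (- \<gamma>)"
      by blast
    obtain \<psi> where \<psi>: "\<psi> \<in> NN t m2 (m2 * N) (K2 * real N ^ m2)"
        "\<And>v. sup_le t (2 * K1) v \<Longrightarrow>
           \<bar>\<psi> v - h (vec t v)\<bar> \<le> K2 * real N powr (- (2 * \<beta> / real t))"
      using g N unfolding holder_approx_def by blast
    let ?p = "\<lambda>v. \<psi> (\<lambda>j. \<phi> j v)"
    have p\<gamma>: "real N powr (- \<gamma>) \<le> 1" using N1 \<gamma> powr_mono[of "- \<gamma>" 0 "real N"] by simp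
    have pp: "0 \<le> real N powr (- \<gamma>)" by simp
    have pow1: "1 \<le> K1 * real N ^ m1"
      using mult_mono[OF K(1) one_le_power[OF N1, of m1]] K(1) by simp
    have "?p \<in> NN d m (m * N) (K' * real N ^ m)"
    proof (rule NN_deepen_le[OF NN_mono[OF NN_compose[OF \<psi>(1) _ \<phi>(1) pow1]]])
      show "0 < t" using t by simp
      have "t * (m1 * N) + m2 * N = (t * m1 + m2) * N" by (simp add: algebra_simps)
      also have "\<dots> \<le> m * N" using m by (intro mult_right_mono) auto
      finally show "t * (m1 * N) + m2 * N \<le> m * N" .
      let ?D = "m1 + m2 + 1"
      have "real N ^ m1 \<le> real N ^ ?D" "real N ^ m2 \<le> real N ^ ?D"
        using N1 by (intro power_increasing; simp)+
      then have 1: "K1 * real N ^ m1 \<le> K1 * real N ^ ?D" "K2 * real N ^ m2 \<le> K2 * real N ^ ?D"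
        using K by (auto intro: mult_left_mono)
      have "t + m2 * N \<le> (t + m2) * N" using N by (simp add: distrib_right)
      then have "real (t + m2 * N) \<le> real ((t + m2) * N)" by (simp only: of_nat_le_iff)
      then have "real (t + m2 * N) * (K2 * real N ^ m2 * (K1 * real N ^ m1))
          \<le> (real (t + m2) * real N) * (K2 * real N ^ m2 * (K1 * real N ^ m1))"
        using K by (intro mult_right_mono) auto
      also have "\<dots> = (real (t + m2) * (K2 * K1)) * real N ^ ?D"
        by (simp add: power_add mult_ac)
      finally have "K1 * real N ^ m1 + K2 * real N ^ m2
          + real (t + m2 * N) * (K2 * real N ^ m2 * (K1 * real N ^ m1))
        \<le> K1 * real N ^ ?D + K2 * real N ^ ?D + (real (t + m2) * (K2 * K1)) * real N ^ ?D"
        using 1 by linarith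
      also have "\<dots> = (K1 + K2 + real (t + m2) * (K2 * K1)) * real N ^ ?D"
        by (simp only: distrib_right)
      also have "\<dots> \<le> K' * real N ^ m"
        using K' K'2 m N1 by (intro mult_mono power_increasing) auto
      finally show "K1 * real N ^ m1 + K2 * real N ^ m2
          + real (t + m2 * N) * (K2 * real N ^ m2 * (K1 * real N ^ m1)) \<le> K' * real N ^ m" .
      have "1 * 2 \<le> m * N" using m N by (intro mult_le_mono) auto
      then show "2 \<le> m * N" by simp
      have "real N ^ 1 \<le> real N ^ m" using m N1 by (intro power_increasing) auto
      moreover have "2 \<le> real N" using N by simp
      ultimately have "2 \<le> real N ^ m" unfolding power_one_right by linarith
      then have "1 * 2 \<le> K' * real N ^ m" using K'2 by (intro mult_mono) auto
      then show "2 \<le> K' * real N ^ m" by simp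
      show "m1 + m2 \<le> m" using m by linarith
    qed
    moreover have "\<bar>?p v - h (vec t (\<lambda>j. f j v))\<bar> \<le> K' * real N powr (- \<gamma>)"
      if v: "sup_le d c v" for v
    proof -
      have e: "\<bar>\<phi> j v - f j v\<bar> \<le> K1 * real N powr (- \<gamma>)" if "j < t" for j
        using \<phi>(2)[OF that v] .
      have "K1 * real N powr (- \<gamma>) \<le> K1" using p\<gamma> K by (simp add: mult_left_le)
      \<comment> \<open>The inner networks are off by at most \<open>K1\<close> because
        \<open>N powr (- \<gamma>) \<le> 1\<close>; this is why the outer function is treated on the
        cube of radius \<open>2 * K1\<close>.\<close>
      then have \<phi>b: "\<forall>j<t. \<bar>\<phi> j v\<bar> \<le> 2 * K1"
        using e fb[OF _ v] by (smt (verit))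
      have 1: "\<bar>?p v - h (vec t (\<lambda>j. \<phi> j v))\<bar> \<le> K2 * real N powr (- \<gamma>)"
      proof -
        have "real N powr (- (2 * \<beta> / real t)) \<le> real N powr (- \<gamma>)"
          using \<gamma>(2) N1 by (intro powr_mono) auto
        then have "K2 * real N powr (- (2 * \<beta> / real t)) \<le> K2 * real N powr (- \<gamma>)"
          using K by (intro mult_left_mono) auto
        then show ?thesis using \<psi>(2)[OF \<phi>b] by linarith
      qed
      have "(\<Sum>j<t. \<bar>\<phi> j v - f j v\<bar>) \<le> (\<Sum>j<t. K1 * real N powr (- \<gamma>))"
        using e by (intro sum_mono) auto
      then have "K2 * (\<Sum>j<t. \<bar>\<phi> j v - f j v\<bar>) \<le> K2 * (real t * (K1 * real N powr (- \<gamma>)))"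
        using K by (intro mult_left_mono) auto
      also have "\<dots> = real t * (K2 * K1) * real N powr (- \<gamma>)" by simp
      finally have 2: "\<bar>h (vec t (\<lambda>j. \<phi> j v)) - h (vec t (\<lambda>j. f j v))\<bar>
          \<le> real t * (K2 * K1) * real N powr (- \<gamma>)"
        using hl[OF \<phi>b f2[OF v]] by linarith
      have "\<bar>?p v - h (vec t (\<lambda>j. f j v))\<bar>
          \<le> K2 * real N powr (- \<gamma>) + real t * (K2 * K1) * real N powr (- \<gamma>)"
        using 1 2 by linarith
      also have "\<dots> = (K2 + real t * (K2 * K1)) * real N powr (- \<gamma>)"
        by (simp only: distrib_right)
      also have "\<dots> \<le> K' * real N powr (- \<gamma>)"
      proof (rule mult_right_mono[OF _ pp])
        have "real t * (K2 * K1) \<le> real (t + m2) * (K2 * K1)" using KK by (intro mult_right_mono) auto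
        then show "K2 + real t * (K2 * K1) \<le> K'" using K' K by linarith
      qed
      finally show ?thesis .
    qed
    ultimately show ?thesis by (intro bexI[of _ ?p]) auto
  qed
  moreover have "\<bar>h (vec t (\<lambda>j. f j v))\<bar> \<le> K'" if "sup_le d c v" for v
    using hb[OF f2[OF that]] K'2 by linarith
  ultimately show ?thesis unfolding approx_bounded_def by blast
qed

lemma approx_bounded_coord:
  assumes "j < d" "2 \<le> K" "c \<le> K"
  shows "approx_bounded d c 2 \<gamma> K (\<lambda>v. v j)"
  unfolding approx_bounded_def
proof (intro conjI allI impI)
  fix v :: "nat \<Rightarrow> real" assume "sup_le d c v"
  then show "\<bar>v j\<bar> \<le> K" using assms by force
next
  fix N :: nat assume N: "2 \<le> N"
  have "1 \<le> real N ^ 2" using N by (intro one_le_power) auto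
  then have "2 * 1 \<le> K * real N ^ 2" using assms by (intro mult_mono) auto
  then have "(\<lambda>v. v j) \<in> NN d 2 (2 * N) (K * real N ^ 2)"
    using assms N by (intro NN_deepen_le[OF NN_coord]) auto
  then show "\<exists>\<phi>\<in>NN d 2 (2 * N) (K * real N ^ 2). \<forall>v. sup_le d c v \<longrightarrow>
      \<bar>\<phi> v - v j\<bar> \<le> K * real N powr (- \<gamma>)"
    using assms by (intro bexI[of _ "\<lambda>v. v j"]) auto
qed

text \<open>Finiteness of \<open>P\<close> is used twice: first for an \<open>m\<close> common to
  all pairs, and again for a common \<open>K\<close> once \<open>R\<close> and \<open>B\<close> are
  known.\<close>

lemma holder_approx_uniform:
  assumes "finite P" "P \<subseteq> {1..} \<times> {1..}" "0 < C"
  shows "\<exists>m\<ge>1. \<forall>R B. \<exists>K\<ge>1. \<forall>(\<beta>, t)\<in>P. holder_approx \<beta> t C m R B K"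
proof -
  have "\<forall>p\<in>P. eventually (\<lambda>m. \<forall>R B. \<exists>K0. \<forall>K\<ge>K0. holder_approx (fst p) (snd p) C m R B K) sequentially"
    using holder_approx_exists[OF _ _ assms(3)] assms(2) unfolding eventually_sequentially by fastforce
  then have "eventually (\<lambda>m. \<forall>p\<in>P. \<forall>R B. \<exists>K0. \<forall>K\<ge>K0. holder_approx (fst p) (snd p) C m R B K) sequentially"
    by (rule eventually_ball_finite[OF assms(1)])
  then obtain m0 where m0: "\<And>m. m0 \<le> m \<Longrightarrow> \<forall>p\<in>P. \<forall>R B. \<exists>K0. \<forall>K\<ge>K0. holder_approx (fst p) (snd p) C m R B K"
    unfolding eventually_sequentially by blast
  define m where "m = max m0 1"
  have "\<exists>K\<ge>1. \<forall>(\<beta>, t)\<in>P. holder_approx \<beta> t C m R B K" for R B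
  proof -
    have "\<forall>p\<in>P. eventually (\<lambda>K. holder_approx (fst p) (snd p) C m R B K) at_top"
      using m0[of m] unfolding m_def eventually_at_top_linorder by simp
    then have "eventually (\<lambda>K. \<forall>p\<in>P. holder_approx (fst p) (snd p) C m R B K) at_top"
      by (rule eventually_ball_finite[OF assms(1)])
    then obtain K0 where "\<And>K. K0 \<le> K \<Longrightarrow> \<forall>p\<in>P. holder_approx (fst p) (snd p) C m R B K"
      unfolding eventually_at_top_linorder by blast
    from this[of "max K0 1"] show ?thesis by (intro exI[of _ "max K0 1"]) auto
  qed
  then show ?thesis by (intro exI[of _ m]) (auto simp: m_def)
qed

lemma sup_norm_le: "sup_norm_on A h \<le> ereal R \<longleftrightarrow> (\<forall>x\<in>A. \<bar>h x\<bar> \<le> R)"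
  by (simp add: sup_norm_on_def SUP_le_iff)

text \<open>Every constituent has rate at least \<gamma>, the infimum over \<open>P\<close>. The
  bound \<open>K1\<close> of one level fixes the cube for the constituents of the next, so
  \<open>K\<close> grows with \<open>R\<close>; \<open>m\<close> obeys a recursion that involves
  only \<open>T\<close>, \<open>m2\<close> and the level.\<close>

lemma hier_approx:
  assumes P: "finite P" "P \<subseteq> {1..} \<times> {1..}" and C: "0 < C" and l: "1 \<le> l"
    and \<gamma>: "\<gamma> = (INF (\<beta>, t)\<in>P. 2 * \<beta> / real t)"
  shows "\<exists>m\<ge>1. \<forall>R. \<exists>K\<ge>1. \<forall>g\<in>hier_comp_bounded (ereal R) C P d l.
    approx_bounded d c m \<gamma> K (\<lambda>v. g (vec d v))"
  using l
proof (induction l rule: nat_induct_at_least)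
  obtain m2 where m2: "1 \<le> m2" "\<And>R B. \<exists>K\<ge>1. \<forall>(\<beta>, t)\<in>P. holder_approx \<beta> t C m2 R B K"
    using holder_approx_uniform[OF P C] by blast
  \<comment> \<open>A common bound for all arities \<open>t\<close>.\<close>
  define T where "T = (\<Sum>p\<in>P. snd p)"
  have T: "t \<le> T" if "(\<beta>, t) \<in> P" for \<beta> t
    using member_le_sum[OF that, of snd] P(1) unfolding T_def by simp
  have \<gamma>_le: "\<gamma> \<le> 2 * \<beta> / real t" if "(\<beta>, t) \<in> P" for \<beta> t
    unfolding \<gamma> using that P(1) by (intro cINF_lower2[OF _ that]) (auto intro: bdd_below_finite)
  have \<gamma>0: "0 \<le> \<gamma>" if "p \<in> P" for p
    unfolding \<gamma> using that P(2) by (intro cINF_greatest) auto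
  have comp: "\<exists>K\<ge>1. \<forall>\<beta> t h f. (\<beta>, t) \<in> P \<and> holder_smooth t \<beta> C h \<and> sup_norm_on (box t 0 1) h \<le> ereal R \<and>
      (\<forall>j<t. approx_bounded d c m1 \<gamma> K1 (f j)) \<longrightarrow>
      approx_bounded d c (T * m1 + 2 * m2 + T + m1 + 1) \<gamma> K (\<lambda>v. h (vec t (\<lambda>j. f j v)))"
    if m1: "1 \<le> m1" and K1: "1 \<le> K1" for m1 R K1
  proof -
    obtain K2 where K2: "1 \<le> K2" "\<And>\<beta> t. (\<beta>, t) \<in> P \<Longrightarrow> holder_approx \<beta> t C m2 R (2 * K1) K2"
      using m2(2)[of R "2 * K1"] by blast
    define K where "K = K1 + K2 + real (T + m2) * (K2 * K1)"
    have K0: "0 \<le> K2 * K1" using K1 K2 by simp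
    then have "0 \<le> real (T + m2) * (K2 * K1)" by (rule mult_nonneg_nonneg[rotated]) simp
    then have "1 \<le> K" unfolding K_def using K1 K2 by linarith
    moreover have "approx_bounded d c (T * m1 + 2 * m2 + T + m1 + 1) \<gamma> K (\<lambda>v. h (vec t (\<lambda>j. f j v)))"
      if p: "(\<beta>, t) \<in> P" and h: "holder_smooth t \<beta> C h" "sup_norm_on (box t 0 1) h \<le> ereal R"
        and f: "\<forall>j<t. approx_bounded d c m1 \<gamma> K1 (f j)" for \<beta> t h f
    proof (rule approx_bounded_compose[OF _ \<gamma>0[OF p] \<gamma>_le[OF p] _ m1 K1 K2(1) _ K2(2)[OF p] h(1)])
      show "1 \<le> t" "1 \<le> \<beta>" using p P(2) by auto
      show "\<forall>x\<in>box t 0 1. \<bar>h x\<bar> \<le> R" using h(2) by (simp add: sup_norm_le)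
      have "t * m1 \<le> T * m1" using T[OF p] by (rule mult_right_mono) simp
      then show "t * m1 + 2 * m2 + t + m1 + 1 \<le> T * m1 + 2 * m2 + T + m1 + 1" using T[OF p] by linarith
      have "real (t + m2) * (K2 * K1) \<le> real (T + m2) * (K2 * K1)"
        using T[OF p] K0 by (intro mult_right_mono) auto
      then show "K1 + K2 + real (t + m2) * (K2 * K1) \<le> K" unfolding K_def by linarith
    qed (use f in auto)
    ultimately show ?thesis by blast
  qed
  {
    case base
    have "\<exists>K\<ge>1. \<forall>g\<in>hier_comp_bounded (ereal R) C P d 1.
      approx_bounded d c (T * 2 + 2 * m2 + T + 2 + 1) \<gamma> K (\<lambda>v. g (vec d v))" for R
    proof -
      \<comment> \<open>At the lowest level the inner functions are coordinates: \<open>c\<close>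
        bounds their values, and 2 is the constant required by
        \<open>approx_bounded_coord\<close>.\<close>
      have "1 \<le> max 2 c" by simp
      then obtain K where K: "1 \<le> K" "\<And>\<beta> t h f. (\<beta>, t) \<in> P \<Longrightarrow> holder_smooth t \<beta> C h \<Longrightarrow>
          sup_norm_on (box t 0 1) h \<le> ereal R \<Longrightarrow>
          (\<forall>j<t. approx_bounded d c 2 \<gamma> (max 2 c) (f j)) \<Longrightarrow>
          approx_bounded d c (T * 2 + 2 * m2 + T + 2 + 1) \<gamma> K (\<lambda>v. h (vec t (\<lambda>j. f j v)))"
        using comp[of 2 "max 2 c" R] by auto
      have "approx_bounded d c (T * 2 + 2 * m2 + T + 2 + 1) \<gamma> K (\<lambda>v. g (vec d v))"
        if mem: "g \<in> hier_comp_bounded (ereal R) C P d 1" for g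
      proof -
        obtain \<beta> t h \<pi> where *: "(\<beta>, t) \<in> P" "holder_smooth t \<beta> C h"
            "sup_norm_on (box t 0 1) h \<le> ereal R" "\<forall>j<t. \<pi> j < d"
            "\<forall>x\<in>carrier_vec d. g x = h (vec t (\<lambda>j. x $ \<pi> j))"
          using mem unfolding One_nat_def hier_comp_bounded.simps by blast
        have "approx_bounded d c (T * 2 + 2 * m2 + T + 2 + 1) \<gamma> K (\<lambda>v. h (vec t (\<lambda>j. v (\<pi> j))))"
          using *(4) by (intro K(2)[OF *(1-3)] allI impI approx_bounded_coord) auto
        moreover have "g (vec d v) = h (vec t (\<lambda>j. v (\<pi> j)))" for v
        proof -
          have "vec t (\<lambda>j. vec d v $ \<pi> j) = vec t (\<lambda>j. v (\<pi> j))" using *(4) by (intro eq_vecI) auto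
          then show ?thesis using *(5) by simp
        qed
        ultimately show ?thesis by simp
      qed
      then show ?thesis using K(1) by blast
    qed
    then show ?case by (intro exI[of _ "T * 2 + 2 * m2 + T + 2 + 1"]) auto
  next
    case (Suc l)
    then obtain m1 where m1: "1 \<le> m1" "\<And>R. \<exists>K\<ge>1. \<forall>g\<in>hier_comp_bounded (ereal R) C P d l.
      approx_bounded d c m1 \<gamma> K (\<lambda>v. g (vec d v))" by blast
    have "\<exists>K\<ge>1. \<forall>g\<in>hier_comp_bounded (ereal R) C P d (Suc l).
      approx_bounded d c (T * m1 + 2 * m2 + T + m1 + 1) \<gamma> K (\<lambda>v. g (vec d v))" for R
    proof -
      obtain K1 where K1: "1 \<le> K1" "\<And>g. g \<in> hier_comp_bounded (ereal R) C P d l \<Longrightarrow>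
        approx_bounded d c m1 \<gamma> K1 (\<lambda>v. g (vec d v))" using m1(2)[of R] by blast
      obtain K where K: "1 \<le> K" "\<And>\<beta> t h f. (\<beta>, t) \<in> P \<Longrightarrow> holder_smooth t \<beta> C h \<Longrightarrow>
          sup_norm_on (box t 0 1) h \<le> ereal R \<Longrightarrow>
          (\<forall>j<t. approx_bounded d c m1 \<gamma> K1 (f j)) \<Longrightarrow>
          approx_bounded d c (T * m1 + 2 * m2 + T + m1 + 1) \<gamma> K (\<lambda>v. h (vec t (\<lambda>j. f j v)))"
        using comp[OF m1(1) K1(1), of R] by blast
      obtain l' where l': "l = Suc l'" using Suc.hyps by (cases l) auto
      have "approx_bounded d c (T * m1 + 2 * m2 + T + m1 + 1) \<gamma> K (\<lambda>v. g (vec d v))"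
        if mem: "g \<in> hier_comp_bounded (ereal R) C P d (Suc l)" for g
      proof -
        obtain \<beta> t h f where *: "(\<beta>, t) \<in> P" "holder_smooth t \<beta> C h"
            "sup_norm_on (box t 0 1) h \<le> ereal R"
            "\<forall>j<t. f j \<in> hier_comp_bounded (ereal R) C P d l"
            "\<forall>x\<in>carrier_vec d. g x = h (vec t (\<lambda>j. f j x))"
          using mem unfolding l' hier_comp_bounded.simps by blast
        have "approx_bounded d c (T * m1 + 2 * m2 + T + m1 + 1) \<gamma> K (\<lambda>v. h (vec t (\<lambda>j. f j (vec d v))))"
          using *(4) by (intro K(2)[OF *(1-3)] allI impI K1(2)) auto
        then show ?thesis using *(5) by simp
      qed
      then show ?thesis using K(1) by blast
    qed
    then show ?case by (intro exI[of _ "T * m1 + 2 * m2 + T + m1 + 1"]) auto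
  }
qed

section \<open>Weight matrices\<close>

text \<open>Neurons receive positions through the injection \<open>idx\<close>. Positions outside
  its image get weight 0, so the entries of \<open>z\<close> there may be arbitrary.\<close>

lemma affine_in_row:
  assumes "affine_in B F h" "finite F" "inj_on idx F" "idx ` F \<subseteq> {..<n::nat}"
  shows "\<exists>r b. \<bar>b\<bar> \<le> B \<and> (\<forall>j. \<bar>r j\<bar> \<le> B) \<and>
    (\<forall>z v. (\<forall>f\<in>F. z (idx f) = f v) \<longrightarrow> (\<Sum>j<n. r j * z j) + b = h v)"
proof -
  obtain b c where *: "\<bar>b\<bar> \<le> B" "\<And>f. \<bar>c f\<bar> \<le> B" "\<And>v. h v = b + (\<Sum>f\<in>F. c f * f v)"
    using assms(1) unfolding affine_in_def by blast
  define r where "r j = (if j \<in> idx ` F then c (inv_into F idx j) else 0)" for j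
  have "\<bar>r j\<bar> \<le> B" for j using * affine_in_nonneg[OF assms(1)] by (simp add: r_def)
  moreover have "(\<Sum>j<n. r j * z j) + b = h v" if z: "\<forall>f\<in>F. z (idx f) = f v" for z v
  proof -
    have "(\<Sum>j<n. r j * z j) = (\<Sum>j\<in>idx ` F. r j * z j)"
      using assms(4) by (intro sum.mono_neutral_right) (auto simp: r_def)
    also have "\<dots> = (\<Sum>f\<in>F. r (idx f) * z (idx f))" using assms(3) by (simp add: sum.reindex)
    also have "\<dots> = (\<Sum>f\<in>F. c f * f v)"
      using assms(3) z by (intro sum.cong) (auto simp: r_def inv_into_f_f)
    finally show ?thesis using * by simp
  qed
  ultimately show ?thesis using *(1) by blast
qed

lemma hidden_layers_cong:
  assumes "\<And>k. 1 \<le> k \<Longrightarrow> k \<le> L \<Longrightarrow> W k = W' k \<and> b k = b' k"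
  shows "hidden_layers W b L z = hidden_layers W' b' L z"
  using assms by (induction L) auto

lemma affine_rows:
  assumes "z \<in> carrier_vec n" "i < m"
  shows "affine (mat m n (\<lambda>(i, j). r i j)) (vec m b) z $ i = (\<Sum>j<n. r i j * z $ j) + b i"
  using assms by (simp add: affine_def scalar_prod_def atLeast0LessThan)

definition weights_ok ::
  "nat \<Rightarrow> nat \<Rightarrow> real \<Rightarrow> nat \<Rightarrow> (nat \<Rightarrow> real mat) \<Rightarrow> (nat \<Rightarrow> real vec) \<Rightarrow> bool" where
  "weights_ok d w B L W b \<longleftrightarrow> (\<forall>k\<in>{1..L}.
        W k \<in> carrier_mat w (if k = 1 then d else w) \<and> b k \<in> carrier_vec w \<and>
        (\<forall>i<w. \<bar>b k $ i\<bar> \<le> B \<and> (\<forall>j<(if k = 1 then d else w). \<bar>W k $$ (i, j)\<bar> \<le> B)))"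

text \<open>A set of at most \<open>w\<close> neurons becomes a vector of length exactly
  \<open>w\<close>. Only the positions in the image of \<open>idx\<close> carry meaning; in the
  input layer these are the coordinate numbers, recovered from the projections because distinct
  projections are distinct functions.\<close>

lemma layers_matrix:
  assumes "layers d w B L F" "0 \<le> B"
  shows "\<exists>W b idx. weights_ok d w B L W b \<and>
      inj_on idx F \<and> idx ` F \<subseteq> {..<(if L = 0 then d else w)} \<and>
      (\<forall>x\<in>carrier_vec d. hidden_layers W b L x \<in> carrier_vec (if L = 0 then d else w) \<and>
        (\<forall>f\<in>F. hidden_layers W b L x $ idx f = f (\<lambda>j. x $ j)))"
  using assms(1)
proof (induction L arbitrary: F)
  case 0
  have inj: "inj_on (\<lambda>j (v::nat \<Rightarrow> real). v j) {..<d}"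
  proof (rule inj_onI)
    fix i j :: nat assume "(\<lambda>v::nat \<Rightarrow> real. v i) = (\<lambda>v. v j)"
    from fun_cong[OF this, of "\<lambda>k. if k = i then 1 else 0"] show "i = j" by (auto split: if_splits)
  qed
  let ?idx = "inv_into {..<d} (\<lambda>j (v::nat \<Rightarrow> real). v j)"
  have F: "F = (\<lambda>j v. v j) ` {..<d}" using 0 by (simp add: coords_def)
  have "?idx (\<lambda>v. v j) = j" if "j < d" for j using inv_into_f_f[OF inj, of j] that by simp
  then show ?case unfolding F
    by (intro exI[of _ undefined] exI[of _ undefined] exI[of _ ?idx]) (auto simp: inj_on_inv_into weights_ok_def)
next
  case (Suc L)
  obtain E where E: "layers d w B L E" "finite F" "card F \<le> w"
      "\<And>g. g \<in> F \<Longrightarrow> \<exists>h. affine_in B E h \<and> g = (\<lambda>v. relu (h v))"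
    using Suc.prems by auto
  let ?n = "if L = 0 then d else w"
  obtain W b idx where H: "weights_ok d w B L W b \<and> inj_on idx E \<and> idx ` E \<subseteq> {..<?n} \<and>
      (\<forall>x\<in>carrier_vec d. hidden_layers W b L x \<in> carrier_vec ?n \<and>
        (\<forall>f\<in>E. hidden_layers W b L x $ idx f = f (\<lambda>j. x $ j)))"
    using Suc.IH[OF E(1)] by (elim exE) (rule that)
  have W: "\<And>k. k \<in> {1..L} \<Longrightarrow>
        W k \<in> carrier_mat w (if k = 1 then d else w) \<and> b k \<in> carrier_vec w \<and>
        (\<forall>i<w. \<bar>b k $ i\<bar> \<le> B \<and> (\<forall>j<(if k = 1 then d else w). \<bar>W k $$ (i, j)\<bar> \<le> B))"
    using H unfolding weights_ok_def by blast
  have idx: "inj_on idx E" "idx ` E \<subseteq> {..<?n}" using H by blast+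
  have z: "hidden_layers W b L x \<in> carrier_vec ?n"
      "f \<in> E \<Longrightarrow> hidden_layers W b L x $ idx f = f (\<lambda>j. x $ j)" if "x \<in> carrier_vec d" for x f
    using H that by blast+
  have "\<exists>rb. \<bar>snd rb\<bar> \<le> B \<and> (\<forall>j. \<bar>fst rb j\<bar> \<le> B) \<and>
    (\<forall>z v. (\<forall>f\<in>E. z (idx f) = f v) \<longrightarrow> relu ((\<Sum>j<?n. fst rb j * z j) + snd rb) = g v)"
    if g: "g \<in> F" for g
  proof -
    obtain h where h: "affine_in B E h" "g = (\<lambda>v. relu (h v))" using E(4)[OF g] by blast
    from affine_in_row[OF h(1) layers_finite[OF E(1)] idx] obtain r b' where
      "\<bar>b'\<bar> \<le> B" "\<forall>j. \<bar>r j\<bar> \<le> B"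
      "\<forall>z v. (\<forall>f\<in>E. z (idx f) = f v) \<longrightarrow> (\<Sum>j<?n. r j * z j) + b' = h v" by blast
    moreover have "relu ((\<Sum>j<?n. r j * z j) + b') = g v" if "\<forall>f\<in>E. z (idx f) = f v" for z v
      unfolding h(2) using that calculation(3) by (intro arg_cong[of _ _ relu]) blast
    ultimately show ?thesis by (intro exI[of _ "(r, b')"]) simp
  qed
  then have "\<forall>g. \<exists>rb. g \<in> F \<longrightarrow> \<bar>snd rb\<bar> \<le> B \<and> (\<forall>j. \<bar>fst rb j\<bar> \<le> B) \<and>
    (\<forall>z v. (\<forall>f\<in>E. z (idx f) = f v) \<longrightarrow> relu ((\<Sum>j<?n. fst rb j * z j) + snd rb) = g v)"
    by blast
  from choice[OF this] obtain rb where rb: "\<And>g. g \<in> F \<Longrightarrow> \<bar>snd (rb g)\<bar> \<le> B"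
      "\<And>g j. g \<in> F \<Longrightarrow> \<bar>fst (rb g) j\<bar> \<le> B"
      "\<And>g z v. g \<in> F \<Longrightarrow> (\<forall>f\<in>E. z (idx f) = f v) \<Longrightarrow>
         relu ((\<Sum>j<?n. fst (rb g) j * z j) + snd (rb g)) = g v"
    by blast
  obtain idx' and n' :: nat where idx': "idx' ` F = {i. i < n'}" "inj_on idx' F"
    using finite_imp_inj_to_nat_seg[OF E(2)] by blast
  have "n' = card F" using card_image[OF idx'(2)] unfolding idx'(1) by simp
  then have idx'w: "idx' ` F \<subseteq> {..<w}" using idx'(1) E(3) by auto
  \<comment> \<open>Rows without a neuron get zero weights and zero bias, which fills the layer up
    to width \<open>w\<close> within the bound \<open>B\<close>.\<close>
  define r where "r i j = (if i \<in> idx' ` F then fst (rb (inv_into F idx' i)) j else 0)" for i j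
  define c where "c i = (if i \<in> idx' ` F then snd (rb (inv_into F idx' i)) else 0)" for i
  define W' where "W' = W(Suc L := mat w ?n (\<lambda>(i, j). r i j))"
  define b' where "b' = b(Suc L := vec w c)"
  have rc: "\<bar>r i j\<bar> \<le> B" "\<bar>c i\<bar> \<le> B" for i j
    using rb inv_into_into[of i idx' F] assms(2) by (auto simp: r_def c_def)
  have hl: "hidden_layers W' b' L x = hidden_layers W b L x" for x
    by (rule hidden_layers_cong) (auto simp: W'_def b'_def)
  have hS: "hidden_layers W' b' (Suc L) x
      = map_vec relu (affine (mat w ?n (\<lambda>(i, j). r i j)) (vec w c) (hidden_layers W b L x))" for x
    by (simp add: hl) (simp add: W'_def b'_def)
  show ?case
    unfolding weights_ok_def
  proof (intro exI[of _ W'] exI[of _ b'] exI[of _ idx'] conjI ballI)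
    fix k assume k: "k \<in> {1..Suc L}"
    show "W' k \<in> carrier_mat w (if k = 1 then d else w)"
    and "b' k \<in> carrier_vec w"
    and "\<forall>i<w. \<bar>b' k $ i\<bar> \<le> B \<and> (\<forall>j<(if k = 1 then d else w). \<bar>W' k $$ (i, j)\<bar> \<le> B)"
      using W[of k] k rc by (cases "k = Suc L"; auto simp: W'_def b'_def)+
  next
    show "inj_on idx' F" by (rule idx'(2))
    show "idx' ` F \<subseteq> {..<(if Suc L = 0 then d else w)}" using idx'w by simp
  next
    fix x :: "real vec" assume x: "x \<in> carrier_vec d"
    show "hidden_layers W' b' (Suc L) x \<in> carrier_vec (if Suc L = 0 then d else w)"
      by (rule carrier_vecI) (simp only: hS affine_def index_map_vec index_add_vec dim_vec
        nat.distinct if_False)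
    fix f assume f: "f \<in> F"
    have i: "idx' f < w" using idx'w f by auto
    have dimv: "dim_vec (affine (mat w ?n (\<lambda>(i, j). r i j)) (vec w c) (hidden_layers W b L x)) = w"
      by (simp only: affine_def index_add_vec dim_vec)
    have "hidden_layers W' b' (Suc L) x $ idx' f
        = relu ((\<Sum>j<?n. r (idx' f) j * hidden_layers W b L x $ j) + c (idx' f))"
      unfolding hS using affine_rows[OF z(1)[OF x] i, of r c] i dimv by (simp only: index_map_vec)
    also have "\<dots> = relu ((\<Sum>j<?n. fst (rb f) j * hidden_layers W b L x $ j) + snd (rb f))"
      using f idx'(2) by (simp add: r_def c_def inv_into_f_f)
    also have "\<dots> = f (\<lambda>j. x $ j)" using z(2)[OF x] by (intro rb(3)[OF f]) auto
    finally show "hidden_layers W' b' (Suc L) x $ idx' f = f (\<lambda>j. x $ j)" .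
  qed
qed

lemma NN_relu_networks:
  assumes "\<phi> \<in> NN d L w B" "1 \<le> L"
  shows "\<exists>f\<in>relu_networks L d 1 w \<infinity> B. \<forall>x\<in>carrier_vec d. f x $ 0 = \<phi> (\<lambda>j. x $ j)"
proof -
  obtain F where F: "layers d w B L F" "affine_in B F \<phi>" using assms(1) by (auto simp: NN_def)
  have B: "0 \<le> B" using affine_in_nonneg[OF F(2)] .
  have L0: "(if L = 0 then d else w) = w" using assms(2) by simp
  obtain W b idx where H: "weights_ok d w B L W b \<and> inj_on idx F \<and> idx ` F \<subseteq> {..<w} \<and>
      (\<forall>x\<in>carrier_vec d. hidden_layers W b L x \<in> carrier_vec w \<and>
        (\<forall>f\<in>F. hidden_layers W b L x $ idx f = f (\<lambda>j. x $ j)))"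
    using layers_matrix[OF F(1) B] unfolding L0 by (elim exE) (rule that)
  have W: "\<And>k. k \<in> {1..L} \<Longrightarrow>
        W k \<in> carrier_mat w (if k = 1 then d else w) \<and> b k \<in> carrier_vec w \<and>
        (\<forall>i<w. \<bar>b k $ i\<bar> \<le> B \<and> (\<forall>j<(if k = 1 then d else w). \<bar>W k $$ (i, j)\<bar> \<le> B))"
    using H unfolding weights_ok_def by blast
  have idx: "inj_on idx F" "idx ` F \<subseteq> {..<w}" using H by blast+
  have z: "hidden_layers W b L x \<in> carrier_vec w"
      "f \<in> F \<Longrightarrow> hidden_layers W b L x $ idx f = f (\<lambda>j. x $ j)" if "x \<in> carrier_vec d" for x f
    using H that by blast+
  obtain r c where r: "\<bar>c\<bar> \<le> B" "\<And>j. \<bar>r j\<bar> \<le> B"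
      "\<And>z v. (\<forall>f\<in>F. z (idx f) = f v) \<Longrightarrow> (\<Sum>j<w. r j * z j) + c = \<phi> v"
    using affine_in_row[OF F(2) layers_finite[OF F(1)] idx] by blast
  define W' where "W' = W(L + 1 := mat 1 w (\<lambda>(i, j). r j))"
  define b' where "b' = b(L + 1 := vec 1 (\<lambda>_. c))"
  have hl: "hidden_layers W' b' L x = hidden_layers W b L x" for x
    by (rule hidden_layers_cong) (auto simp: W'_def b'_def)
  define f where "f x = map_vec (trunc_at \<infinity>) (network W' b' L x)" for x
  have "f \<in> relu_networks L d 1 w \<infinity> B"
    unfolding relu_networks_def mem_Collect_eq
  proof (intro exI[of _ W'] exI[of _ b'] conjI ballI)
    fix k assume k: "k \<in> {1..L + 1}"
    have dims: "layer_dim L d 1 w k = (if k = L + 1 then 1 else w)"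
      "layer_dim L d 1 w (k - 1) = (if k = 1 then d else w)"
      using k by (auto simp: layer_dim_def)
    show "W' k \<in> carrier_mat (layer_dim L d 1 w k) (layer_dim L d 1 w (k - 1))"
      and "b' k \<in> carrier_vec (layer_dim L d 1 w k)"
      and "\<forall>i<layer_dim L d 1 w k. \<bar>b' k $ i\<bar> \<le> B \<and>
        (\<forall>j<layer_dim L d 1 w (k - 1). \<bar>W' k $$ (i, j)\<bar> \<le> B)"
      unfolding dims using W[of k] k r(1,2) assms(2)
      by (cases "k = L + 1"; auto simp: W'_def b'_def)+
  qed (simp add: f_def)
  moreover have "f x $ 0 = \<phi> (\<lambda>j. x $ j)" if x: "x \<in> carrier_vec d" for x
  proof -
    have net: "network W' b' L x = affine (mat 1 w (\<lambda>(i, j). r j)) (vec 1 (\<lambda>_. c)) (hidden_layers W b L x)"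
      unfolding network_def hl by (simp add: W'_def b'_def)
    have "f x $ 0 = network W' b' L x $ 0"
      unfolding f_def net by (simp add: affine_def)
    also have "\<dots> = (\<Sum>j<w. r j * hidden_layers W b L x $ j) + c"
      unfolding net using affine_rows[OF z(1)[OF x], of 0 1 "\<lambda>_. r" "\<lambda>_. c"] by simp
    also have "\<dots> = \<phi> (\<lambda>j. x $ j)" using z(2)[OF x] by (intro r(3)) auto
    finally show ?thesis .
  qed
  ultimately show ?thesis by blast
qed

lemma NN_sup_norm:
  assumes "\<phi> \<in> NN d L w B" "1 \<le> L" "A \<subseteq> carrier_vec d"
    and "\<And>x. x \<in> A \<Longrightarrow> \<bar>\<phi> (\<lambda>j. x $ j) - g x\<bar> \<le> E"
  shows "\<exists>f\<in>relu_networks L d 1 w \<infinity> B. sup_norm_on A (\<lambda>x. f x $ 0 - g x) \<le> ereal E"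
proof -
  obtain f where f: "f \<in> relu_networks L d 1 w \<infinity> B" "\<And>x. x \<in> carrier_vec d \<Longrightarrow> f x $ 0 = \<phi> (\<lambda>j. x $ j)"
    using NN_relu_networks[OF assms(1,2)] by blast
  have "\<forall>x\<in>A. \<bar>f x $ 0 - g x\<bar> \<le> E" using f(2) assms(3,4) by auto
  then have "sup_norm_on A (\<lambda>x. f x $ 0 - g x) \<le> ereal E" unfolding sup_norm_le .
  with f(1) show ?thesis by blast
qed

lemma vec_index_id: "x \<in> carrier_vec d \<Longrightarrow> vec d (\<lambda>j. x $ j) = x"
  by (intro eq_vecI) auto

text \<open>Why the last two constants follow \<open>R\<close>: smoothness restrains only
  derivatives of top order, so every constant function satisfies it, while for fixed
  \<open>N\<close> the outputs of all networks of the given size and weights are bounded on the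
  cube. Hence \<open>c3\<close> and \<open>c5\<close> cannot both be independent of the size of
  \<open>g\<close>. By \<open>hier_comp_eq_Union\<close>, letting \<open>R\<close> vary covers the
  whole hierarchical class.\<close>

theorem theorem4:
  fixes d :: nat and C :: real
  assumes "1 \<le> d" and "0 < C"
  shows
    "(\<forall>\<beta>>0. \<exists>c1>0. \<exists>c2>0. \<exists>c4>0. \<forall>R. \<exists>c3>0. \<exists>c5>0.
        \<forall>g. holder_smooth d \<beta> C g \<and> sup_norm_on (box d 0 1) g \<le> ereal R \<longrightarrow>
          (\<forall>N\<ge>2. \<exists>g\<^sub>N \<in> relu_networks c1 d 1 (c2 * N) \<infinity> (c3 * real N powr c4).
             sup_norm_on (box d 0 1) (\<lambda>x. g\<^sub>N x $ 0 - g x)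
               \<le> ereal (c5 * real N powr (- (2 * \<beta> / real d)))))
     \<and>
     (\<forall>l\<ge>1. \<forall>P. \<forall>c6>0.
        finite P \<and> P \<subseteq> {1..} \<times> {1..} \<and> bdd_above ((\<lambda>(\<beta>, t). max \<beta> (real t)) ` P) \<longrightarrow>
        (\<exists>c7>0. \<exists>c8>0. \<exists>c10>0. \<forall>R. \<exists>c9>0. \<exists>c11>0.
          \<forall>g \<in> hier_comp_bounded (ereal R) C P d l.
            (\<forall>x \<in> carrier_vec d - box d (- c6) c6. g x = 0) \<longrightarrow>
            (\<forall>N\<ge>2. \<exists>g\<^sub>N \<in> relu_networks c7 d 1 (c8 * N) \<infinity> (c9 * real N powr c10).
               sup_norm_on (box d (- c6) c6) (\<lambda>x. g\<^sub>N x $ 0 - g x)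
                 \<le> ereal (c11 * real N powr (- (INF (\<beta>, t)\<in>P. 2 * \<beta> / real t))))))"
proof (intro conjI allI impI)
  fix \<beta> :: real assume \<beta>: "0 < \<beta>"
  obtain m0 where m0: "\<And>m R B. m0 \<le> m \<Longrightarrow> \<exists>K0. \<forall>K\<ge>K0. holder_approx \<beta> d C m R B K"
    using holder_approx_exists[OF assms(1) \<beta> assms(2)] by blast
  define m where "m = max m0 1"
  have m: "m0 \<le> m" "1 \<le> m" by (auto simp: m_def)
  have *: "\<exists>c3>0. \<exists>c5>0. \<forall>g. holder_smooth d \<beta> C g \<and> sup_norm_on (box d 0 1) g \<le> ereal R \<longrightarrow>
          (\<forall>N\<ge>2. \<exists>g\<^sub>N \<in> relu_networks m d 1 (m * N) \<infinity> (c3 * real N powr real m).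
             sup_norm_on (box d 0 1) (\<lambda>x. g\<^sub>N x $ 0 - g x)
               \<le> ereal (c5 * real N powr (- (2 * \<beta> / real d))))" for R
  proof -
    \<comment> \<open>The radius 1 gives the cube \<open>[-1, 1]\<close>, which contains the unit
      cube.\<close>
    obtain K0 where "\<And>K. K0 \<le> K \<Longrightarrow> holder_approx \<beta> d C m R 1 K" using m0[OF m(1)] by blast
    then have K: "holder_approx \<beta> d C m R 1 (max K0 1)" by simp
    show ?thesis
    proof (intro exI[of _ "max K0 1"] conjI allI impI; (elim conjE)?)
      fix g and N :: nat
      assume g: "holder_smooth d \<beta> C g" "sup_norm_on (box d 0 1) g \<le> ereal R" and N: "2 \<le> N"
      obtain \<phi> where \<phi>: "\<phi> \<in> NN d m (m * N) (max K0 1 * real N ^ m)"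
        "\<And>v. sup_le d 1 v \<Longrightarrow>
           \<bar>\<phi> v - g (vec d v)\<bar> \<le> max K0 1 * real N powr (- (2 * \<beta> / real d))"
        using K g N unfolding holder_approx_def sup_norm_le by blast
      have "\<phi> \<in> NN d m (m * N) (max K0 1 * real N powr real m)"
        using \<phi>(1) N by (simp add: powr_realpow)
      then show "\<exists>g\<^sub>N \<in> relu_networks m d 1 (m * N) \<infinity> (max K0 1 * real N powr real m).
             sup_norm_on (box d 0 1) (\<lambda>x. g\<^sub>N x $ 0 - g x)
               \<le> ereal (max K0 1 * real N powr (- (2 * \<beta> / real d)))"
      proof (rule NN_sup_norm[OF _ m(2)])
        show "box d 0 1 \<subseteq> carrier_vec d" by (auto simp: box_def)
        fix x assume "x \<in> box d 0 1"
        then show "\<bar>\<phi> (\<lambda>j. x $ j) - g x\<bar> \<le> max K0 1 * real N powr (- (2 * \<beta> / real d))"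
          using \<phi>(2)[of "\<lambda>j. x $ j"] vec_index_id[of x d] by (auto simp: box_def)
      qed
    qed auto
  qed
  have pos: "0 < m" "0 < real m" using m(2) by simp_all
  show "\<exists>c1>0. \<exists>c2>0. \<exists>c4>0. \<forall>R. \<exists>c3>0. \<exists>c5>0.
        \<forall>g. holder_smooth d \<beta> C g \<and> sup_norm_on (box d 0 1) g \<le> ereal R \<longrightarrow>
          (\<forall>N\<ge>2. \<exists>g\<^sub>N \<in> relu_networks c1 d 1 (c2 * N) \<infinity> (c3 * real N powr c4).
             sup_norm_on (box d 0 1) (\<lambda>x. g\<^sub>N x $ 0 - g x)
               \<le> ereal (c5 * real N powr (- (2 * \<beta> / real d))))"
    by (intro exI[of _ m] exI[of _ "real m"] conjI pos allI[OF *])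
next
  fix l :: nat and P :: "(real \<times> nat) set" and c6 :: real
  assume l: "1 \<le> l" and P: "finite P \<and> P \<subseteq> {1..} \<times> {1..} \<and> bdd_above ((\<lambda>(\<beta>, t). max \<beta> (real t)) ` P)"
  define \<gamma> where "\<gamma> = (INF (\<beta>, t)\<in>P. 2 * \<beta> / real t)"
  obtain m where m: "1 \<le> m" "\<And>R. \<exists>K\<ge>1. \<forall>g\<in>hier_comp_bounded (ereal R) C P d l.
      approx_bounded d c6 m \<gamma> K (\<lambda>v. g (vec d v))"
    using hier_approx[OF _ _ assms(2) l \<gamma>_def] P by blast
  have *: "\<exists>c9>0. \<exists>c11>0. \<forall>g \<in> hier_comp_bounded (ereal R) C P d l.
            (\<forall>x \<in> carrier_vec d - box d (- c6) c6. g x = 0) \<longrightarrow>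
            (\<forall>N\<ge>2. \<exists>g\<^sub>N \<in> relu_networks m d 1 (m * N) \<infinity> (c9 * real N powr real m).
               sup_norm_on (box d (- c6) c6) (\<lambda>x. g\<^sub>N x $ 0 - g x)
                 \<le> ereal (c11 * real N powr (- \<gamma>)))" for R
  proof -
    obtain K where K: "1 \<le> K" "\<And>g. g \<in> hier_comp_bounded (ereal R) C P d l \<Longrightarrow>
      approx_bounded d c6 m \<gamma> K (\<lambda>v. g (vec d v))" using m(2)[of R] by blast
    show ?thesis
    proof (intro exI[of _ K] conjI ballI allI impI)
      fix g and N :: nat
      assume g: "g \<in> hier_comp_bounded (ereal R) C P d l" and N: "2 \<le> N"
      obtain \<phi> where \<phi>: "\<phi> \<in> NN d m (m * N) (K * real N ^ m)"
        "\<And>v. sup_le d c6 v \<Longrightarrow> \<bar>\<phi> v - g (vec d v)\<bar> \<le> K * real N powr (- \<gamma>)"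
        using K(2)[OF g] N unfolding approx_bounded_def by blast
      have "\<phi> \<in> NN d m (m * N) (K * real N powr real m)"
        using \<phi>(1) N by (simp add: powr_realpow)
      then show "\<exists>g\<^sub>N \<in> relu_networks m d 1 (m * N) \<infinity> (K * real N powr real m).
               sup_norm_on (box d (- c6) c6) (\<lambda>x. g\<^sub>N x $ 0 - g x)
                 \<le> ereal (K * real N powr (- \<gamma>))"
      proof (rule NN_sup_norm[OF _ m(1)])
        show "box d (- c6) c6 \<subseteq> carrier_vec d" by (auto simp: box_def)
        fix x assume "x \<in> box d (- c6) c6"
        then have "\<forall>j<d. \<bar>x $ j\<bar> \<le> c6" "x \<in> carrier_vec d" by (auto simp: box_def abs_le_iff minus_le_iff)
        then show "\<bar>\<phi> (\<lambda>j. x $ j) - g x\<bar> \<le> K * real N powr (- \<gamma>)"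
          using \<phi>(2)[of "\<lambda>j. x $ j"] vec_index_id[of x d] by simp
      qed
    qed (use K(1) in auto)
  qed
  have pos: "0 < m" "0 < real m" using m(1) by simp_all
  show "\<exists>c7>0. \<exists>c8>0. \<exists>c10>0. \<forall>R. \<exists>c9>0. \<exists>c11>0.
          \<forall>g \<in> hier_comp_bounded (ereal R) C P d l.
            (\<forall>x \<in> carrier_vec d - box d (- c6) c6. g x = 0) \<longrightarrow>
            (\<forall>N\<ge>2. \<exists>g\<^sub>N \<in> relu_networks c7 d 1 (c8 * N) \<infinity> (c9 * real N powr c10).
               sup_norm_on (box d (- c6) c6) (\<lambda>x. g\<^sub>N x $ 0 - g x)
                 \<le> ereal (c11 * real N powr (- (INF (\<beta>, t)\<in>P. 2 * \<beta> / real t))))"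
    unfolding \<gamma>_def[symmetric]
    by (intro exI[of _ m] exI[of _ "real m"] conjI pos allI[OF *])
qed

end
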